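(* Let $g:\mathbb{N}\to\mathbb{N}_0$ be a genus function, let $\mathcal A^g$ be any one of $\mathcal E^g$, $\mathcal O\mathcal E^g$, $\mathcal N\mathcal E^g$ or $\mathcal O\mathcal E^g\cap\mathcal N\mathcal E^g$, and let $\tilde R_n$ be chosen uniformly at random from $\mathrm{Minor}(\widetilde{\mathcal A}^g)_n$. (a) If $\widetilde{\mathcal A}^g$ contains all graphs, then $\tilde R_n$ is connected with very high probability; indeed $\mathbb{P}(\tilde R_n\text{ not connected})\sim n2^{-n+1}$. (b) If $g$ is non-decreasing and $\widetilde{\mathcal A}^g$ does not contain all graphs, then $\liminf_{n\to\infty}\mathbb{P}(\tilde R_n\text{ is connected})<1$.
   Context: All graphs are finite and simple. $\mathcal E^g$ is the class of graphs $G$ such that, if $G$ has $n$ vertices, $G$ embeds in some surface of Euler genus at most $g(n)$; $\mathcal O\mathcal E^g$ / $\mathcal N\mathcal E^g$ require the surface to be orientable / non-orientable. $\mathrm{Minor}(\mathcal B)$ is the class of graphs all of whose minors lie in $\mathcal B$. For a class $\mathcal B$ of labelled graphs, $\widetilde{\mathcal B}$ is the corresponding set of unlabelled graphs (isomorphism classes), and $\widetilde{\mathcal B}_n$ those with $n$ vertices. With very high probability means with probability $1-e^{-\Omega(n)}$; $a_n\sim b_n$ means $a_n/b_n\to1$. *)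

theory Defs
  imports "HOL-Probability.Probability" "HOL-Library.Landau_Symbols"
begin

section \<open>Finite simple graphs and minors\<close>

text \<open>Vertices are natural numbers; the null graph is excluded, since orders range
  over the positive integers.\<close>

type_synonym ugraph = "nat set \<times> nat set set"

abbreviation verts :: "ugraph \<Rightarrow> nat set" where "verts \<equiv> fst"
abbreviation edges :: "ugraph \<Rightarrow> nat set set" where "edges \<equiv> snd"

definition simple_graph :: "ugraph \<Rightarrow> bool" where
  "simple_graph G \<longleftrightarrow>
     finite (verts G) \<and> verts G \<noteq> {} \<and> edges G \<subseteq> {e. e \<subseteq> verts G \<and> card e = 2}"

definition all_graphs :: "ugraph set" where
  "all_graphs = {G. simple_graph G}"

definition graph_order :: "ugraph \<Rightarrow> nat" where
  "graph_order G = card (verts G)"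

definition connected_graph :: "ugraph \<Rightarrow> bool" where
  "connected_graph G \<longleftrightarrow> verts G \<noteq> {} \<and>
     (\<forall>u\<in>verts G. \<forall>v\<in>verts G. (u, v) \<in> {(x, y). {x, y} \<in> edges G}\<^sup>*)"

definition induced :: "ugraph \<Rightarrow> nat set \<Rightarrow> ugraph" where
  "induced G B = (B, {e \<in> edges G. e \<subseteq> B})"

text \<open>Minors via branch sets: \<open>\<beta> x\<close> is contracted to the vertex \<open>x\<close> of \<open>H\<close>, and vertices in no
  branch set are deleted. Every isomorphic copy of a minor counts as a minor.\<close>

definition minor_of :: "ugraph \<Rightarrow> ugraph \<Rightarrow> bool" where
  "minor_of H G \<longleftrightarrow> simple_graph H \<and> simple_graph G \<and>
     (\<exists>\<beta>. (\<forall>x\<in>verts H. \<beta> x \<subseteq> verts G \<and> connected_graph (induced G (\<beta> x))) \<and>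
          (\<forall>x\<in>verts H. \<forall>y\<in>verts H. x \<noteq> y \<longrightarrow> \<beta> x \<inter> \<beta> y = {}) \<and>
          (\<forall>x y. {x, y} \<in> edges H \<longrightarrow> (\<exists>u\<in>\<beta> x. \<exists>v\<in>\<beta> y. {u, v} \<in> edges G)))"

definition Minor :: "ugraph set \<Rightarrow> ugraph set" where
  "Minor \<B> = {G. simple_graph G \<and> (\<forall>H. minor_of H G \<longrightarrow> H \<in> \<B>)}"


section \<open>Unlabelled graphs\<close>

definition iso_rel :: "(ugraph \<times> ugraph) set" where
  "iso_rel = {(G, H). simple_graph G \<and> simple_graph H \<and>
     (\<exists>f. bij_betw f (verts G) (verts H) \<and> edges H = (\<lambda>e. f ` e) ` edges G)}"

definition unlabelled :: "ugraph set \<Rightarrow> ugraph set set" where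
  "unlabelled \<B> = \<B> // iso_rel"

definition unlabelled_of_order :: "ugraph set \<Rightarrow> nat \<Rightarrow> ugraph set set" where
  "unlabelled_of_order \<B> n = {R \<in> unlabelled \<B>. \<forall>G\<in>R. graph_order G = n}"

definition unlabelled_connected :: "ugraph set \<Rightarrow> bool" where
  "unlabelled_connected R \<longleftrightarrow> (\<forall>G\<in>R. connected_graph G)"

lemma equiv_iso_rel: "equiv all_graphs iso_rel"
proof (rule equivI)
  show "iso_rel \<subseteq> all_graphs \<times> all_graphs"
    by (auto simp: iso_rel_def all_graphs_def)
  show "refl_on all_graphs iso_rel"
    unfolding refl_on_def iso_rel_def all_graphs_def
    by (auto intro!: exI[of _ id] bij_betw_id)
  show "sym iso_rel"
  proof (rule symI)
    fix G H assume "(G, H) \<in> iso_rel"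
    then obtain f where G: "simple_graph G" and H: "simple_graph H"
      and f: "bij_betw f (verts G) (verts H)" and E: "edges H = (\<lambda>e. f ` e) ` edges G"
      by (auto simp: iso_rel_def)
    let ?g = "inv_into (verts G) f"
    have "?g ` f ` e = e" if "e \<in> edges G" for e
      using that G bij_betw_imp_inj_on[OF f]
      by (intro inv_into_image_cancel) (auto simp: simple_graph_def)
    then have "edges G = (\<lambda>e. ?g ` e) ` edges H"
      unfolding E by (auto simp: image_image image_iff)
    then show "(H, G) \<in> iso_rel"
      using G H bij_betw_inv_into[OF f] by (auto simp: iso_rel_def)
  qed
  show "trans iso_rel"
  proof (rule transI)
    fix G H K assume "(G, H) \<in> iso_rel" "(H, K) \<in> iso_rel"
    then obtain f g where "simple_graph G" "simple_graph K"
      and "bij_betw f (verts G) (verts H)" "edges H = (\<lambda>e. f ` e) ` edges G"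
      and "bij_betw g (verts H) (verts K)" "edges K = (\<lambda>e. g ` e) ` edges H"
      by (auto simp: iso_rel_def)
    then show "(G, K) \<in> iso_rel"
      by (auto simp: iso_rel_def image_comp comp_def intro!: exI[of _ "g \<circ> f"] bij_betw_trans)
  qed
qed


section \<open>Closed surfaces\<close>

text \<open>Surfaces are given by their standard polygonal normal forms. A word \<open>w\<close> is a list of
  letters with exponent \<open>+1\<close> (\<open>True\<close>) or \<open>-1\<close> (\<open>False\<close>). The unit circle is divided into
  \<open>length w\<close> equal sides; the \<open>i\<close>-th side carries the \<open>i\<close>-th letter and is traversed
  counterclockwise iff its exponent is \<open>+1\<close>. Sides with the same letter are glued.\<close>

definition polygon_side :: "(nat \<times> bool) list \<Rightarrow> nat \<Rightarrow> real \<Rightarrow> complex" where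
  "polygon_side w i t =
     cis (2 * pi * (real i + (if snd (w ! i) then t else 1 - t)) / real (length w))"

definition side_pairs :: "(nat \<times> bool) list \<Rightarrow> (complex \<times> complex) set" where
  "side_pairs w = {(polygon_side w i t, polygon_side w j t) | i j t.
     i < length w \<and> j < length w \<and> fst (w ! i) = fst (w ! j) \<and> 0 \<le> t \<and> t \<le> 1}"

definition glue :: "(nat \<times> bool) list \<Rightarrow> (complex \<times> complex) set" where
  "glue w = (side_pairs w)\<^sup>* \<inter> (cball 0 1 \<times> cball 0 1)"

definition polygon_surface :: "(nat \<times> bool) list \<Rightarrow> complex set topology" where
  "polygon_surface w = topology (\<lambda>U. U \<subseteq> cball 0 1 // glue w \<and>
     openin (top_of_set (cball 0 1)) (\<Union>U))"

text \<open>The words \<open>a a\<^sup>-\<^sup>1\<close> for the sphere, the product of the commutators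
  \<open>a\<^sub>i b\<^sub>i a\<^sub>i\<^sup>-\<^sup>1 b\<^sub>i\<^sup>-\<^sup>1\<close> for the sphere with \<open>h > 0\<close> handles, and the product of the squares
  \<open>a\<^sub>i a\<^sub>i\<close> for the sphere with \<open>k > 0\<close> crosscaps.\<close>

definition sphere_with_handles :: "nat \<Rightarrow> complex set topology" where
  "sphere_with_handles h = polygon_surface
     (if h = 0 then [(0, True), (0, False)]
      else concat (map (\<lambda>i. [(2*i, True), (2*i+1, True), (2*i, False), (2*i+1, False)]) [0..<h]))"

definition sphere_with_crosscaps :: "nat \<Rightarrow> complex set topology" where
  "sphere_with_crosscaps k = polygon_surface
     (if k = 0 then [(0, True), (0, False)]
      else concat (map (\<lambda>i. [(i, True), (i, True)]) [0..<k]))"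

definition orientable_surface :: "nat \<Rightarrow> complex set topology \<Rightarrow> bool" where
  "orientable_surface e S \<longleftrightarrow> (\<exists>h. e = 2 * h \<and> S = sphere_with_handles h)"

text \<open>The flag \<open>z\<close> selects whether the sphere is admitted as the degenerate non-orientable
  surface of Euler genus \<open>0\<close>. It matters only for graph orders with \<open>g n = 0\<close>, where
  conventions differ.\<close>

definition nonorientable_surface :: "bool \<Rightarrow> nat \<Rightarrow> complex set topology \<Rightarrow> bool" where
  "nonorientable_surface z e S \<longleftrightarrow> (e \<ge> 1 \<or> z) \<and> S = sphere_with_crosscaps e"

lemma equiv_glue: "equiv (cball 0 1) (glue w)"
proof (rule equivI)
  show "glue w \<subseteq> cball 0 1 \<times> cball 0 1" and "refl_on (cball 0 1) (glue w)"
    by (auto simp: glue_def refl_on_def)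
  have "sym (side_pairs w)"
    unfolding side_pairs_def sym_def by fastforce
  then show "sym (glue w)"
    unfolding glue_def by (intro sym_Int sym_rtrancl) (auto intro: symI)
  show "trans (glue w)"
    by (auto simp: glue_def trans_def)
qed

lemma openin_polygon_surface:
  "openin (polygon_surface w) U \<longleftrightarrow>
     U \<subseteq> cball 0 1 // glue w \<and> openin (top_of_set (cball 0 1)) (\<Union>U)"
proof -
  let ?P = "\<lambda>U. U \<subseteq> cball 0 1 // glue w \<and> openin (top_of_set (cball 0 1)) (\<Union>U)"
  have "?P (U \<inter> V)" if "?P U" "?P V" for U V
  proof -
    have "\<Union>(U \<inter> V) = \<Union>U \<inter> \<Union>V"
    proof (intro equalityI subsetI)
      fix x assume "x \<in> \<Union>U \<inter> \<Union>V"
      then obtain b c where bc: "b \<in> U" "c \<in> V" "x \<in> b" "x \<in> c" by blast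
      with that have "b = c" using quotient_disj[OF equiv_glue, of b w c] by blast
      with bc show "x \<in> \<Union>(U \<inter> V)" by blast
    qed blast
    moreover have "U \<inter> V \<subseteq> cball 0 1 // glue w" using that(1) by blast
    ultimately show ?thesis using that by (simp only: openin_Int)
  qed
  moreover have "?P (\<Union>K)" if "\<forall>U\<in>K. ?P U" for K
  proof -
    have "\<Union>(\<Union>K) = \<Union>(Union ` K)" by auto
    moreover have "openin (top_of_set (cball 0 1)) (\<Union>(Union ` K))"
      using that by (intro openin_Union) blast
    moreover have "\<Union>K \<subseteq> cball 0 1 // glue w" using that by blast
    ultimately show ?thesis by simp
  qed
  ultimately have "istopology ?P" unfolding istopology_def by blast
  then show ?thesis by (simp add: polygon_surface_def topology_inverse')
qed

lemma quotient_map_polygon_surface: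
  "quotient_map (top_of_set (cball 0 1)) (polygon_surface w) (\<lambda>x. glue w `` {x})"
proof -
  let ?D = "cball 0 1 :: complex set" and ?q = "\<lambda>x. glue w `` {x}"
  have union: "\<Union>(?D // glue w) = ?D"
    by (rule Union_quotient[OF equiv_glue])
  have top: "topspace (polygon_surface w) = ?D // glue w"
  proof
    show "topspace (polygon_surface w) \<subseteq> ?D // glue w"
      by (auto simp: topspace_def openin_polygon_surface)
    have "openin (polygon_surface w) (?D // glue w)"
      by (simp add: openin_polygon_surface union)
    then show "?D // glue w \<subseteq> topspace (polygon_surface w)" by (rule openin_subset)
  qed
  have "{x \<in> ?D. ?q x \<in> U} = \<Union>U" if U: "U \<subseteq> ?D // glue w" for U
  proof (intro equalityI subsetI)
    fix x assume "x \<in> {x \<in> ?D. ?q x \<in> U}"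
    then show "x \<in> \<Union>U" using equiv_class_self[OF equiv_glue] by blast
  next
    fix x assume "x \<in> \<Union>U"
    then obtain c where c: "c \<in> U" "x \<in> c" by blast
    with U obtain y where y: "y \<in> ?D" "c = ?q y" by (auto elim!: quotientE)
    with c have "(y, x) \<in> glue w" by simp
    then have "?q y = ?q x" "x \<in> ?D"
      using equiv_class_eq[OF equiv_glue] by (auto simp: glue_def)
    with c y show "x \<in> {x \<in> ?D. ?q x \<in> U}" by simp
  qed
  moreover have "?q ` ?D = ?D // glue w" by (auto simp: quotient_def)
  ultimately show ?thesis
    unfolding quotient_map_def by (auto simp: top openin_polygon_surface)
qed


section \<open>Embeddings of graphs in surfaces\<close>

text \<open>Vertices become distinct points and edges become simple arcs that join the images of
  their ends and meet vertices and one another only at common ends.\<close>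

definition embeds_in :: "ugraph \<Rightarrow> 'a topology \<Rightarrow> bool" where
  "embeds_in G S \<longleftrightarrow> (\<exists>\<phi> \<gamma>.
     \<phi> ` verts G \<subseteq> topspace S \<and> inj_on \<phi> (verts G) \<and>
     (\<forall>e\<in>edges G. pathin S (\<gamma> e) \<and> inj_on (\<gamma> e) {0..1} \<and>
        {\<gamma> e 0, \<gamma> e 1} = \<phi> ` e \<and> \<gamma> e ` {0<..<1} \<inter> \<phi> ` verts G = {}) \<and>
     (\<forall>e\<in>edges G. \<forall>e'\<in>edges G. e \<noteq> e' \<longrightarrow> \<gamma> e ` {0<..<1} \<inter> \<gamma> e' ` {0<..<1} = {}))"

definition \<E> :: "(nat \<Rightarrow> nat) \<Rightarrow> ugraph set" where
  "\<E> g = {G. simple_graph G \<and> (\<exists>e\<le>g (graph_order G). \<exists>S.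
     (orientable_surface e S \<or> nonorientable_surface False e S) \<and> embeds_in G S)}"

definition \<O>\<E> :: "(nat \<Rightarrow> nat) \<Rightarrow> ugraph set" where
  "\<O>\<E> g = {G. simple_graph G \<and> (\<exists>e\<le>g (graph_order G). \<exists>S.
     orientable_surface e S \<and> embeds_in G S)}"

definition \<N>\<E> :: "bool \<Rightarrow> (nat \<Rightarrow> nat) \<Rightarrow> ugraph set" where
  "\<N>\<E> z g = {G. simple_graph G \<and> (\<exists>e\<le>g (graph_order G). \<exists>S.
     nonorientable_surface z e S \<and> embeds_in G S)}"


section \<open>Random unlabelled graphs\<close>

text \<open>If there is no graph of order \<open>n\<close>, all events have measure \<open>0\<close>.\<close>

definition random_unlabelled :: "ugraph set \<Rightarrow> nat \<Rightarrow> ugraph set measure" where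
  "random_unlabelled \<B> n = uniform_count_measure (unlabelled_of_order \<B> n)"

definition wvhp :: "(nat \<Rightarrow> real) \<Rightarrow> bool" where
  "wvhp p \<longleftrightarrow> (\<exists>c>0. \<forall>\<^sub>F n in sequentially. p n \<ge> 1 - exp (- c * real n))"

end

theory Submission
  imports Defs "HOL-Real_Asymp.Real_Asymp"
begin

text \<open>(a) If the class contains all graphs, then we count all unlabelled graphs. By Burnside's lemma
  almost all of them have trivial automorphism group, so there are asymptotically
  \<open>2\<^bsup>n choose 2\<^esup> / n!\<close> of them. The dominant way to be disconnected is to have an isolated vertex,
  which gives the ratio of consecutive counts, \<open>n 2\<^bsup>1 - n\<^esup>\<close>.

  (b) Otherwise the class of minors is a proper minor-closed class. It has at most \<open>C\<^sup>n\<close> unlabelled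
  graphs of order \<open>n\<close>: by sparsity each graph of order \<open>n\<close> either has a linear matching to contract
  or linearly many disjoint pairs of twins to identify, so it is a spanning subgraph of a blow-up of
  a smaller member of the class by a constant factor. On the other hand, an isolated vertex can be
  added within the class, because finitely many arcs never cover a surface. If almost all members
  were connected, then consecutive counts would have unbounded ratio, and the growth would be
  superexponential.\<close>

section \<open>Minors\<close>

text \<open>A bound \<open>C^n * n!\<close> on labelled members would not suffice for (b): a graph
  with many automorphisms has few labellings. The count therefore encodes isomorphism classes
  directly. Folding along an injection creates fibres of at most two vertices, so a graph of order
  \<open>n\<close> is coded by one of order \<open>h\<close> together with O(h) bits; as
  \<open>n - h\<close> is at least a fixed fraction of \<open>n\<close>, the powers of
  \<open>C\<close> saved pay for these bits. Twins are needed beside matchings because a star has no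
  large matching. Identifying two twins is not a contraction, but the result stays in the class as a
  subgraph. The arcs of an embedding are arbitrary continuous ones and may have positive area, so
  the place for an isolated vertex is found by category rather than by measure. The new vertex
  raises the order, which is where monotonicity of \<open>g\<close> enters. In (a) a disconnected
  graph splits into parts of orders \<open>k\<close> and \<open>n - k\<close>. The case
  \<open>k = 1\<close> gives the main term; all cases \<open>k \<ge> 2\<close> together are smaller
  by a factor of order \<open>n / 2^n\<close>.\<close>

definition adj :: "ugraph \<Rightarrow> (nat \<times> nat) set" where
  "adj G = {(x, y). {x, y} \<in> edges G}"

definition nbrs :: "ugraph \<Rightarrow> nat \<Rightarrow> nat set" where
  "nbrs G v = {u. {u, v} \<in> edges G}"

text \<open>The quotient along \<open>f\<close>: the filter \<open>card e = 2\<close> discards edges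
  that collapse to a vertex, and parallel edges merge because edges form a set. An injective
  \<open>f\<close> relabels; other \<open>f\<close> contract or identify vertices.\<close>

definition image_graph :: "(nat \<Rightarrow> nat) \<Rightarrow> ugraph \<Rightarrow> ugraph" where
  "image_graph f G = (f ` verts G, {e \<in> (\<lambda>e. f ` e) ` edges G. card e = 2})"

definition complete_graph :: "nat \<Rightarrow> ugraph" where
  "complete_graph t = ({..<t}, {e. e \<subseteq> {..<t} \<and> card e = 2})"

definition branch_map :: "(nat \<Rightarrow> nat set) \<Rightarrow> ugraph \<Rightarrow> ugraph \<Rightarrow> bool" where
  "branch_map \<beta> H G \<longleftrightarrow>
     (\<forall>x\<in>verts H. \<beta> x \<subseteq> verts G \<and> connected_graph (induced G (\<beta> x))) \<and>
     (\<forall>x\<in>verts H. \<forall>y\<in>verts H. x \<noteq> y \<longrightarrow> \<beta> x \<inter> \<beta> y = {}) \<and>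
     (\<forall>x y. {x, y} \<in> edges H \<longrightarrow> (\<exists>u\<in>\<beta> x. \<exists>v\<in>\<beta> y. {u, v} \<in> edges G))"

lemma minor_of_iff:
  "minor_of H G \<longleftrightarrow> simple_graph H \<and> simple_graph G \<and> (\<exists>\<beta>. branch_map \<beta> H G)"
  by (simp only: minor_of_def branch_map_def)

lemma branch_mapD:
  assumes "branch_map \<beta> H G"
  shows "x \<in> verts H \<Longrightarrow> \<beta> x \<subseteq> verts G"
    and "x \<in> verts H \<Longrightarrow> connected_graph (induced G (\<beta> x))"
    and "x \<in> verts H \<Longrightarrow> y \<in> verts H \<Longrightarrow> x \<noteq> y \<Longrightarrow> \<beta> x \<inter> \<beta> y = {}"
    and "{x, y} \<in> edges H \<Longrightarrow> \<exists>u\<in>\<beta> x. \<exists>v\<in>\<beta> y. {u, v} \<in> edges G"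
  using assms by (simp_all add: branch_map_def)

lemma connected_graph_iff:
  "connected_graph G \<longleftrightarrow> verts G \<noteq> {} \<and> verts G \<times> verts G \<subseteq> (adj G)\<^sup>*"
  unfolding connected_graph_def adj_def by blast

lemma simple_edgeE:
  assumes "simple_graph G" "e \<in> edges G"
  obtains u v where "e = {u, v}" "u \<noteq> v" "u \<in> verts G" "v \<in> verts G"
proof -
  have "card e = 2" "e \<subseteq> verts G" using assms by (auto simp: simple_graph_def)
  then show thesis using that by (auto simp: card_2_iff)
qed

lemma simple_edgeD:
  assumes "simple_graph G" "{u, v} \<in> edges G"
  shows "u \<noteq> v" "u \<in> verts G" "v \<in> verts G"
proof -
  have "card {u, v} = 2" "{u, v} \<subseteq> verts G" using assms by (auto simp: simple_graph_def)
  then show "u \<noteq> v" "u \<in> verts G" "v \<in> verts G" by (auto simp: card_2_iff doubleton_eq_iff)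
qed

lemma simple_graph_finite:
  assumes "simple_graph G"
  shows "finite (verts G)" "finite (edges G)"
proof -
  show "finite (verts G)" using assms by (simp add: simple_graph_def)
  then show "finite (edges G)" using assms
    unfolding simple_graph_def by (blast intro: finite_subset[of _ "Pow (verts G)"] finite_Pow_iff[THEN iffD2])
qed

lemma nbrs_subset: "simple_graph G \<Longrightarrow> nbrs G v \<subseteq> verts G"
  unfolding nbrs_def by (auto dest: simple_edgeD)

lemma finite_nbrs: "simple_graph G \<Longrightarrow> finite (nbrs G v)"
  by (meson nbrs_subset simple_graph_finite(1) finite_subset)

lemma simple_graph_subgraph:
  assumes "simple_graph G" "V \<subseteq> verts G" "V \<noteq> {}" "E \<subseteq> edges G" "\<And>e. e \<in> E \<Longrightarrow> e \<subseteq> V"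
  shows "simple_graph (V, E)"
  using assms by (auto simp: simple_graph_def intro: finite_subset)

lemma simple_graph_induced:
  assumes "simple_graph G" "V \<subseteq> verts G" "V \<noteq> {}"
  shows "simple_graph (induced G V)"
  using assms unfolding induced_def by (intro simple_graph_subgraph) auto

lemma simple_graph_image_graph:
  assumes "simple_graph G"
  shows "simple_graph (image_graph f G)"
  using assms by (fastforce simp: simple_graph_def image_graph_def)

lemma edge_image_graphI:
  assumes "{u, v} \<in> edges G" "f u \<noteq> f v"
  shows "{f u, f v} \<in> edges (image_graph f G)"
proof -
  have "{f u, f v} = f ` {u, v}" "card {f u, f v} = 2" using assms(2) by auto
  then show ?thesis using assms(1) unfolding image_graph_def by (metis (mono_tags, lifting) image_eqI mem_Collect_eq snd_conv)
qed

lemma edge_image_graphE: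
  assumes "simple_graph G" "{x, y} \<in> edges (image_graph f G)"
  obtains u v where "{u, v} \<in> edges G" "f u = x" "f v = y" "u \<in> verts G" "v \<in> verts G"
proof -
  obtain e where e: "e \<in> edges G" "{x, y} = f ` e" using assms(2) by (auto simp: image_graph_def)
  then obtain a b where ab: "e = {a, b}" "a \<in> verts G" "b \<in> verts G"
    using assms(1) by (meson simple_edgeE)
  then have "{x, y} = {f a, f b}" using e by simp
  then consider "x = f a \<and> y = f b" | "x = f b \<and> y = f a" by (auto simp: doubleton_eq_iff)
  then show thesis using e ab that[of a b] that[of b a] by cases (auto simp: insert_commute)
qed

lemma image_graph_inj:
  assumes "simple_graph G" "inj_on f (verts G)"
  shows "image_graph f G = (f ` verts G, (\<lambda>e. f ` e) ` edges G)"
proof -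
  have "card (f ` e) = 2" if "e \<in> edges G" for e
    using that assms card_image[of f e] inj_on_subset[of f "verts G" e]
    by (auto simp: simple_graph_def)
  then show ?thesis by (auto simp: image_graph_def)
qed

lemma iso_rel_iff:
  "(G, H) \<in> iso_rel \<longleftrightarrow> simple_graph G \<and> simple_graph H \<and>
     (\<exists>f. bij_betw f (verts G) (verts H) \<and> edges H = (\<lambda>e. f ` e) ` edges G)"
  unfolding iso_rel_def by (simp only: mem_Collect_eq case_prod_conv)

lemma iso_image_graph:
  assumes "simple_graph G" "inj_on f (verts G)"
  shows "(G, image_graph f G) \<in> iso_rel"
  using assms simple_graph_image_graph[OF assms(1), of f] unfolding iso_rel_iff
  by (intro conjI exI[of _ f]) (simp_all add: image_graph_inj bij_betw_def)

lemma iso_relE: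
  assumes "(G, H) \<in> iso_rel"
  obtains f where "simple_graph G" "simple_graph H" "inj_on f (verts G)" "H = image_graph f G"
proof -
  obtain f where f: "simple_graph G" "simple_graph H" "bij_betw f (verts G) (verts H)"
      "edges H = (\<lambda>e. f ` e) ` edges G"
    using assms iso_rel_iff by blast
  then have inj: "inj_on f (verts G)" by (simp add: bij_betw_def)
  have "H = image_graph f G"
    using f(3,4) by (simp add: image_graph_inj[OF f(1) inj] bij_betw_def prod_eq_iff)
  with f inj that show thesis by blast
qed

lemma iso_sym: "(G, H) \<in> iso_rel \<Longrightarrow> (H, G) \<in> iso_rel"
  using equiv_iso_rel unfolding equiv_def by (blast dest: symD)

lemma iso_refl: "simple_graph G \<Longrightarrow> (G, G) \<in> iso_rel"
  using equiv_iso_rel unfolding equiv_def refl_on_def all_graphs_def by blast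

lemma iso_order: "(G, H) \<in> iso_rel \<Longrightarrow> graph_order G = graph_order H"
  by (auto simp: iso_rel_iff graph_order_def bij_betw_same_card)

lemma connected_image_graph:
  assumes "simple_graph G" "connected_graph G"
  shows "connected_graph (image_graph f G)"
proof -
  have "(f u, f v) \<in> (adj (image_graph f G))\<^sup>*" if "(u, v) \<in> (adj G)\<^sup>*" for u v
    using that
  proof induction
    case base
    show ?case by simp
  next
    case (step v w)
    then have "{v, w} \<in> edges G" by (auto simp: adj_def)
    then have "f v = f w \<or> (f v, f w) \<in> adj (image_graph f G)"
      using edge_image_graphI[of v w G f] by (auto simp: adj_def)
    with step show ?case by auto
  qed
  then show ?thesis using assms(2)
    by (auto simp: connected_graph_iff image_graph_def)
qed

lemma iso_connected:
  assumes "(G, H) \<in> iso_rel"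
  shows "connected_graph G \<longleftrightarrow> connected_graph H"
proof -
  have "connected_graph H'" if "(G', H') \<in> iso_rel" "connected_graph G'" for G' H'
    using that(1) by (rule iso_relE) (use that(2) connected_image_graph in blast)
  then show ?thesis using assms iso_sym by blast
qed

lemma induced_simps [simp]: "verts (induced G B) = B"
  "{u, v} \<in> edges (induced G B) \<longleftrightarrow> {u, v} \<in> edges G \<and> u \<in> B \<and> v \<in> B"
  by (auto simp: induced_def)

lemma connected_induced_singleton: "connected_graph (induced G {v})"
  by (auto simp: connected_graph_iff)

lemma connected_induced_edge:
  assumes "{u, v} \<in> edges G"
  shows "connected_graph (induced G {u, v})"
proof -
  have "(u, v) \<in> adj (induced G {u, v})" "(v, u) \<in> adj (induced G {u, v})"
    using assms by (auto simp: adj_def insert_commute)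
  then show ?thesis by (auto simp: connected_graph_iff)
qed

text \<open>The fibres of \<open>f\<close> serve as branch sets. They are disjoint by construction,
  so only their connectedness has to be required.\<close>

lemma minor_image_graph:
  assumes G: "simple_graph G"
    and conn: "\<And>x. x \<in> f ` verts G \<Longrightarrow> connected_graph (induced G {v \<in> verts G. f v = x})"
  shows "minor_of (image_graph f G) G"
proof -
  let ?\<beta> = "\<lambda>x. {v \<in> verts G. f v = x}"
  have "\<exists>u\<in>?\<beta> x. \<exists>v\<in>?\<beta> y. {u, v} \<in> edges G" if "{x, y} \<in> edges (image_graph f G)" for x y
    using that by (rule edge_image_graphE[OF G]) auto
  moreover have "verts (image_graph f G) = f ` verts G" by (simp add: image_graph_def)
  ultimately have "branch_map ?\<beta> (image_graph f G) G"
    unfolding branch_map_def using conn by auto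
  then show ?thesis using G simple_graph_image_graph minor_of_iff by blast
qed

lemma minor_iso:
  assumes "(G, H) \<in> iso_rel"
  shows "minor_of H G"
proof -
  obtain f where f: "simple_graph G" "inj_on f (verts G)" "H = image_graph f G"
    using assms by (rule iso_relE)
  have "{v \<in> verts G. f v = f u} = {u}" if "u \<in> verts G" for u
    using f(2) that by (auto dest: inj_onD)
  then show ?thesis using f by (auto intro!: minor_image_graph connected_induced_singleton)
qed

lemma minor_subgraph:
  assumes "simple_graph G" "simple_graph H" "verts H \<subseteq> verts G" "edges H \<subseteq> edges G"
  shows "minor_of H G"
proof -
  have "branch_map (\<lambda>x. {x}) H G"
    unfolding branch_map_def using assms(3,4) connected_induced_singleton by blast
  then show ?thesis using assms minor_of_iff by blast
qed

text \<open>Branch sets compose: the new one for \<open>z\<close> is the union of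
  \<open>\<beta> x\<close> over all \<open>x \<in> \<gamma> z\<close>.\<close>

lemma minor_trans:
  assumes "minor_of K H" "minor_of H G"
  shows "minor_of K G"
proof -
  obtain \<beta> where "branch_map \<beta> H G" using assms(2) by (auto simp: minor_of_iff)
  note \<beta> = branch_mapD[OF this]
  obtain \<gamma> where "branch_map \<gamma> K H" using assms(1) by (auto simp: minor_of_iff)
  note \<gamma> = branch_mapD[OF this]
  have simp: "simple_graph K" "simple_graph G" using assms by (simp_all add: minor_of_iff)
  let ?\<delta> = "\<lambda>z. \<Union>x\<in>\<gamma> z. \<beta> x"
  have conn: "connected_graph (induced G (?\<delta> z))" if z: "z \<in> verts K" for z
  proof -
    let ?R = "(adj (induced G (?\<delta> z)))\<^sup>*"
    have part: "(u, v) \<in> ?R" if "x \<in> \<gamma> z" "u \<in> \<beta> x" "v \<in> \<beta> x" for x u v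
    proof -
      have "x \<in> verts H" using \<gamma>(1)[OF z] that(1) by auto
      then have "(u, v) \<in> (adj (induced G (\<beta> x)))\<^sup>*"
        using \<beta>(2)[of x] that by (auto simp: connected_graph_iff)
      moreover have "adj (induced G (\<beta> x)) \<subseteq> adj (induced G (?\<delta> z))"
        using that(1) by (auto simp: adj_def)
      ultimately show ?thesis using rtrancl_mono by blast
    qed
    \<comment> \<open>Induction along a walk of \<open>H\<close> inside \<open>\<gamma> z\<close>:
      each step crosses an edge of \<open>G\<close> between two branch sets, after which
      \<open>part\<close> reaches the whole next set.\<close>
    have *: "\<forall>v\<in>\<beta> y. (u, v) \<in> ?R"
      if "(x, y) \<in> (adj (induced H (\<gamma> z)))\<^sup>*" and x: "x \<in> \<gamma> z" and u: "u \<in> \<beta> x" for x y u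
      using that(1)
    proof induction
      case base
      show ?case using part x u by blast
    next
      case (step y y')
      then have y: "{y, y'} \<in> edges H" "y \<in> \<gamma> z" "y' \<in> \<gamma> z" by (auto simp: adj_def)
      then obtain a b where ab: "a \<in> \<beta> y" "b \<in> \<beta> y'" "{a, b} \<in> edges G" using \<beta>(4) by blast
      have "(a, b) \<in> adj (induced G (?\<delta> z))" using ab y by (auto simp: adj_def)
      then have ub: "(u, b) \<in> ?R" using step.IH ab(1) by (meson rtrancl.rtrancl_into_rtrancl)
      show ?case
      proof
        fix v assume "v \<in> \<beta> y'"
        then have "(b, v) \<in> ?R" using part y(3) ab(2) by blast
        with ub show "(u, v) \<in> ?R" by simp
      qed
    qed
    obtain x where x: "x \<in> \<gamma> z" using \<gamma>(2)[OF z] by (auto simp: connected_graph_iff)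
    then have "\<beta> x \<noteq> {}" using \<gamma>(1)[OF z] \<beta>(2)[of x] by (auto simp: connected_graph_iff)
    then have "?\<delta> z \<noteq> {}" using x by blast
    moreover have "(u, v) \<in> ?R" if uv: "u \<in> ?\<delta> z" "v \<in> ?\<delta> z" for u v
    proof -
      obtain x y where "x \<in> \<gamma> z" "u \<in> \<beta> x" "y \<in> \<gamma> z" "v \<in> \<beta> y" using uv by blast
      then show ?thesis using * \<gamma>(2)[OF z] by (auto simp: connected_graph_iff)
    qed
    ultimately show ?thesis by (auto simp: connected_graph_iff)
  qed
  show ?thesis unfolding minor_of_def
  proof (intro conjI exI[of _ ?\<delta>] ballI allI impI)
    fix z assume "z \<in> verts K"
    then show "?\<delta> z \<subseteq> verts G" "connected_graph (induced G (?\<delta> z))"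
      using conn \<beta>(1) \<gamma>(1) by blast+
  next
    fix x y assume xy: "x \<in> verts K" "y \<in> verts K" "x \<noteq> y"
    have "\<beta> a \<inter> \<beta> b = {}" if "a \<in> \<gamma> x" "b \<in> \<gamma> y" for a b
      using that \<gamma>(1,3) xy \<beta>(3) by blast
    then show "?\<delta> x \<inter> ?\<delta> y = {}" by blast
  next
    fix x y assume "{x, y} \<in> edges K"
    then obtain a b where "a \<in> \<gamma> x" "b \<in> \<gamma> y" "{a, b} \<in> edges H" using \<gamma>(4) by blast
    then show "\<exists>u\<in>?\<delta> x. \<exists>v\<in>?\<delta> y. {u, v} \<in> edges G" using \<beta>(4) by blast
  qed (use simp in auto)
qed

lemma Minor_closed:
  assumes "G \<in> Minor \<B>" "minor_of H G"
  shows "H \<in> Minor \<B>"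
proof -
  have "K \<in> \<B>" if "minor_of K H" for K
    using minor_trans[OF that assms(2)] assms(1) unfolding Minor_def by blast
  then show ?thesis using assms(2) unfolding Minor_def minor_of_iff by blast
qed

lemma incident_edges_eq:
  assumes "simple_graph G"
  shows "{e \<in> edges G. v \<in> e} = (\<lambda>u. {u, v}) ` nbrs G v"
proof -
  have "e \<in> (\<lambda>u. {u, v}) ` nbrs G v" if e: "e \<in> edges G" "v \<in> e" for e
  proof -
    obtain a b where "e = {a, b}" using simple_edgeE[OF assms e(1)] by blast
    then show ?thesis using e by (auto simp: nbrs_def insert_commute)
  qed
  then show ?thesis by (auto simp: nbrs_def)
qed

lemma card_incident_edges:
  assumes "simple_graph G"
  shows "card {e \<in> edges G. v \<in> e} = card (nbrs G v)"
  unfolding incident_edges_eq[OF assms]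
  by (intro card_image) (auto simp: inj_on_def doubleton_eq_iff)

lemma handshake:
  assumes "simple_graph G"
  shows "(\<Sum>v\<in>verts G. card (nbrs G v)) = 2 * card (edges G)"
proof -
  note fin = simple_graph_finite[OF assms]
  have "(\<Sum>v\<in>verts G. card (nbrs G v)) = (\<Sum>v\<in>verts G. \<Sum>e\<in>edges G. if v \<in> e then 1 else 0)"
    using fin by (simp flip: card_incident_edges[OF assms] add: sum.If_cases Int_def)
  also have "\<dots> = (\<Sum>e\<in>edges G. \<Sum>v\<in>verts G. if v \<in> e then 1 else 0)" by (rule sum.swap)
  also have "\<dots> = (\<Sum>e\<in>edges G. 2)"
  proof (rule sum.cong)
    fix e assume "e \<in> edges G"
    then have "verts G \<inter> e = e" "card e = 2" using assms by (auto simp: simple_graph_def)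
    then show "(\<Sum>v\<in>verts G. if v \<in> e then 1 else 0) = (2::nat)"
      using fin by (simp add: sum.If_cases)
  qed simp
  finally show ?thesis by simp
qed

section \<open>Complete minors of dense graphs\<close>

lemma simple_complete_graph: "simple_graph (complete_graph (Suc t))"
  by (simp add: simple_graph_def complete_graph_def lessThan_empty_iff)

lemma edge_complete_graph:
  "{x, y} \<in> edges (complete_graph t) \<longleftrightarrow> x < t \<and> y < t \<and> x \<noteq> y"
  by (auto simp: complete_graph_def card_2_iff doubleton_eq_iff)

lemma induced_induced: "B \<subseteq> N \<Longrightarrow> induced (induced G N) B = induced G B"
  by (auto simp: induced_def)

text \<open>The smaller complete minor lives among the neighbours of \<open>x\<close>, so
  \<open>{x}\<close> can be added as one more branch set; every old branch set is nonempty and hence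
  contains a neighbour of \<open>x\<close>.\<close>

lemma complete_minor_Suc:
  assumes G: "simple_graph G" and x: "x \<in> verts G"
    and minor: "minor_of (complete_graph (Suc t)) (induced G (nbrs G x))"
  shows "minor_of (complete_graph (Suc (Suc t))) G"
proof -
  let ?N = "nbrs G x" and ?T = "Suc t"
  obtain \<beta> where "branch_map \<beta> (complete_graph ?T) (induced G ?N)"
    using minor minor_of_iff by blast
  note \<beta> = branch_mapD[OF this]
  have sub: "\<beta> i \<subseteq> ?N" and conn: "connected_graph (induced G (\<beta> i))" if "i < ?T" for i
  proof -
    show s: "\<beta> i \<subseteq> ?N" using \<beta>(1)[of i] that by (simp add: complete_graph_def)
    show "connected_graph (induced G (\<beta> i))"
      using \<beta>(2)[of i] that s by (simp add: complete_graph_def induced_induced)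
  qed
  have disj: "\<beta> i \<inter> \<beta> j = {}" if "i < ?T" "j < ?T" "i \<noteq> j" for i j
    using \<beta>(3)[of i j] that by (simp add: complete_graph_def)
  have adjacent: "\<exists>u\<in>\<beta> i. \<exists>v\<in>\<beta> j. {u, v} \<in> edges G" if "i < ?T" "j < ?T" "i \<noteq> j" for i j
  proof -
    have "{i, j} \<in> edges (complete_graph ?T)" using that edge_complete_graph by blast
    then show ?thesis using \<beta>(4) induced_simps(2) by blast
  qed
  have new: "\<exists>v\<in>\<beta> i. {x, v} \<in> edges G" if i: "i < ?T" for i
  proof -
    obtain v where "v \<in> \<beta> i" using conn[OF i] by (auto simp: connected_graph_iff)
    then show ?thesis using sub[OF i] by (auto simp: nbrs_def insert_commute)
  qed
  have x_notin: "x \<notin> \<beta> i" if "i < ?T" for i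
    using sub[OF that] simple_edgeD(1)[OF G, of x x] by (auto simp: nbrs_def)
  let ?\<gamma> = "\<beta>(?T := {x})"
  have "branch_map ?\<gamma> (complete_graph (Suc ?T)) G"
    unfolding branch_map_def
  proof (intro conjI ballI allI impI)
    fix i assume "i \<in> verts (complete_graph (Suc ?T))"
    then have i: "i < ?T \<or> i = ?T" by (auto simp: complete_graph_def)
    then show "?\<gamma> i \<subseteq> verts G" using sub nbrs_subset[OF G] x by fastforce
    show "connected_graph (induced G (?\<gamma> i))"
      using i conn by (auto simp: connected_induced_singleton)
  next
    fix i j assume "i \<in> verts (complete_graph (Suc ?T))" "j \<in> verts (complete_graph (Suc ?T))" "i \<noteq> j"
    then have "i < ?T \<or> i = ?T" "j < ?T \<or> j = ?T" by (auto simp: complete_graph_def)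
    then show "?\<gamma> i \<inter> ?\<gamma> j = {}" using disj x_notin \<open>i \<noteq> j\<close> by auto
  next
    fix i j assume "{i, j} \<in> edges (complete_graph (Suc ?T))"
    then have "i < Suc ?T" "j < Suc ?T" "i \<noteq> j" unfolding edge_complete_graph by auto
    then consider "i < ?T" "j < ?T" | "i = ?T" "j < ?T" | "i < ?T" "j = ?T" by linarith
    then show "\<exists>u\<in>?\<gamma> i. \<exists>v\<in>?\<gamma> j. {u, v} \<in> edges G"
    proof cases
      case 1
      then show ?thesis using adjacent[OF 1 \<open>i \<noteq> j\<close>] by simp
    next
      case 2
      then show ?thesis using new by simp
    next
      case 3
      then show ?thesis using new[of i] by (auto simp: insert_commute)
    qed
  qed
  then show ?thesis using G simple_complete_graph minor_of_iff by blast
qed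

text \<open>A contraction loses the edge \<open>{x, y}\<close> itself and, for each common neighbour
  \<open>w\<close>, one of the edges \<open>{x, w}\<close> and \<open>{y, w}\<close>, which
  merge.\<close>

lemma contract_edge:
  assumes G: "simple_graph G" and xy: "{x, y} \<in> edges G"
  defines "H \<equiv> image_graph (\<lambda>v. if v = y then x else v) G"
  shows "minor_of H G" "Suc (card (verts H)) = card (verts G)"
    "card (edges G) \<le> card (edges H) + 1 + card (nbrs G x \<inter> nbrs G y)"
proof -
  let ?f = "\<lambda>v. if v = y then x else v"
  note d = simple_edgeD[OF G xy]
  note fin = simple_graph_finite[OF G]
  have fib: "{v \<in> verts G. ?f v = z} = (if z = x then {x, y} else {z})" if "z \<in> verts G" "z \<noteq> y" for z
    using d that by auto
  show "minor_of H G"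
    unfolding H_def
  proof (rule minor_image_graph[OF G])
    fix z assume "z \<in> ?f ` verts G"
    then have "z \<in> verts G" "z \<noteq> y" using d by (auto split: if_splits)
    then show "connected_graph (induced G {v \<in> verts G. ?f v = z})"
      using fib connected_induced_edge[OF xy] connected_induced_singleton by auto
  qed
  have "verts H = verts G - {y}" using d by (auto simp: H_def image_graph_def)
  then show "Suc (card (verts H)) = card (verts G)"
    using d fin by (metis card.remove)
  let ?C = "nbrs G x \<inter> nbrs G y"
  \<comment> \<open>The edges charged as lost, with \<open>{y, w}\<close> chosen from each merging
    pair. Off \<open>?D\<close> the map on edges is injective.\<close>
  let ?D = "insert {x, y} ((\<lambda>w. {y, w}) ` ?C)"
  have finC: "finite ?C" using finite_nbrs[OF G] by blast
  have inj: "inj_on (\<lambda>e. ?f ` e) (edges G - ?D)"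
  proof -
    have key: "e = e'" if e: "e \<in> edges G - ?D" "e' \<in> edges G - ?D" and eq: "?f ` e = ?f ` e'"
      and y: "y \<in> e" "y \<notin> e'" for e e'
    proof -
      obtain w where w: "e = {y, w}" "w \<noteq> y"
        using e(1) y(1) by (blast elim: simple_edgeE[OF G])
      have wx: "w \<noteq> x" using e(1) w by (auto simp: insert_commute)
      have im: "?f ` e = {x, w}" using w by auto
      have "?f ` e' = e'" using y(2) by (auto simp: image_iff)
      then have "e' = {x, w}" using eq im by simp
      then have "w \<in> nbrs G x" using e(2) by (auto simp: nbrs_def insert_commute)
      moreover have "w \<in> nbrs G y" using e(1) w by (auto simp: nbrs_def insert_commute)
      ultimately have "e \<in> ?D" using w by blast
      with e(1) show ?thesis by blast
    qed
    show ?thesis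
    proof (rule inj_onI)
      fix e e' assume e: "e \<in> edges G - ?D" "e' \<in> edges G - ?D" and eq: "?f ` e = ?f ` e'"
      consider "y \<in> e" "y \<notin> e'" | "y \<notin> e" "y \<in> e'" | "y \<notin> e" "y \<notin> e'" | "y \<in> e" "y \<in> e'" by blast
      then show "e = e'"
      proof cases
        case 1
        then show ?thesis using key e eq by blast
      next
        case 2
        then show ?thesis using key[of e' e] e eq by auto
      next
        case 3
        then have "?f ` e = e" "?f ` e' = e'" by (auto simp: image_iff)
        with eq show ?thesis by simp
      next
        case 4
        obtain w where w: "e = {y, w}" "w \<noteq> y"
          using e(1) 4(1) by (blast elim: simple_edgeE[OF G])
        obtain w' where w': "e' = {y, w'}" "w' \<noteq> y"
          using e(2) 4(2) by (blast elim: simple_edgeE[OF G])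
        have "{x, w} = {x, w'}" using eq w w' by (simp add: insert_commute)
        then have "w = w'" by (auto simp: doubleton_eq_iff)
        with w w' show ?thesis by simp
      qed
    qed
  qed
  have "(\<lambda>e. ?f ` e) ` (edges G - ?D) \<subseteq> edges H"
  proof (rule image_subsetI)
    fix e assume e: "e \<in> edges G - ?D"
    then obtain a b where ab: "e = {a, b}" "a \<noteq> b" by (blast elim: simple_edgeE[OF G])
    have "{a, b} \<noteq> {x, y}" using e ab by blast
    then have "?f a \<noteq> ?f b" using ab(2) by (auto simp: insert_commute)
    then have "{?f a, ?f b} \<in> edges H"
      using e ab(1) unfolding H_def by (intro edge_image_graphI) auto
    moreover have "?f ` e = {?f a, ?f b}" using ab(1) by simp
    ultimately show "?f ` e \<in> edges H" by simp
  qed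
  moreover have "finite (edges H)"
    unfolding H_def using simple_graph_finite(2)[OF simple_graph_image_graph[OF G]] .
  ultimately have "card ((\<lambda>e. ?f ` e) ` (edges G - ?D)) \<le> card (edges H)"
    by (rule card_mono[rotated])
  then have "card (edges G - ?D) \<le> card (edges H)"
    unfolding card_image[OF inj] .
  moreover have "card (edges G) \<le> card (edges G - ?D) + card ?D"
  proof -
    have "card (edges G) \<le> card ((edges G - ?D) \<union> ?D)"
      using fin finC by (intro card_mono) auto
    then show ?thesis using card_Un_le order_trans by blast
  qed
  moreover have "card ?D \<le> 1 + card ?C"
    using finC card_image_le[OF finC, of "\<lambda>w. {y, w}"] by (simp add: card_insert_if)
  ultimately show "card (edges G) \<le> card (edges H) + 1 + card (nbrs G x \<inter> nbrs G y)" by linarith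
qed

text \<open>Mader's argument, by induction on \<open>t\<close> with an inner induction on the order.
  An edge with fewer than \<open>2 ^ Suc t\<close> common neighbours can be contracted without
  falling below the required density. If there is none, the graph induced on the neighbours of a
  non-isolated vertex has minimum degree at least \<open>2 ^ Suc t\<close>, hence at least
  \<open>2 ^ t\<close> edges per vertex, and contains the smaller complete minor.\<close>

lemma complete_minor_if_dense:
  assumes "simple_graph G" "2 ^ t * card (verts G) \<le> card (edges G)"
  shows "minor_of (complete_graph (Suc t)) G"
  using assms
proof (induction t arbitrary: G)
  case 0
  then obtain v where v: "v \<in> verts G" by (auto simp: simple_graph_def)
  have "{x, y} \<notin> edges (complete_graph (Suc 0))" for x y
    unfolding edge_complete_graph by auto
  then have "branch_map (\<lambda>_. {v}) (complete_graph (Suc 0)) G"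
    unfolding branch_map_def using v connected_induced_singleton
    by (auto simp: complete_graph_def)
  then show ?case using 0 simple_complete_graph minor_of_iff by blast
next
  case (Suc t)
  show ?case using Suc.prems
  proof (induction "card (verts G)" arbitrary: G rule: less_induct)
    case less
    note G = less.prems(1)
    show ?case
    proof (cases "\<exists>x y. {x, y} \<in> edges G \<and> card (nbrs G x \<inter> nbrs G y) < 2 ^ Suc t")
      case True
      then obtain x y where xy: "{x, y} \<in> edges G" "card (nbrs G x \<inter> nbrs G y) < 2 ^ Suc t"
        by blast
      define H where "H = image_graph (\<lambda>v. if v = y then x else v) G"
      have H: "minor_of H G" "Suc (card (verts H)) = card (verts G)"
        "card (edges G) \<le> card (edges H) + 1 + card (nbrs G x \<inter> nbrs G y)"
        using contract_edge[OF G xy(1)] unfolding H_def by blast+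
      have "2 ^ Suc t * card (verts G) = 2 ^ Suc t * card (verts H) + 2 ^ Suc t"
        unfolding H(2)[symmetric] by simp
      then have "2 ^ Suc t * card (verts H) \<le> card (edges H)"
        using H(3) xy(2) less.prems(2) by linarith
      then have "minor_of (complete_graph (Suc (Suc t))) H"
        using less.hyps[of H] H(1,2) minor_of_iff by simp
      then show ?thesis using H(1) minor_trans by blast
    next
      case False
      have "verts G \<noteq> {}" "finite (verts G)" using G by (auto simp: simple_graph_def)
      then have "card (verts G) > 0" by (simp add: card_gt_0_iff)
      then have "edges G \<noteq> {}" using less.prems(2) by (auto simp del: power_Suc)
      then obtain e where "e \<in> edges G" by blast
      then obtain x y where xy: "{x, y} \<in> edges G" "x \<in> verts G" by (metis simple_edgeE[OF G])
      let ?N = "nbrs G x"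
      have "y \<in> ?N" using xy by (simp add: nbrs_def insert_commute)
      then have N: "simple_graph (induced G ?N)"
        using simple_graph_induced[OF G nbrs_subset[OF G]] by blast
      have deg: "2 ^ Suc t \<le> card (nbrs (induced G ?N) u)" if "u \<in> ?N" for u
      proof -
        have "{x, u} \<in> edges G" using that by (simp add: nbrs_def insert_commute)
        then have "2 ^ Suc t \<le> card (?N \<inter> nbrs G u)" using False by force
        moreover have "nbrs (induced G ?N) u = ?N \<inter> nbrs G u"
          using that by (auto simp: nbrs_def)
        ultimately show ?thesis by simp
      qed
      have "card ?N * 2 ^ Suc t \<le> (\<Sum>u\<in>?N. card (nbrs (induced G ?N) u))"
        using sum_bounded_below[of ?N "2 ^ Suc t" "\<lambda>u. card (nbrs (induced G ?N) u)"] deg by simp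
      also have "\<dots> = 2 * card (edges (induced G ?N))"
        using handshake[OF N] by simp
      finally have "2 ^ t * card (verts (induced G ?N)) \<le> card (edges (induced G ?N))"
        by (simp add: mult.commute)
      then have "minor_of (complete_graph (Suc t)) (induced G ?N)"
        using Suc.IH N by blast
      then show ?thesis using complete_minor_Suc[OF G xy(2)] by blast
    qed
  qed
qed

section \<open>Foldings in minor-closed classes\<close>

text \<open>Take a partial matching of maximum size, with first ends \<open>X\<close> and partners
  given by \<open>f\<close>; a related pair left over could be added to it. The relation will be
  adjacency once and equality of neighbourhoods once.\<close>

lemma ex_maximal_matching:
  fixes r :: "nat \<Rightarrow> nat \<Rightarrow> bool"
  assumes fin: "finite R"
  obtains X f where "X \<subseteq> R" "inj_on f X" "f ` X \<subseteq> R - X" "\<And>x. x \<in> X \<Longrightarrow> r x (f x)"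
    "\<And>u v. u \<in> R - X - f ` X \<Longrightarrow> v \<in> R - X - f ` X \<Longrightarrow> u \<noteq> v \<Longrightarrow> \<not> r u v"
proof -
  define P where "P = (\<lambda>X. \<exists>f. X \<subseteq> R \<and> inj_on f X \<and> f ` X \<subseteq> R - X \<and> (\<forall>x\<in>X. r x (f x)))"
  have "P {}" by (simp add: P_def)
  moreover have "\<forall>X. P X \<longrightarrow> card X < Suc (card R)"
    using card_mono[OF fin] by (auto simp: P_def less_Suc_eq_le)
  ultimately obtain X where X: "P X" "\<And>Y. P Y \<Longrightarrow> card Y \<le> card X"
    using ex_has_greatest_nat[of P "{}" card "Suc (card R)"] by blast
  obtain f where f: "X \<subseteq> R" "inj_on f X" "f ` X \<subseteq> R - X" "\<And>x. x \<in> X \<Longrightarrow> r x (f x)"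
    using X(1) by (auto simp: P_def)
  have "\<not> r u v" if uv: "u \<in> R - X - f ` X" "v \<in> R - X - f ` X" "u \<noteq> v" for u v
  proof
    assume "r u v"
    have "P (insert u X)"
      unfolding P_def
    proof (intro exI[of _ "f(u := v)"] conjI)
      have eq: "(f(u := v)) x = f x" if "x \<in> X" for x using that uv(1) by auto
      show "insert u X \<subseteq> R" using f uv by auto
      have im: "(f(u := v)) ` X = f ` X" using eq by auto
      show "inj_on (f(u := v)) (insert u X)"
        using f(2) uv im eq by (auto simp: inj_on_insert cong: inj_on_cong)
      show "(f(u := v)) ` insert u X \<subseteq> R - insert u X"
        using f(3) uv im by auto
      show "\<forall>x\<in>insert u X. r x ((f(u := v)) x)" using f(4) eq \<open>r u v\<close> by simp
    qed
    then have "card (insert u X) \<le> card X" using X(2) by blast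
    moreover have "finite X" using f(1) fin finite_subset by blast
    ultimately show False using uv by simp
  qed
  with f that show thesis by blast
qed

text \<open>A retraction onto the complement of \<open>X\<close> whenever \<open>f\<close> maps
  \<open>X\<close> outside \<open>X\<close>. It describes both the contraction of edges and the
  identification of twins.\<close>

definition fold_map :: "nat set \<Rightarrow> (nat \<Rightarrow> nat) \<Rightarrow> nat \<Rightarrow> nat" where
  "fold_map X f v = (if v \<in> X then f v else v)"

lemma connected_induced_star:
  assumes "w \<in> S" "\<And>v. v \<in> S \<Longrightarrow> v \<noteq> w \<Longrightarrow> {w, v} \<in> edges G"
  shows "connected_graph (induced G S)"
proof -
  let ?R = "(adj (induced G S))\<^sup>*"
  have "(w, v) \<in> ?R \<and> (v, w) \<in> ?R" if v: "v \<in> S" for v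
  proof (cases "v = w")
    case False
    have "(w, v) \<in> adj (induced G S)" "(v, w) \<in> adj (induced G S)"
      using assms(1) assms(2)[OF v False] v by (auto simp: adj_def insert_commute)
    then show ?thesis by blast
  qed simp
  then have "(u, v) \<in> ?R" if "u \<in> S" "v \<in> S" for u v using that rtrancl_trans by metis
  then show ?thesis unfolding connected_graph_iff using assms(1) by auto
qed

text \<open>This is what an excluded minor provides for counting. Closure hands the edge bound on to
  all induced subgraphs and contractions, which makes the members degenerate.\<close>

locale sparse_minor_closed =
  fixes \<B> :: "ugraph set" and d :: nat
  assumes simple: "G \<in> \<B> \<Longrightarrow> simple_graph G"
    and closed: "G \<in> \<B> \<Longrightarrow> minor_of H G \<Longrightarrow> H \<in> \<B>"
    and sparse: "G \<in> \<B> \<Longrightarrow> card (edges G) \<le> d * card (verts G)"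
begin

lemma induced_closed:
  assumes "G \<in> \<B>" "V \<subseteq> verts G" "V \<noteq> {}"
  shows "induced G V \<in> \<B>"
proof -
  have G: "simple_graph G" using simple assms by blast
  have "edges (induced G V) \<subseteq> edges G" by (auto simp: induced_def)
  then show ?thesis
    using closed[OF assms(1)] minor_subgraph[OF G simple_graph_induced[OF G assms(2,3)]] assms(2)
    by simp
qed

lemma ex_low_degree:
  assumes "G \<in> \<B>"
  shows "\<exists>v\<in>verts G. card (nbrs G v) \<le> 2 * d"
proof (rule ccontr)
  assume neg: "\<not> ?thesis"
  have high: "\<not> card (nbrs G v) \<le> 2 * d" if "v \<in> verts G" for v
    using that neg by blast
  have G: "simple_graph G" using simple assms by blast
  have "Suc (2 * d) \<le> card (nbrs G v)" if "v \<in> verts G" for v using high[OF that] by simp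
  then have "card (verts G) * Suc (2 * d) \<le> 2 * card (edges G)"
    using sum_bounded_below[of "verts G" "Suc (2 * d)" "\<lambda>v. card (nbrs G v)"] handshake[OF G] by simp
  also have "\<dots> \<le> 2 * (d * card (verts G))" using sparse[OF assms] by simp
  finally have "card (verts G) = 0" by (simp add: algebra_simps)
  then show False using G by (simp add: simple_graph_def)
qed

section \<open>Few cliques and few neighbourhoods in sparse graphs\<close>

definition cliques :: "ugraph \<Rightarrow> nat set \<Rightarrow> nat set set" where
  "cliques G V = {S. S \<subseteq> V \<and> (\<forall>x\<in>S. \<forall>y\<in>S. x \<noteq> y \<longrightarrow> {x, y} \<in> edges G)}"

text \<open>Peel off a vertex of degree at most \<open>2 * d\<close> in the graph induced on
  \<open>V\<close>. The cliques through it come from subsets of its neighbourhood, at most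
  \<open>2 ^ (2 * d) = 4 ^ d\<close> of them. The final \<open>+ 1\<close> is the empty
  clique.\<close>

lemma card_cliques:
  assumes G: "G \<in> \<B>" and V: "V \<subseteq> verts G"
  shows "card (cliques G V) \<le> 4 ^ d * card V + 1"
proof -
  have "finite V" using V simple[OF G] simple_graph_finite(1) finite_subset by blast
  then show ?thesis using V
  proof (induction "card V" arbitrary: V rule: less_induct)
    case less
    show ?case
    proof (cases "V = {}")
      case True
      then have "cliques G V = {{}}" by (auto simp: cliques_def)
      then show ?thesis by simp
    next
      case False
      obtain v where "v \<in> verts (induced G V)" and deg: "card (nbrs (induced G V) v) \<le> 2 * d"
        using ex_low_degree[OF induced_closed[OF G less.prems(2) False]] by blast
      then have v: "v \<in> V" by simp
      let ?N = "nbrs (induced G V) v"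
      have finN: "finite ?N" by (rule finite_subset[OF _ less.prems(1)]) (auto simp: nbrs_def)
      have sub: "cliques G V \<subseteq> cliques G (V - {v}) \<union> insert v ` Pow ?N"
      proof
        fix S assume S: "S \<in> cliques G V"
        show "S \<in> cliques G (V - {v}) \<union> insert v ` Pow ?N"
        proof (cases "v \<in> S")
          case True
          then have "S - {v} \<subseteq> ?N" "S = insert v (S - {v})"
            using S v by (auto simp: cliques_def nbrs_def)
          then show ?thesis by blast
        next
          case False
          then show ?thesis using S by (auto simp: cliques_def)
        qed
      qed
      have "finite (cliques G (V - {v}))"
        by (rule finite_subset[of _ "Pow V"]) (use less.prems in \<open>auto simp: cliques_def\<close>)
      then have "card (cliques G V) \<le> card (cliques G (V - {v}) \<union> insert v ` Pow ?N)"
        using sub finN by (intro card_mono) auto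
      also have "\<dots> \<le> card (cliques G (V - {v})) + card (insert v ` Pow ?N)"
        by (rule card_Un_le)
      also have "card (insert v ` Pow ?N) \<le> card (Pow ?N)"
        using finN by (intro card_image_le) auto
      also have "card (Pow ?N) = 2 ^ card ?N" by (rule card_Pow[OF finN])
      also have "(2::nat) ^ card ?N \<le> 2 ^ (2 * d)" using deg by (intro power_increasing) auto
      also have "(2::nat) ^ (2 * d) = 4 ^ d" by (simp add: power_mult)
      finally have le: "card (cliques G V) \<le> card (cliques G (V - {v})) + 4 ^ d" by simp
      have c: "card V = Suc (card (V - {v}))" using v less.prems(1) by (metis card.remove)
      then have "card (cliques G (V - {v})) \<le> 4 ^ d * card (V - {v}) + 1"
        using less.prems by (intro less.hyps) auto
      then show ?thesis using le c by simp
    qed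
  qed
qed

text \<open>Each fibre is a star: its centre is the image vertex and its leaves are the vertices of
  \<open>X\<close> sent there.\<close>

lemma fold_map_minor:
  assumes G: "simple_graph G" and X: "X \<subseteq> verts G" "f ` X \<subseteq> verts G - X"
    and e: "\<And>x. x \<in> X \<Longrightarrow> {f x, x} \<in> edges G"
  shows "minor_of (image_graph (fold_map X f) G) G"
proof (rule minor_image_graph[OF G])
  fix w assume "w \<in> fold_map X f ` verts G"
  then have w: "w \<in> verts G" "w \<notin> X" using X by (auto simp: fold_map_def split: if_splits)
  show "connected_graph (induced G {v \<in> verts G. fold_map X f v = w})"
  proof (rule connected_induced_star[of w])
    show "w \<in> {v \<in> verts G. fold_map X f v = w}" using w by (auto simp: fold_map_def)
  qed (use e in \<open>auto simp: fold_map_def split: if_splits\<close>)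
qed

text \<open>The number of neighbourhoods is small because contracting vertices of the independent set
  into \<open>W\<close> can create only few new edges inside \<open>W\<close>; once no further edge can be created, every
  remaining neighbourhood is a clique.\<close>

lemma few_neighbourhoods:
  assumes G: "G \<in> \<B>" and W: "W \<subseteq> verts G"
    and indep: "\<And>u v. u \<in> verts G - W \<Longrightarrow> v \<in> verts G - W \<Longrightarrow> {u, v} \<notin> edges G"
  obtains R where "R \<subseteq> verts G - W" "card (verts G) \<le> card R + Suc d * card W"
    "card (nbrs G ` R) \<le> 4 ^ d * card W + 1"
proof (cases "W = {}")
  case True
  \<comment> \<open>The contracted graphs on \<open>W\<close> used in the other case would be null
    here, hence no graphs at all; but with \<open>W\<close> empty, \<open>G\<close> is
    edgeless.\<close>
  have "nbrs G v = {}" for v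
    using indep True simple_edgeD[OF simple[OF G]] unfolding nbrs_def by blast
  then have "nbrs G ` verts G \<subseteq> {{}}" by auto
  then have "card (nbrs G ` verts G) \<le> card {{}::nat set}" by (intro card_mono) auto
  then show thesis using that[of "verts G"] True by simp
next
  case False
  note simpG = simple[OF G]
  note finG = simple_graph_finite[OF simpG]
  have finW: "finite W" using W finG finite_subset by blast
  let ?I = "verts G - W"
  define J where "J = (\<lambda>X c. image_graph (fold_map X c) (induced G (W \<union> X)))"
  \<comment> \<open>\<open>X\<close> is the set contracted so far and \<open>c\<close> picks the
    target of each vertex. The last conjunct charges every contracted vertex to an edge on
    \<open>W\<close>, so sparsity caps \<open>card X\<close> at \<open>d * card W\<close>.\<close>
  define P where "P = (\<lambda>X c. X \<subseteq> ?I \<and> (\<forall>v\<in>X. c v \<in> W \<and> {c v, v} \<in> edges G)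
      \<and> card X \<le> card (edges (J X c)))"
  have J: "J X c \<in> \<B> \<and> verts (J X c) = W" if "P X c" for X c
  proof -
    have X: "X \<subseteq> ?I" "\<And>v. v \<in> X \<Longrightarrow> c v \<in> W" "\<And>v. v \<in> X \<Longrightarrow> {c v, v} \<in> edges G"
      using that by (auto simp: P_def)
    have ind: "induced G (W \<union> X) \<in> \<B>"
      using X(1) W False by (intro induced_closed[OF G]) auto
    have "minor_of (J X c) (induced G (W \<union> X))"
      unfolding J_def using X by (intro fold_map_minor[OF simple[OF ind]]) auto
    then have "J X c \<in> \<B>" using closed[OF ind] by blast
    moreover have "verts (J X c) = fold_map X c ` (W \<union> X)" by (simp add: J_def image_graph_def)
    moreover have "fold_map X c ` (W \<union> X) = W"
    proof
      show "fold_map X c ` (W \<union> X) \<subseteq> W" using X by (auto simp: fold_map_def)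
      show "W \<subseteq> fold_map X c ` (W \<union> X)"
      proof
        fix w assume "w \<in> W"
        moreover from this have "fold_map X c w = w" using X(1) by (auto simp: fold_map_def)
        ultimately show "w \<in> fold_map X c ` (W \<union> X)" by (metis UnI1 imageI)
      qed
    qed
    ultimately show ?thesis by simp
  qed
  have "P {} id" by (simp add: P_def)
  moreover have "\<forall>X. (\<exists>c. P X c) \<longrightarrow> card X < Suc (card (verts G))"
    using card_mono[OF finG(1)] by (auto simp: P_def less_Suc_eq_le)
  ultimately obtain X where "\<exists>c. P X c" and max: "\<And>Y c. P Y c \<Longrightarrow> card Y \<le> card X"
    using ex_has_greatest_nat[of "\<lambda>X. \<exists>c. P X c" "{}" card "Suc (card (verts G))"] by blast
  then obtain c where P: "P X c" by blast
  have X: "X \<subseteq> ?I" "\<And>v. v \<in> X \<Longrightarrow> c v \<in> W" "\<And>v. v \<in> X \<Longrightarrow> {c v, v} \<in> edges G"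
      "card X \<le> card (edges (J X c))"
    using P by (auto simp: P_def)
  have finX: "finite X" using X(1) finG finite_subset by blast
  have nb: "nbrs G v \<subseteq> W" if "v \<in> ?I" for v
    using indep[of _ v] that simple_edgeD[OF simpG] unfolding nbrs_def by blast
  have clique: "nbrs G v \<in> cliques (J X c) W" if v: "v \<in> ?I - X" for v
  proof -
    have "{x, y} \<in> edges (J X c)" if xy: "x \<in> nbrs G v" "y \<in> nbrs G v" "x \<noteq> y" for x y
    proof (rule ccontr)
      \<comment> \<open>Contracting \<open>v\<close> into \<open>x\<close> keeps the old edges and
        adds \<open>{x, y}\<close>, so \<open>insert v X\<close> would beat the maximal
        \<open>X\<close>.\<close>
      assume new: "{x, y} \<notin> edges (J X c)"
      let ?X = "insert v X" and ?c = "c(v := x)"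
      have xyW: "x \<in> W" "y \<in> W" using nb[of v] v xy by auto
      have fm: "fold_map ?X ?c u = fold_map X c u" if "u \<in> W \<union> X" for u
        using that v by (auto simp: fold_map_def)
      have sub: "edges (J X c) \<subseteq> edges (J ?X ?c)"
      proof
        fix e assume "e \<in> edges (J X c)"
        then obtain e' where e': "e' \<in> edges (induced G (W \<union> X))" "e = fold_map X c ` e'" "card e = 2"
          by (auto simp: J_def image_graph_def)
        then have "e' \<subseteq> W \<union> X" "e' \<in> edges (induced G (W \<union> ?X))" by (auto simp: induced_def)
        moreover from this have "e = fold_map ?X ?c ` e'" using e'(2) fm
          by (metis (no_types, lifting) image_cong subsetD)
        ultimately show "e \<in> edges (J ?X ?c)" using e'(3) by (auto simp: J_def image_graph_def)
      qed
      have "{v, y} \<in> edges (induced G (W \<union> ?X))"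
        using xy xyW by (simp add: nbrs_def insert_commute)
      moreover have f: "fold_map ?X ?c v = x" "fold_map ?X ?c y = y"
        using xyW v X(1) by (auto simp: fold_map_def)
      ultimately have "{x, y} \<in> edges (J ?X ?c)"
        using edge_image_graphI[of v y "induced G (W \<union> ?X)" "fold_map ?X ?c"] xy(3)
        unfolding J_def by simp
      then have "insert {x, y} (edges (J X c)) \<subseteq> edges (J ?X ?c)" using sub by blast
      moreover have "simple_graph (induced G (W \<union> ?X))"
        using v X(1) W False by (intro simple_graph_induced[OF simpG]) auto
      then have "finite (edges (J ?X ?c))"
        unfolding J_def using simple_graph_image_graph simple_graph_finite(2) by blast
      ultimately have "card (insert {x, y} (edges (J X c))) \<le> card (edges (J ?X ?c))"
        by (rule card_mono[rotated])
      moreover have "finite (edges (J X c))" using J[OF P] simple simple_graph_finite(2) by blast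
      ultimately have "Suc (card (edges (J X c))) \<le> card (edges (J ?X ?c))" using new by simp
      then have "card ?X \<le> card (edges (J ?X ?c))" using X(4) finX v by simp
      moreover have "\<forall>u\<in>?X. ?c u \<in> W \<and> {?c u, u} \<in> edges G"
        using X v xy xyW by (auto simp: nbrs_def)
      moreover have "?X \<subseteq> ?I" using X(1) v by blast
      ultimately have "P ?X ?c" unfolding P_def by blast
      then have "card ?X \<le> card X" using max by blast
      then show False using v finX by simp
    qed
    moreover have "nbrs G v \<subseteq> W" using nb v by blast
    ultimately show ?thesis unfolding cliques_def by blast
  qed
  have finC: "finite (cliques (J X c) W)"
    by (rule finite_subset[of _ "Pow W"]) (use finW in \<open>auto simp: cliques_def\<close>)
  have "nbrs G ` (?I - X) \<subseteq> cliques (J X c) W" using clique by blast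
  then have "card (nbrs G ` (?I - X)) \<le> card (cliques (J X c) W)"
    by (rule card_mono[OF finC])
  also have "\<dots> \<le> 4 ^ d * card W + 1" using J[OF P] by (intro card_cliques) auto
  finally have q: "card (nbrs G ` (?I - X)) \<le> 4 ^ d * card W + 1" .
  have "card X \<le> d * card W" using X(4) sparse[of "J X c"] J[OF P] by simp
  moreover have "card (verts G) = card W + card ?I"
    using W finG finW by (simp add: card_Diff_subset card_mono)
  moreover have "card ?I = card X + card (?I - X)"
    using X(1) finG finX by (simp add: card_Diff_subset card_mono)
  ultimately have "card (verts G) \<le> card (?I - X) + Suc d * card W" by simp
  then show thesis using that[of "?I - X"] q by blast
qed

text \<open>The constant is generous: a matching of fewer than \<open>n / m\<close> edges leaves room for \<open>n / 4\<close>
  disjoint pairs of vertices with equal neighbourhoods.\<close>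

lemma ex_folding:
  defines "m \<equiv> 8 * (1 + d + 4 ^ d)"
  assumes G: "G \<in> \<B>" and n: "4 \<le> card (verts G)"
  obtains X f where "X \<subseteq> verts G" "inj_on f X" "f ` X \<subseteq> verts G - X"
    "card (verts G) \<le> m * card X" "image_graph (fold_map X f) G \<in> \<B>"
proof -
  note simpG = simple[OF G]
  note finG = simple_graph_finite[OF simpG]
  obtain X f where X: "X \<subseteq> verts G" "inj_on f X" "f ` X \<subseteq> verts G - X"
      "\<And>x. x \<in> X \<Longrightarrow> {f x, x} \<in> edges G"
    and max: "\<And>u v. u \<in> verts G - X - f ` X \<Longrightarrow> v \<in> verts G - X - f ` X \<Longrightarrow> u \<noteq> v \<Longrightarrow> \<not> {v, u} \<in> edges G"
    using ex_maximal_matching[OF finG(1), of "\<lambda>u v. {v, u} \<in> edges G"] by metis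
  show thesis
  proof (cases "card (verts G) \<le> m * card X")
    case True
    have "image_graph (fold_map X f) G \<in> \<B>"
      using closed[OF G fold_map_minor[OF simpG X(1,3,4)]] .
    then show thesis using that[OF X(1-3) True] by blast
  next
    case False
    let ?W = "X \<union> f ` X"
    have finX: "finite X" using X(1) finG finite_subset by blast
    have "card ?W = card X + card (f ` X)"
      using X(3) finX by (intro card_Un_disjoint) auto
    then have cW: "card ?W = 2 * card X" using card_image[OF X(2)] by simp
    have indep: "{u, v} \<notin> edges G" if "u \<in> verts G - ?W" "v \<in> verts G - ?W" for u v
      using max[of v u] that simple_edgeD(1)[OF simpG, of u v] by blast
    have "?W \<subseteq> verts G" using X by blast
    then obtain R where R: "R \<subseteq> verts G - ?W" "card (verts G) \<le> card R + Suc d * card ?W"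
      "card (nbrs G ` R) \<le> 4 ^ d * card ?W + 1"
      using few_neighbourhoods[OF G _ indep] by blast
    have finR: "finite R" using R(1) finG finite_subset by blast
    \<comment> \<open>Pair off twins in \<open>R\<close>. The vertices left over have pairwise
      distinct neighbourhoods, so the bound on the number of neighbourhoods limits them.\<close>
    obtain Y h where Y: "Y \<subseteq> R" "inj_on h Y" "h ` Y \<subseteq> R - Y"
        "\<And>y. y \<in> Y \<Longrightarrow> nbrs G y = nbrs G (h y)"
      and rest: "\<And>u v. u \<in> R - Y - h ` Y \<Longrightarrow> v \<in> R - Y - h ` Y \<Longrightarrow> u \<noteq> v \<Longrightarrow> nbrs G u \<noteq> nbrs G v"
      using ex_maximal_matching[OF finR, of "\<lambda>u v. nbrs G u = nbrs G v"] by metis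
    have finY: "finite Y" using Y(1) finR finite_subset by blast
    have "inj_on (nbrs G) (R - Y - h ` Y)" using rest by (meson inj_onI)
    then have "card (R - Y - h ` Y) = card (nbrs G ` (R - Y - h ` Y))" by (simp add: card_image)
    also have "\<dots> \<le> card (nbrs G ` R)" using finR by (intro card_mono) auto
    finally have "card (R - Y - h ` Y) \<le> 4 ^ d * card ?W + 1" using R(3) by linarith
    moreover have "card R = card Y + card (h ` Y) + card (R - Y - h ` Y)"
    proof -
      have "card (R - Y) = card R - card Y" "card Y \<le> card R"
        using finR finY Y(1) by (simp_all add: card_Diff_subset card_mono)
      moreover have "card (R - Y - h ` Y) = card (R - Y) - card (h ` Y)"
          "card (h ` Y) \<le> card (R - Y)"
        using finR finY Y(3) by (simp_all add: card_Diff_subset card_mono)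
      ultimately show ?thesis by linarith
    qed
    moreover have "card (h ` Y) = card Y" using Y(2) by (rule card_image)
    ultimately have "card (verts G) \<le> 2 * card Y + 1 + (1 + d + 4 ^ d) * card ?W"
      using R(2) by (simp add: algebra_simps)
    \<comment> \<open>The contraction case failed, so \<open>m * card X\<close> is less than the
      order; with \<open>card ?W = 2 * card X\<close> and the factor 8 in \<open>m\<close> this is
      the same inequality.\<close>
    moreover have "4 * ((1 + d + 4 ^ d) * card ?W) < card (verts G)"
      using False cW by (simp add: m_def algebra_simps)
    ultimately have "card (verts G) \<le> 4 * card Y + 4" "card (verts G) \<le> 8 * card Y"
      using n by linarith+
    moreover have "8 * card Y \<le> m * card Y" by (simp add: m_def)
    ultimately have big: "card (verts G) \<le> m * card Y" by linarith
    have Yv: "Y \<subseteq> verts G" "h ` Y \<subseteq> verts G - Y" using Y R(1) by auto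
    \<comment> \<open>Replacing an end in \<open>Y\<close> by its twin turns an edge into an edge of
      \<open>G\<close>. At most one end is affected, since \<open>Y\<close> lies in the independent
      set \<open>R\<close>; hence folding yields a subgraph.\<close>
    have sub: "edges (image_graph (fold_map Y h) G) \<subseteq> edges G"
    proof
      fix e assume e: "e \<in> edges (image_graph (fold_map Y h) G)"
      then obtain e' where e': "e' \<in> edges G" "e = fold_map Y h ` e'" by (auto simp: image_graph_def)
      then obtain u v where uv: "e' = {u, v}" "u \<in> verts G" "v \<in> verts G"
        by (blast elim: simple_edgeE[OF simpG])
      have edge: "{fold_map Y h a, b} \<in> edges G" if "{a, b} \<in> edges G" for a b
      proof (cases "a \<in> Y")
        case True
        then have "b \<in> nbrs G (h a)" using Y(4)[OF True] that by (auto simp: nbrs_def insert_commute)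
        then show ?thesis using True by (simp add: fold_map_def nbrs_def insert_commute)
      qed (use that in \<open>simp add: fold_map_def\<close>)
      have "u \<in> ?W \<or> v \<in> ?W" using indep[of u v] e' uv by blast
      then have "u \<notin> Y \<or> v \<notin> Y" using Y(1) R(1) by blast
      then have "fold_map Y h u = u \<or> fold_map Y h v = v" by (auto simp: fold_map_def)
      then show "e \<in> edges G"
        using edge[of u v] edge[of v u] e' uv by (auto simp: insert_commute)
    qed
    have "fold_map Y h ` verts G \<subseteq> verts G" using Yv by (auto simp: fold_map_def)
    then have "verts (image_graph (fold_map Y h) G) \<subseteq> verts G" by (simp add: image_graph_def)
    then have "minor_of (image_graph (fold_map Y h) G) G"
      using sub minor_subgraph[OF simpG simple_graph_image_graph[OF simpG]] by blast
    then have "image_graph (fold_map Y h) G \<in> \<B>" using closed[OF G] by blast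
    then show thesis using that[OF Yv(1) Y(2) Yv(2) big] by blast
  qed
qed

end

section \<open>Isomorphism classes and isolated vertices\<close>

definition iso_class :: "ugraph \<Rightarrow> ugraph set" where
  "iso_class G = iso_rel `` {G}"

definition iso_closed :: "ugraph set \<Rightarrow> bool" where
  "iso_closed \<B> \<longleftrightarrow> \<B> \<subseteq> all_graphs \<and> (\<forall>G\<in>\<B>. \<forall>H. (G, H) \<in> iso_rel \<longrightarrow> H \<in> \<B>)"

lemma iso_closed_simple: "iso_closed \<B> \<Longrightarrow> G \<in> \<B> \<Longrightarrow> simple_graph G"
  unfolding iso_closed_def all_graphs_def by blast

lemma iso_closedD: "iso_closed \<B> \<Longrightarrow> G \<in> \<B> \<Longrightarrow> (G, H) \<in> iso_rel \<Longrightarrow> H \<in> \<B>"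
  unfolding iso_closed_def by blast

lemma iso_closed_Minor: "iso_closed (Minor \<B>)"
  unfolding iso_closed_def
proof (intro conjI ballI allI impI)
  show "Minor \<B> \<subseteq> all_graphs" unfolding Minor_def all_graphs_def by blast
  show "H \<in> Minor \<B>" if "G \<in> Minor \<B>" "(G, H) \<in> iso_rel" for G H
    using Minor_closed[OF that(1) minor_iso[OF that(2)]] .
qed

lemma iso_closed_all_graphs: "iso_closed all_graphs"
  unfolding iso_closed_def all_graphs_def iso_rel_iff by blast

lemma iso_class_eq_iff:
  assumes "simple_graph G" "simple_graph H"
  shows "iso_class G = iso_class H \<longleftrightarrow> (G, H) \<in> iso_rel"
  unfolding iso_class_def
  using eq_equiv_class_iff[OF equiv_iso_rel, of G H] assms by (simp add: all_graphs_def)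

lemma iso_classI: "(G, H) \<in> iso_rel \<Longrightarrow> iso_class G = iso_class H"
  using iso_class_eq_iff iso_rel_iff by blast

lemma ex_relabelling:
  assumes "simple_graph G"
  obtains H where "(G, H) \<in> iso_rel" "verts H = {..<graph_order G}"
proof -
  obtain f where f: "bij_betw f (verts G) {0..<card (verts G)}"
    using ex_bij_betw_finite_nat[OF simple_graph_finite(1)[OF assms]] by blast
  then have "inj_on f (verts G)" "f ` verts G = {..<graph_order G}"
    by (auto simp: bij_betw_def graph_order_def)
  then have iso: "(G, image_graph f G) \<in> iso_rel" using iso_image_graph[OF assms] by blast
  have "verts (image_graph f G) = {..<graph_order G}"
    using \<open>f ` verts G = _\<close> by (simp add: image_graph_def)
  with iso show thesis by (rule that)
qed

lemma unlabelled_of_order_iff: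
  assumes "iso_closed \<B>"
  shows "R \<in> unlabelled_of_order \<B> n \<longleftrightarrow> (\<exists>G\<in>\<B>. graph_order G = n \<and> R = iso_class G)"
proof
  assume "R \<in> unlabelled_of_order \<B> n"
  then obtain G where G: "G \<in> \<B>" "R = iso_class G" and ord: "\<forall>H\<in>R. graph_order H = n"
    unfolding unlabelled_of_order_def unlabelled_def quotient_def iso_class_def by blast
  have "G \<in> R" using iso_refl[OF iso_closed_simple[OF assms G(1)]] G(2) by (simp add: iso_class_def)
  then show "\<exists>G\<in>\<B>. graph_order G = n \<and> R = iso_class G" using G ord by blast
next
  assume "\<exists>G\<in>\<B>. graph_order G = n \<and> R = iso_class G"
  then obtain G where G: "G \<in> \<B>" "graph_order G = n" "R = iso_class G" by blast
  have "\<forall>H\<in>R. graph_order H = n"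
  proof
    fix H assume "H \<in> R"
    then have "(G, H) \<in> iso_rel" using G(3) by (simp add: iso_class_def)
    then show "graph_order H = n" using iso_order G(2) by metis
  qed
  then show "R \<in> unlabelled_of_order \<B> n"
    using G unfolding unlabelled_of_order_def unlabelled_def quotient_def iso_class_def by blast
qed

lemma unlabelled_of_order_eq:
  assumes "iso_closed \<B>"
  shows "unlabelled_of_order \<B> n = iso_class ` {G \<in> \<B>. verts G = {..<n}}"
proof (intro set_eqI iffI)
  fix R assume "R \<in> unlabelled_of_order \<B> n"
  then obtain G where G: "G \<in> \<B>" "graph_order G = n" "R = iso_class G"
    using unlabelled_of_order_iff[OF assms] by blast
  obtain H where "(G, H) \<in> iso_rel" "verts H = {..<n}"
    using ex_relabelling[OF iso_closed_simple[OF assms G(1)]] G(2) by blast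
  then show "R \<in> iso_class ` {G \<in> \<B>. verts G = {..<n}}"
    using G iso_closedD[OF assms G(1)] iso_classI by blast
next
  fix R assume "R \<in> iso_class ` {G \<in> \<B>. verts G = {..<n}}"
  then obtain G where "G \<in> \<B>" "verts G = {..<n}" "R = iso_class G" by blast
  moreover from this have "graph_order G = n" by (simp add: graph_order_def)
  ultimately show "R \<in> unlabelled_of_order \<B> n"
    unfolding unlabelled_of_order_iff[OF assms] by blast
qed

lemma graphs_on_subset:
  assumes "iso_closed \<B>"
  shows "{G \<in> \<B>. verts G = V} \<subseteq> {V} \<times> Pow {e. e \<subseteq> V \<and> card e = 2}"
proof
  fix G assume "G \<in> {G \<in> \<B>. verts G = V}"
  then have "simple_graph G" "verts G = V" using iso_closed_simple[OF assms] by auto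
  then show "G \<in> {V} \<times> Pow {e. e \<subseteq> V \<and> card e = 2}"
    by (cases G) (simp add: simple_graph_def)
qed

lemma finite_graphs_on:
  assumes "iso_closed \<B>"
  shows "finite {G \<in> \<B>. verts G = {..<n::nat}}"
  by (rule finite_subset[OF graphs_on_subset[OF assms]]) simp

lemma finite_unlabelled_of_order:
  assumes "iso_closed \<B>"
  shows "finite (unlabelled_of_order \<B> n)"
  unfolding unlabelled_of_order_eq[OF assms] using finite_graphs_on[OF assms] by simp

lemma unlabelled_of_order_0:
  assumes "iso_closed \<B>"
  shows "unlabelled_of_order \<B> 0 = {}"
proof -
  have "verts G \<noteq> {..<0}" if "G \<in> \<B>" for G
    using iso_closed_simple[OF assms that] by (simp add: simple_graph_def)
  then show ?thesis unfolding unlabelled_of_order_eq[OF assms] by blast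
qed

lemma card_pairs: "card {e. e \<subseteq> {..<n::nat} \<and> card e = 2} = n choose 2"
  using n_subsets[of "{..<n}" 2] by simp

lemma card_unlabelled_of_order_le:
  assumes "iso_closed \<B>"
  shows "card (unlabelled_of_order \<B> n) \<le> 2 ^ (n choose 2)"
proof -
  have fin: "finite {e. e \<subseteq> {..<n} \<and> card e = 2}" by simp
  have "card (unlabelled_of_order \<B> n) \<le> card {G \<in> \<B>. verts G = {..<n}}"
    unfolding unlabelled_of_order_eq[OF assms] by (rule card_image_le[OF finite_graphs_on[OF assms]])
  also have "\<dots> \<le> card ({{..<n}} \<times> Pow {e. e \<subseteq> {..<n} \<and> card e = 2})"
    by (rule card_mono[OF _ graphs_on_subset[OF assms]]) simp
  also have "\<dots> = 2 ^ (n choose 2)"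
    using card_Pow[OF fin] by (simp add: card_cartesian_product card_pairs)
  finally show ?thesis .
qed

text \<open>A transversal of the classes of order \<open>n\<close> on the fixed vertex set
  \<open>{..<n}\<close>, so that codes can be built from concrete graphs.\<close>

lemma ex_representatives:
  assumes "iso_closed \<B>"
  obtains T where "T \<subseteq> {G \<in> \<B>. verts G = {..<n}}" "finite T" "inj_on iso_class T"
    "unlabelled_of_order \<B> n = iso_class ` T" "card T = card (unlabelled_of_order \<B> n)"
    "\<And>G. G \<in> \<B> \<Longrightarrow> graph_order G = n \<Longrightarrow> \<exists>H\<in>T. (G, H) \<in> iso_rel"
proof -
  have "\<exists>T\<subseteq>{G \<in> \<B>. verts G = {..<n}}. inj_on iso_class T \<and> unlabelled_of_order \<B> n = iso_class ` T"
    by (rule subset_image_inj[THEN iffD1]) (simp add: unlabelled_of_order_eq[OF assms])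
  then obtain T where T: "T \<subseteq> {G \<in> \<B>. verts G = {..<n}}" "inj_on iso_class T"
      "unlabelled_of_order \<B> n = iso_class ` T"
    by (elim exE conjE)
  have "\<exists>H\<in>T. (G, H) \<in> iso_rel" if G: "G \<in> \<B>" "graph_order G = n" for G
  proof -
    have "iso_class G \<in> iso_class ` T"
      using T(3) unlabelled_of_order_iff[OF assms] G by blast
    then obtain H where H: "H \<in> T" "iso_class G = iso_class H" by blast
    then have "H \<in> \<B>" using T(1) by blast
    then show ?thesis using H iso_class_eq_iff iso_closed_simple[OF assms] G(1) by blast
  qed
  moreover have "finite T" using T(1) finite_graphs_on[OF assms] finite_subset by blast
  moreover have "card T = card (unlabelled_of_order \<B> n)" using T(2,3) by (simp add: card_image)
  ultimately show thesis using that[OF T(1) _ T(2,3)] by blast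
qed

lemma ex_representative_system:
  assumes "iso_closed \<B>"
  shows "\<exists>T. \<forall>n. T n \<subseteq> {G \<in> \<B>. verts G = {..<n}} \<and> finite (T n) \<and>
    card (T n) = card (unlabelled_of_order \<B> n) \<and>
    (\<forall>G\<in>\<B>. graph_order G = n \<longrightarrow> (\<exists>H\<in>T n. (G, H) \<in> iso_rel))" (is "\<exists>T. \<forall>n. ?P n (T n)")
proof (rule choice, rule allI)
  fix n
  show "\<exists>T. ?P n T"
  proof (rule ex_representatives[OF assms, of n])
    fix T
    assume "T \<subseteq> {G \<in> \<B>. verts G = {..<n}}" "finite T"
      "card T = card (unlabelled_of_order \<B> n)"
      "\<And>G. G \<in> \<B> \<Longrightarrow> graph_order G = n \<Longrightarrow> \<exists>H\<in>T. (G, H) \<in> iso_rel"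
    then have "?P n T" by simp
    then show ?thesis by (rule exI)
  qed
qed

lemma unlabelled_connected_iso_class:
  assumes "simple_graph G"
  shows "unlabelled_connected (iso_class G) \<longleftrightarrow> connected_graph G"
proof
  assume "unlabelled_connected (iso_class G)"
  then show "connected_graph G"
    using iso_refl[OF assms] unfolding unlabelled_connected_def iso_class_def by blast
next
  assume "connected_graph G"
  then show "unlabelled_connected (iso_class G)"
    using iso_connected unfolding unlabelled_connected_def iso_class_def by blast
qed

lemma prob_random_unlabelled:
  assumes "iso_closed \<B>"
  shows "\<P>(R in random_unlabelled \<B> n. Q R) =
    card {R \<in> unlabelled_of_order \<B> n. Q R} / card (unlabelled_of_order \<B> n)"
  unfolding random_unlabelled_def space_uniform_count_measure
  by (rule measure_uniform_count_measure[OF finite_unlabelled_of_order[OF assms]]) blast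

section \<open>Adding an isolated vertex\<close>

definition add_isolated :: "nat \<Rightarrow> ugraph \<Rightarrow> ugraph" where
  "add_isolated n G = (insert n (verts G), edges G)"

lemma simple_add_isolated: "simple_graph G \<Longrightarrow> simple_graph (add_isolated n G)"
  by (auto simp: simple_graph_def add_isolated_def)

lemma not_connected_add_isolated:
  assumes G: "simple_graph G" and n: "n \<notin> verts G"
  shows "\<not> connected_graph (add_isolated n G)"
proof
  assume c: "connected_graph (add_isolated n G)"
  obtain v where v: "v \<in> verts G" using G by (auto simp: simple_graph_def)
  then have "(n, v) \<in> (adj (add_isolated n G))\<^sup>*"
    using c by (auto simp: connected_graph_iff add_isolated_def)
  moreover have "n \<noteq> v" using v n by blast
  ultimately obtain w where "(n, w) \<in> adj (add_isolated n G)" by (blast elim: converse_rtranclE)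
  then have "{n, w} \<in> edges G" by (simp add: adj_def add_isolated_def)
  then show False using simple_edgeD[OF G] n by blast
qed

text \<open>The isomorphism \<open>f\<close> may move \<open>n\<close>; following it by the
  transposition of \<open>f n\<close> and \<open>n\<close> repairs this. Edges are not affected,
  because \<open>f\<close> sends no vertex of an edge to \<open>n\<close> or to
  \<open>f n\<close>.\<close>

lemma iso_add_isolated_cancel:
  assumes G: "simple_graph G" and H: "simple_graph H" and n: "n \<notin> verts G" "n \<notin> verts H"
    and iso: "(add_isolated n G, add_isolated n H) \<in> iso_rel"
  shows "(G, H) \<in> iso_rel"
proof -
  obtain f where f: "bij_betw f (insert n (verts G)) (insert n (verts H))"
      "edges H = (\<lambda>e. f ` e) ` edges G"
    using iso unfolding iso_rel_iff add_isolated_def by auto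
  define g where "g = Transposition.transpose (f n) n \<circ> f"
  have fn: "f n \<in> insert n (verts H)" using f(1) by (auto simp: bij_betw_def)
  have "bij_betw (Transposition.transpose (f n) n) (insert n (verts H)) (insert n (verts H))"
    using fn by (auto intro!: bij_betw_byWitness[where f' = "Transposition.transpose (f n) n"]
        simp: Transposition.transpose_def)
  then have "bij_betw g (insert n (verts G)) (insert n (verts H))"
    unfolding g_def using f(1) bij_betw_trans by blast
  moreover have "g n = n" by (simp add: g_def)
  ultimately have g: "bij_betw g (verts G) (verts H)"
    using notIn_Un_bij_betw3[of n "verts G" g "verts H"] n by simp
  have "g ` e = f ` e" if e: "e \<in> edges G" for e
  proof (rule image_cong)
    fix x assume x: "x \<in> e"
    have sub: "e \<subseteq> verts G" "f ` e \<subseteq> verts H"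
      using e f(2) G H unfolding simple_graph_def by blast+
    then have "f x \<noteq> n" using x n by blast
    moreover have "f x \<noteq> f n"
    proof
      assume eq: "f x = f n"
      have "inj_on f (insert n (verts G))" using f(1) by (simp only: bij_betw_def)
      then have "x = n" using eq by (rule inj_onD) (use x sub(1) in blast)+
      then show False using x sub n by blast
    qed
    ultimately show "g x = f x" by (simp add: g_def)
  qed simp
  then have "edges H = (\<lambda>e. g ` e) ` edges G" unfolding f(2) by (simp cong: image_cong)
  then show ?thesis using G H g iso_rel_iff by blast
qed

text \<open>Adding an isolated vertex is injective on isomorphism classes. This inequality gives the
  lower bound in (a) and drives the growth argument in (b).\<close>

lemma card_disconnected_ge:
  assumes iso: "iso_closed \<B>"
    and add: "\<And>G. G \<in> \<B> \<Longrightarrow> verts G = {..<n} \<Longrightarrow> add_isolated n G \<in> \<B>"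
  shows "card (unlabelled_of_order \<B> n)
    \<le> card {R \<in> unlabelled_of_order \<B> (Suc n). \<not> unlabelled_connected R}"
proof -
  obtain T where T: "T \<subseteq> {G \<in> \<B>. verts G = {..<n}}" "inj_on iso_class T"
      "card T = card (unlabelled_of_order \<B> n)"
    by (rule ex_representatives[OF iso, of n])
  have simple: "simple_graph G" "n \<notin> verts G" "verts G = {..<n}" if "G \<in> T" for G
  proof -
    show "simple_graph G" using that T(1) iso_closed_simple[OF iso] by blast
    show "verts G = {..<n}" using that T(1) by blast
    then show "n \<notin> verts G" by simp
  qed
  have "inj_on (\<lambda>G. iso_class (add_isolated n G)) T"
  proof (rule inj_onI)
    fix G H assume GH: "G \<in> T" "H \<in> T" and "iso_class (add_isolated n G) = iso_class (add_isolated n H)"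
    then have "(add_isolated n G, add_isolated n H) \<in> iso_rel"
      using iso_class_eq_iff[OF simple_add_isolated simple_add_isolated] simple(1) by blast
    then have "(G, H) \<in> iso_rel"
      using iso_add_isolated_cancel[OF simple(1)[OF GH(1)] simple(1)[OF GH(2)]] simple(2) GH by blast
    then have "iso_class G = iso_class H" by (rule iso_classI)
    then show "G = H" using T(2) GH by (simp add: inj_on_eq_iff)
  qed
  moreover have "(\<lambda>G. iso_class (add_isolated n G)) ` T
    \<subseteq> {R \<in> unlabelled_of_order \<B> (Suc n). \<not> unlabelled_connected R}"
  proof (rule image_subsetI)
    fix G assume G: "G \<in> T"
    have "verts (add_isolated n G) = {..<Suc n}"
      using simple(3)[OF G] by (simp add: add_isolated_def lessThan_Suc)
    moreover have "add_isolated n G \<in> \<B>" using add[of G] G T(1) by blast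
    ultimately have "iso_class (add_isolated n G) \<in> unlabelled_of_order \<B> (Suc n)"
      unfolding unlabelled_of_order_eq[OF iso] by blast
    moreover have "\<not> unlabelled_connected (iso_class (add_isolated n G))"
      using not_connected_add_isolated[OF simple(1,2)[OF G]]
        unlabelled_connected_iso_class[OF simple_add_isolated[OF simple(1)[OF G]]] by blast
    ultimately show "iso_class (add_isolated n G)
      \<in> {R \<in> unlabelled_of_order \<B> (Suc n). \<not> unlabelled_connected R}" by blast
  qed
  moreover have "finite {R \<in> unlabelled_of_order \<B> (Suc n). \<not> unlabelled_connected R}"
    using finite_unlabelled_of_order[OF iso] by simp
  ultimately show ?thesis unfolding T(3)[symmetric] by (rule card_inj_on_le)
qed

section \<open>Growth of minor-closed classes\<close>

text \<open>Vertex \<open>i\<close> of \<open>H\<close> is doubled into \<open>2 * i\<close> and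
  \<open>2 * i + 1\<close>. The set deliberately overestimates the possible edges: for each edge of
  \<open>H\<close> it contains all 16 subsets of the four copies of its ends, at a constant cost per
  edge.\<close>

definition blowup_edges :: "ugraph \<Rightarrow> nat set set" where
  "blowup_edges H = (\<lambda>i. {2 * i, 2 * i + 1}) ` verts H \<union>
     (\<Union>e\<in>edges H. Pow ((\<lambda>i. 2 * i) ` e \<union> (\<lambda>i. 2 * i + 1) ` e))"

text \<open>Every vertex has its even copy; \<open>S\<close> marks those onto which another vertex
  was folded, and only these have an odd copy.\<close>

definition blowup_verts :: "nat set \<Rightarrow> nat set \<Rightarrow> nat set" where
  "blowup_verts V S = (\<lambda>i. 2 * i) ` V \<union> (\<lambda>i. 2 * i + 1) ` S"

lemma card_blowup_edges:
  assumes "simple_graph H"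
  shows "finite (blowup_edges H)"
    "card (blowup_edges H) \<le> card (verts H) + 16 * card (edges H)"
proof -
  note fin = simple_graph_finite[OF assms]
  let ?L = "\<lambda>e. (\<lambda>i. 2 * i) ` e \<union> (\<lambda>i::nat. 2 * i + 1) ` e"
  have L: "finite (?L e)" "card (Pow (?L e)) \<le> 16" if "e \<in> edges H" for e
  proof -
    have e: "card e = 2" "finite e"
      using that assms card.infinite[of e] by (fastforce simp: simple_graph_def)+
    then show finL: "finite (?L e)" by simp
    have "card (?L e) \<le> card ((\<lambda>i. 2 * i) ` e) + card ((\<lambda>i::nat. 2 * i + 1) ` e)" by (rule card_Un_le)
    also have "\<dots> \<le> card e + card e" by (intro add_mono card_image_le e)
    finally have "card (?L e) \<le> 4" using e by simp
    then have "(2::nat) ^ card (?L e) \<le> 2 ^ 4" by (intro power_increasing) auto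
    then show "card (Pow (?L e)) \<le> 16" using card_Pow[OF finL] by simp
  qed
  show "finite (blowup_edges H)" unfolding blowup_edges_def using fin L(1) by auto
  have "card (blowup_edges H)
      \<le> card ((\<lambda>i. {2 * i, 2 * i + 1}) ` verts H) + card (\<Union>e\<in>edges H. Pow (?L e))"
    unfolding blowup_edges_def by (rule card_Un_le)
  also have "card ((\<lambda>i. {2 * i, 2 * i + 1}) ` verts H) \<le> card (verts H)"
    by (rule card_image_le[OF fin(1)])
  also have "card (\<Union>e\<in>edges H. Pow (?L e)) \<le> (\<Sum>e\<in>edges H. card (Pow (?L e)))"
    by (rule card_UN_le[OF fin(2)])
  also have "\<dots> \<le> (\<Sum>e\<in>edges H. 16)" using L(2) by (rule sum_mono)
  finally show "card (blowup_edges H) \<le> card (verts H) + 16 * card (edges H)" by simp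
qed

lemma fold_map_image:
  assumes "X \<subseteq> V" "f ` X \<subseteq> V - X"
  shows "fold_map X f ` V = V - X"
proof
  show "fold_map X f ` V \<subseteq> V - X" using assms by (auto simp: fold_map_def)
  show "V - X \<subseteq> fold_map X f ` V"
    by (rule subsetI, rule image_eqI) (auto simp: fold_map_def)
qed

text \<open>Injectivity of \<open>f\<close> limits the fibres of the folding to two vertices, so
  \<open>G\<close> is recovered from \<open>H\<close> by doubling the vertices in \<open>S\<close>
  and selecting edges.\<close>

lemma iso_blowup_subgraph:
  assumes G: "simple_graph G" and X: "X \<subseteq> verts G" "inj_on f X" "f ` X \<subseteq> verts G - X"
    and iso: "(image_graph (fold_map X f) G, H) \<in> iso_rel"
  obtains S F where "S \<subseteq> verts H" "F \<subseteq> blowup_edges H" "(G, (blowup_verts (verts H) S, F)) \<in> iso_rel"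
proof -
  let ?\<pi> = "fold_map X f"
  let ?H = "image_graph ?\<pi> G"
  have simpH: "simple_graph ?H" using simple_graph_image_graph[OF G] .
  obtain \<psi> where \<psi>: "inj_on \<psi> (verts ?H)" "H = image_graph \<psi> ?H"
    using iso by (rule iso_relE)
  have "?\<pi> ` verts G = verts G - X" using fold_map_image[OF X(1,3)] .
  then have vH': "verts ?H = verts G - X" by (simp add: image_graph_def)
  then have vH: "verts H = \<psi> ` (verts G - X)" using \<psi>(2) by (simp add: image_graph_def)
  have inj\<psi>: "\<psi> u = \<psi> v \<longleftrightarrow> u = v" if "u \<in> verts G - X" "v \<in> verts G - X" for u v
    using \<psi>(1) that unfolding vH' by (rule inj_on_eq_iff)
  have \<pi>: "?\<pi> v \<in> verts G - X" if "v \<in> verts G" for v using X that by (auto simp: fold_map_def)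
  \<comment> \<open>A vertex outside \<open>X\<close> becomes an even copy; a vertex of
    \<open>X\<close> becomes the odd copy belonging to its partner.\<close>
  define g where "g v = 2 * \<psi> (?\<pi> v) + (if v \<in> X then 1 else 0)" for v
  have g_div: "g v div 2 = \<psi> (?\<pi> v)" "odd (g v) \<longleftrightarrow> v \<in> X" for v by (auto simp: g_def)
  have inj: "inj_on g (verts G)"
  proof (rule inj_onI)
    fix u v assume uv: "u \<in> verts G" "v \<in> verts G" "g u = g v"
    then have "\<psi> (?\<pi> u) = \<psi> (?\<pi> v)" and X_iff: "u \<in> X \<longleftrightarrow> v \<in> X" using g_div by metis+
    then have "?\<pi> u = ?\<pi> v" using inj\<psi>[OF \<pi>[OF uv(1)] \<pi>[OF uv(2)]] by blast
    then show "u = v" using X_iff X(2) by (auto simp: fold_map_def inj_on_eq_iff split: if_splits)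
  qed
  let ?S = "\<psi> ` f ` X"
  have S: "?S \<subseteq> verts H" using X(3) unfolding vH by blast
  have "g ` verts G = blowup_verts (verts H) ?S"
  proof -
    have "g ` (verts G - X) = (\<lambda>i. 2 * i) ` \<psi> ` (verts G - X)"
      unfolding image_image by (rule image_cong) (auto simp: g_def fold_map_def)
    moreover have "g ` X = (\<lambda>i. 2 * i + 1) ` \<psi> ` f ` X"
      unfolding image_image by (rule image_cong) (auto simp: g_def fold_map_def)
    moreover have "g ` verts G = g ` (verts G - X) \<union> g ` X" using X(1) by blast
    ultimately show ?thesis unfolding blowup_verts_def vH by simp
  qed
  then have v: "verts (image_graph g G) = blowup_verts (verts H) ?S" by (simp add: image_graph_def)
  have E: "edges (image_graph g G) \<subseteq> blowup_edges H"
  proof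
    fix e assume "e \<in> edges (image_graph g G)"
    then obtain e' where e': "e' \<in> edges G" "e = g ` e'" by (auto simp: image_graph_def)
    then obtain u v where uv: "e' = {u, v}" "u \<noteq> v" "u \<in> verts G" "v \<in> verts G"
      by (blast elim: simple_edgeE[OF G])
    have e: "e = {g u, g v}" using e' uv by simp
    show "e \<in> blowup_edges H"
    proof (cases "?\<pi> u = ?\<pi> v")
      case True
      let ?i = "\<psi> (?\<pi> u)"
      have "g u \<noteq> g v" using inj uv by (simp add: inj_on_eq_iff)
      then consider "u \<in> X" "v \<notin> X" | "u \<notin> X" "v \<in> X"
        using True by (auto simp: g_def split: if_splits)
      then have "e = {2 * ?i, 2 * ?i + 1}"
        unfolding e using True by cases (simp_all add: g_def insert_commute)
      moreover have "?i \<in> verts H" using \<pi>[OF uv(3)] unfolding vH by blast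
      ultimately show ?thesis unfolding blowup_edges_def by blast
    next
      case False
      then have H': "{?\<pi> u, ?\<pi> v} \<in> edges ?H" using e'(1) uv(1) by (intro edge_image_graphI) auto
      have "\<psi> (?\<pi> u) \<noteq> \<psi> (?\<pi> v)" using False inj\<psi>[OF \<pi>[OF uv(3)] \<pi>[OF uv(4)]] by blast
      then have "{\<psi> (?\<pi> u), \<psi> (?\<pi> v)} \<in> edges H" (is "?e \<in> _")
        unfolding \<psi>(2) by (rule edge_image_graphI[OF H'])
      moreover have "e \<subseteq> (\<lambda>i. 2 * i) ` ?e \<union> (\<lambda>i. 2 * i + 1) ` ?e" unfolding e by (auto simp: g_def)
      ultimately show ?thesis unfolding blowup_edges_def by blast
    qed
  qed
  have "image_graph g G = (blowup_verts (verts H) ?S, edges (image_graph g G))"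
    using v by (simp add: prod_eq_iff)
  then have "(G, (blowup_verts (verts H) ?S, edges (image_graph g G))) \<in> iso_rel"
    using iso_image_graph[OF G inj] by simp
  then show thesis using that S E by blast
qed

text \<open>For the base \<open>(2 * b) ^ m\<close>, the gap between the exponents \<open>h\<close>
  and \<open>n\<close> is worth at least \<open>(2 * b) ^ n\<close>. This pays for the
  \<open>b ^ h\<close> codes and for a factor \<open>2 ^ n\<close> that will absorb the summation
  over \<open>h\<close>.\<close>

lemma power_mult_le:
  fixes a b m n h :: nat
  assumes "h \<le> n" "n \<le> m * (n - h)" "1 \<le> b"
  shows "2 ^ n * (((2 * b) ^ m) ^ h * b ^ h) \<le> ((2 * b) ^ m) ^ n"
proof -
  have "2 ^ n * b ^ h \<le> 2 ^ n * b ^ n" using assms by (intro mult_left_mono power_increasing) auto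
  also have "\<dots> = (2 * b) ^ n" by (simp add: power_mult_distrib)
  also have "\<dots> \<le> (2 * b) ^ (m * (n - h))" using assms by (intro power_increasing) auto
  also have "\<dots> = ((2 * b) ^ m) ^ (n - h)" by (simp add: power_mult)
  finally have "((2 * b) ^ m) ^ h * (2 ^ n * b ^ h) \<le> ((2 * b) ^ m) ^ h * ((2 * b) ^ m) ^ (n - h)"
    by (rule mult_left_mono) simp
  also have "\<dots> = ((2 * b) ^ m) ^ n" using assms(1) by (simp flip: power_add)
  finally show ?thesis by (simp add: mult.left_commute)
qed

section \<open>Recursion and exponential bound for the number of classes\<close>

context sparse_minor_closed
begin

lemma iso_closed_class: "iso_closed \<B>"
  unfolding iso_closed_def
proof (intro conjI ballI allI impI)
  show "\<B> \<subseteq> all_graphs" using simple unfolding all_graphs_def by blast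
  show "H \<in> \<B>" if "G \<in> \<B>" "(G, H) \<in> iso_rel" for G H
    using closed[OF that(1) minor_iso[OF that(2)]] .
qed

text \<open>Folding and blowing up show that a class of order \<open>n\<close> is determined by a
  representative \<open>H\<close> of smaller order \<open>h\<close>, a vertex set \<open>S\<close>
  and an edge set \<open>F\<close>.\<close>

lemma card_unlabelled_recursion:
  defines "m \<equiv> 8 * (1 + d + 4 ^ d)"
  assumes n: "4 \<le> n"
  shows "card (unlabelled_of_order \<B> n) \<le>
    (\<Sum>h | h < n \<and> n \<le> m * (n - h). card (unlabelled_of_order \<B> h) * (2 ^ (2 + 16 * d)) ^ h)"
proof -
  obtain T where "\<forall>h. T h \<subseteq> {G \<in> \<B>. verts G = {..<h}} \<and> finite (T h) \<and>
      card (T h) = card (unlabelled_of_order \<B> h) \<and>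
      (\<forall>G\<in>\<B>. graph_order G = h \<longrightarrow> (\<exists>H\<in>T h. (G, H) \<in> iso_rel))"
    using ex_representative_system[OF iso_closed_class] by (rule exE)
  then have T: "\<And>h. T h \<subseteq> {G \<in> \<B>. verts G = {..<h}}" "\<And>h. finite (T h)"
      "\<And>h. card (T h) = card (unlabelled_of_order \<B> h)"
      "\<And>h G. G \<in> \<B> \<Longrightarrow> graph_order G = h \<Longrightarrow> \<exists>H\<in>T h. (G, H) \<in> iso_rel"
    by blast+
  let ?Hs = "{h. h < n \<and> n \<le> m * (n - h)}"
  define code where "code H = (\<lambda>(S, F). iso_class (blowup_verts (verts H) S, F)) `
      (Pow (verts H) \<times> Pow (blowup_edges H))" for H
  \<comment> \<open>The \<open>2 + 16 * d\<close> bits per vertex of \<open>H\<close>: one for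
    \<open>S\<close>, one for the edge between its two copies, and 16 for each of the at most
    \<open>d * h\<close> edges of \<open>H\<close>.\<close>
  have code: "finite (code H)" "card (code H) \<le> (2 ^ (2 + 16 * d)) ^ h" if H: "H \<in> T h" for H h
  proof -
    have HB: "H \<in> \<B>" "verts H = {..<h}" using H T(1) by blast+
    note b = card_blowup_edges[OF simple[OF HB(1)]]
    have fin: "finite (Pow (verts H) \<times> Pow (blowup_edges H))" using b HB by simp
    then show "finite (code H)" unfolding code_def by simp
    have "card (code H) \<le> card (Pow (verts H) \<times> Pow (blowup_edges H))"
      unfolding code_def by (rule card_image_le[OF fin])
    also have "\<dots> = 2 ^ (h + card (blowup_edges H))"
      using b HB by (simp add: card_cartesian_product card_Pow power_add)
    also have "\<dots> \<le> 2 ^ ((2 + 16 * d) * h)"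
      using b(2) sparse[OF HB(1)] HB(2) by (intro power_increasing) (auto simp: algebra_simps)
    finally show "card (code H) \<le> (2 ^ (2 + 16 * d)) ^ h" by (simp only: power_mult)
  qed
  have sub: "unlabelled_of_order \<B> n \<subseteq> (\<Union>h\<in>?Hs. \<Union>H\<in>T h. code H)"
  proof
    fix R assume "R \<in> unlabelled_of_order \<B> n"
    then obtain G where G: "G \<in> \<B>" "graph_order G = n" "R = iso_class G"
      using unlabelled_of_order_iff[OF iso_closed_class] by blast
    then have n': "card (verts G) = n" by (simp add: graph_order_def)
    obtain X f where X: "X \<subseteq> verts G" "inj_on f X" "f ` X \<subseteq> verts G - X" "n \<le> m * card X"
      and B: "image_graph (fold_map X f) G \<in> \<B>"
      using ex_folding[OF G(1)] n unfolding m_def n' by blast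
    have fin: "finite (verts G)" using simple[OF G(1)] simple_graph_finite by blast
    have "fold_map X f ` verts G = verts G - X" using fold_map_image[OF X(1,3)] .
    then have "graph_order (image_graph (fold_map X f) G) = n - card X"
      using X(1) fin n' by (simp add: graph_order_def image_graph_def card_Diff_subset finite_subset)
    then obtain H where H: "H \<in> T (n - card X)" "(image_graph (fold_map X f) G, H) \<in> iso_rel"
      using T(4)[OF B] by blast
    obtain S F where SF: "S \<subseteq> verts H" "F \<subseteq> blowup_edges H"
        "(G, (blowup_verts (verts H) S, F)) \<in> iso_rel"
      using iso_blowup_subgraph[OF simple[OF G(1)] X(1-3) H(2)] by blast
    have "R = iso_class (blowup_verts (verts H) S, F)" using G(3) iso_classI[OF SF(3)] by simp
    then have "R \<in> code H" unfolding code_def using SF(1,2) by (intro image_eqI[of _ _ "(S, F)"]) auto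
    moreover have "n - card X \<in> ?Hs"
    proof -
      have "card X \<le> n" using X(1) fin n' card_mono by blast
      moreover have "card X > 0" using X(4) n by (cases "card X") auto
      ultimately show ?thesis using X(4) n by simp
    qed
    ultimately show "R \<in> (\<Union>h\<in>?Hs. \<Union>H\<in>T h. code H)" using H(1) by blast
  qed
  have finHs: "finite ?Hs" by simp
  have "finite (\<Union>h\<in>?Hs. \<Union>H\<in>T h. code H)"
    using T(2) code(1) finHs by (intro finite_UN_I) auto
  then have "card (unlabelled_of_order \<B> n) \<le> card (\<Union>h\<in>?Hs. \<Union>H\<in>T h. code H)"
    using sub by (rule card_mono)
  also have "\<dots> \<le> (\<Sum>h\<in>?Hs. card (\<Union>H\<in>T h. code H))" by (rule card_UN_le[OF finHs])
  also have "\<dots> \<le> (\<Sum>h\<in>?Hs. card (unlabelled_of_order \<B> h) * (2 ^ (2 + 16 * d)) ^ h)"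
  proof (rule sum_mono)
    fix h
    have "card (\<Union>H\<in>T h. code H) \<le> (\<Sum>H\<in>T h. card (code H))" by (rule card_UN_le[OF T(2)])
    also have "\<dots> \<le> (\<Sum>H\<in>T h. (2 ^ (2 + 16 * d)) ^ h)" using code(2) by (intro sum_mono) blast
    finally show "card (\<Union>H\<in>T h. code H) \<le> card (unlabelled_of_order \<B> h) * (2 ^ (2 + 16 * d)) ^ h"
      by (simp add: T(3))
  qed
  finally show ?thesis .
qed

theorem card_unlabelled_le_power:
  obtains C :: nat where "C > 0" "\<And>n. card (unlabelled_of_order \<B> n) \<le> C ^ n"
proof
  define m where "m = 8 * (1 + d + 4 ^ d)"
  define b :: nat where "b = 2 ^ (2 + 16 * d)"
  define C where "C = (2 * b) ^ m"
  have b: "1 \<le> b" by (simp add: b_def)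
  show "C > 0" using b by (simp add: C_def)
  \<comment> \<open>Folding is available only from order 4 on; smaller orders have at most
    \<open>2 ^ 3\<close> graphs, which \<open>C\<close> exceeds because
    \<open>m \<ge> 8\<close>.\<close>
  have "(2::nat) ^ 8 \<le> 2 ^ m" by (intro power_increasing) (auto simp: m_def)
  also have "\<dots> \<le> C" unfolding C_def using b by (intro power_mono) auto
  finally have C: "256 \<le> C" by simp
  show "card (unlabelled_of_order \<B> n) \<le> C ^ n" for n
  proof (induction n rule: less_induct)
    case (less n)
    show ?case
    proof (cases "n < 4")
      case True
      then consider "n = 0" | "n = 1" | "n = 2" | "n = 3" by linarith
      then have "n = 0 \<or> n \<noteq> 0 \<and> (2::nat) ^ (n choose 2) \<le> 256"
        by cases (auto simp: numeral_2_eq_2 numeral_3_eq_3)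
      then show ?thesis
      proof
        assume "n = 0"
        then show ?thesis using unlabelled_of_order_0[OF iso_closed_class] by simp
      next
        assume n: "n \<noteq> 0 \<and> (2::nat) ^ (n choose 2) \<le> 256"
        have "card (unlabelled_of_order \<B> n) \<le> C"
          using card_unlabelled_of_order_le[OF iso_closed_class, of n] n C by linarith
        also have "C \<le> C ^ n" using n C by (intro self_le_power) auto
        finally show ?thesis .
      qed
    next
      case False
      let ?Hs = "{h. h < n \<and> n \<le> m * (n - h)}"
      have "2 ^ n * card (unlabelled_of_order \<B> n)
          \<le> 2 ^ n * (\<Sum>h\<in>?Hs. card (unlabelled_of_order \<B> h) * b ^ h)"
        using card_unlabelled_recursion[of n] False unfolding m_def b_def by (intro mult_left_mono) auto
      also have "\<dots> \<le> 2 ^ n * (\<Sum>h\<in>?Hs. C ^ h * b ^ h)"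
        using less.IH by (intro mult_left_mono sum_mono mult_right_mono) auto
      also have "\<dots> = (\<Sum>h\<in>?Hs. 2 ^ n * (C ^ h * b ^ h))" by (rule sum_distrib_left)
      also have "\<dots> \<le> (\<Sum>h\<in>?Hs. C ^ n)"
        unfolding C_def using b by (intro sum_mono power_mult_le) auto
      also have "\<dots> \<le> (\<Sum>h\<in>{..<n}. C ^ n)" by (intro sum_mono2) auto
      \<comment> \<open>There are \<open>n\<close> terms, and \<open>n \<le> 2 ^ n\<close> lets the
        extra factor on the left cancel.\<close>
      also have "\<dots> \<le> 2 ^ n * C ^ n" by simp
      finally show ?thesis by simp
    qed
  qed
qed

end

section \<open>Isolated vertices on surfaces\<close>

text \<open>On an open subset of the image the inverse of \<open>h\<close> would be a continuous
  injection into the real axis of the plane. By invariance of domain its range would be open, but no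
  point off the axis belongs to it.\<close>

lemma interior_arc_image:
  fixes h :: "real \<Rightarrow> complex"
  assumes C: "compact C" and h: "continuous_on C h" "inj_on h C"
  shows "interior (h ` C) = {}"
proof (rule ccontr)
  let ?U = "interior (h ` C)"
  assume ne: "?U \<noteq> {}"
  obtain g where "homeomorphism C (h ` C) h g" using homeomorphism_compact[OF C h(1) refl h(2)] by blast
  then have g: "continuous_on (h ` C) g" "\<And>y. y \<in> h ` C \<Longrightarrow> h (g y) = y"
    by (auto simp: homeomorphism_def)
  let ?f = "\<lambda>y. complex_of_real (g y)"
  have cont: "continuous_on ?U ?f"
    by (intro continuous_on_of_real continuous_on_subset[OF g(1)] interior_subset)
  have "inj_on ?f ?U"
  proof (rule inj_onI)
    fix x y assume xy: "x \<in> ?U" "y \<in> ?U" "?f x = ?f y"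
    then have "h (g x) = h (g y)" by simp
    moreover have "x \<in> h ` C" "y \<in> h ` C" using xy interior_subset by blast+
    ultimately show "x = y" using g(2) by metis
  qed
  then have "open (?f ` ?U)" using invariance_of_domain[OF cont open_interior] by blast
  moreover obtain z where z: "z \<in> ?f ` ?U" using ne by blast
  ultimately obtain e where e: "e > 0" "ball z e \<subseteq> ?f ` ?U" using open_contains_ball by blast
  have "z + \<i> * of_real (e / 2) \<in> ball z e" using e(1) by (simp add: dist_norm norm_mult)
  then have "z + \<i> * of_real (e / 2) \<in> ?f ` ?U" using e(2) by blast
  then obtain r where r: "z + \<i> * of_real (e / 2) = complex_of_real r" by blast
  obtain s where s: "z = complex_of_real s" using z by blast
  have "Im (z + \<i> * of_real (e / 2)) = e / 2" unfolding s by simp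
  then show False unfolding r using e(1) by simp
qed

text \<open>Only points of the unit circle are identified, so the open disc sits in every polygon
  surface as a set of singleton classes. The free point is sought there.\<close>

lemma glue_inner:
  assumes "x \<in> ball 0 1"
  shows "glue w `` {x} = {x}"
proof -
  have "y = x" if "(x, y) \<in> (side_pairs w)\<^sup>*" for y
    using that
  proof (cases rule: converse_rtranclE)
    case (step z)
    then have "norm x = 1" by (auto simp: side_pairs_def polygon_side_def)
    then show ?thesis using assms by simp
  qed simp
  then show ?thesis using assms by (auto simp: glue_def)
qed

lemma singleton_in_quotient: "x \<in> ball 0 1 \<Longrightarrow> {x} \<in> cball 0 1 // glue w"
  using quotientI[of x "cball 0 1" "glue w"] glue_inner by auto

lemma openin_polygon_surface_inner:
  assumes "open U" "U \<subseteq> ball 0 1"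
  shows "openin (polygon_surface w) ((\<lambda>x. {x}) ` U)"
proof -
  have "openin (top_of_set (cball 0 1)) U"
    using assms ball_subset_cball[of "0::complex" 1] by (intro open_subset) auto
  then show ?thesis
    unfolding openin_polygon_surface using singleton_in_quotient assms(2) by auto
qed

text \<open>The parameters at which the arc is in the open disc form a relatively open set, so this
  part of the arc need not be compact. Exhausting the parameters by countably many boxes gives
  compact pieces, to which \<open>interior_arc_image\<close> applies.\<close>

lemma countable_closed_cover_of_arc:
  assumes path: "pathin (polygon_surface w) \<gamma>" and inj: "inj_on \<gamma> {0..1}"
  obtains \<K> where "countable \<K>" "\<And>K. K \<in> \<K> \<Longrightarrow> closed K \<and> interior K = {}"
    "\<And>x. x \<in> ball 0 1 \<Longrightarrow> {x} \<in> \<gamma> ` {0..1} \<Longrightarrow> x \<in> \<Union>\<K>"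
proof -
  \<comment> \<open>\<open>the_elem\<close> recovers the point from its singleton class; it is
    meaningful only while the arc is inside the disc, that is, on \<open>?T\<close>.\<close>
  define h where "h t = the_elem (\<gamma> t)" for t
  define P where "P U = {t \<in> {0..1}. \<gamma> t \<in> (\<lambda>x. {x}) ` U}" for U
  let ?T = "P (ball 0 1)"
  have cont: "continuous_map (top_of_set {0..1}) (polygon_surface w) \<gamma>"
    using path by (simp add: pathin_def)
  have opn: "openin (top_of_set {0..1}) (P U)" if "open U" "U \<subseteq> ball 0 1" for U
    using openin_continuous_map_preimage[OF cont openin_polygon_surface_inner[OF that]]
    by (simp add: P_def)
  have h: "continuous_on ?T h"
    unfolding continuous_openin_preimage_eq
  proof (intro allI impI)
    fix U :: "complex set" assume "open U"
    have "?T \<inter> h -` U = P (U \<inter> ball 0 1)" by (auto simp: P_def h_def)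
    moreover have "openin (top_of_set {0..1}) (P (U \<inter> ball 0 1))"
      using \<open>open U\<close> by (intro opn) auto
    moreover have "P (U \<inter> ball 0 1) \<subseteq> ?T" "?T \<subseteq> {0..1}" by (auto simp: P_def)
    ultimately show "openin (top_of_set ?T) (?T \<inter> h -` U)"
      by (metis openin_subset_trans)
  qed
  have h_inj: "inj_on h ?T"
  proof (rule inj_onI)
    fix s t assume st: "s \<in> ?T" "t \<in> ?T" "h s = h t"
    then have "\<gamma> s = {h s}" "\<gamma> t = {h t}" by (auto simp: P_def h_def)
    then have "\<gamma> s = \<gamma> t" using st(3) by simp
    then show "s = t" using inj st(1,2) by (auto simp: P_def dest: inj_onD)
  qed
  obtain Q where Q: "open Q" "?T = {0..1} \<inter> Q"
    using opn[of "ball 0 1"] by (auto simp: openin_open)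
  obtain \<D> where \<D>: "countable \<D>" "\<D> \<subseteq> Pow Q" "\<And>X. X \<in> \<D> \<Longrightarrow> \<exists>a b. X = cbox a b" "\<Union>\<D> = Q"
    by (rule open_countable_Union_open_cbox[OF Q(1)]) blast
  let ?\<K> = "(\<lambda>X. h ` ({0..1} \<inter> X)) ` \<D>"
  show thesis
  proof (rule that[of ?\<K>])
    show "countable ?\<K>" using \<D>(1) by simp
  next
    fix K assume "K \<in> ?\<K>"
    then obtain X where X: "X \<in> \<D>" "K = h ` ({0..1} \<inter> X)" by blast
    obtain a b where "X = cbox a b" using \<D>(3)[OF X(1)] by blast
    then have comp: "compact ({0..1} \<inter> X)" by (simp add: compact_Int)
    have sub: "{0..1} \<inter> X \<subseteq> ?T" using X(1) \<D>(2) Q(2) by blast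
    have hX: "continuous_on ({0..1} \<inter> X) h" "inj_on h ({0..1} \<inter> X)"
      using continuous_on_subset[OF h sub] inj_on_subset[OF h_inj sub] .
    show "closed K \<and> interior K = {}"
      unfolding X(2)
      using compact_imp_closed[OF compact_continuous_image[OF hX(1) comp]] interior_arc_image[OF comp hX]
      by blast
  next
    fix x :: complex assume x: "x \<in> ball 0 1" "{x} \<in> \<gamma> ` {0..1}"
    then obtain t where t: "t \<in> {0..1}" "{x} = \<gamma> t" by blast
    have "\<gamma> t \<in> (\<lambda>x. {x}) ` ball 0 1" using x(1) unfolding t(2)[symmetric] by (rule imageI)
    then have "t \<in> ?T" using t(1) by (simp add: P_def)
    then have "t \<in> Q" using Q(2) by blast
    then obtain X where "X \<in> \<D>" "t \<in> X" using \<D>(4) by blast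
    moreover have "h t = x" unfolding h_def t(2)[symmetric] by simp
    ultimately show "x \<in> \<Union>?\<K>" using t(1) by blast
  qed
qed

text \<open>By Baire, countably many closed sets with empty interior do not cover the open disc.\<close>

lemma ex_point_off_arcs:
  assumes V: "finite V" and E: "finite E"
    and \<gamma>: "\<And>e. e \<in> E \<Longrightarrow> pathin (polygon_surface w) (\<gamma> e) \<and> inj_on (\<gamma> e) {0..1}"
  shows "\<exists>p \<in> topspace (polygon_surface w). p \<notin> \<phi> ` V \<and> (\<forall>e\<in>E. p \<notin> \<gamma> e ` {0..1})"
proof -
  have "\<exists>\<K>. countable \<K> \<and> (\<forall>K\<in>\<K>. closed K \<and> interior K = {}) \<and>
      (\<forall>x\<in>ball 0 1. {x} \<in> \<gamma> e ` {0..1} \<longrightarrow> x \<in> \<Union>\<K>)" if "e \<in> E" for e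
    using countable_closed_cover_of_arc[of w "\<gamma> e"] \<gamma>[OF that] by metis
  then obtain \<K> where \<K>: "\<And>e. e \<in> E \<Longrightarrow> countable (\<K> e)"
      "\<And>e K. e \<in> E \<Longrightarrow> K \<in> \<K> e \<Longrightarrow> closed K \<and> interior K = {}"
      "\<And>e x. e \<in> E \<Longrightarrow> x \<in> ball 0 1 \<Longrightarrow> {x} \<in> \<gamma> e ` {0..1} \<Longrightarrow> x \<in> \<Union>(\<K> e)"
    by metis
  define F where "F = {x::complex. {x} \<in> \<phi> ` V}"
  have "finite ((\<lambda>x. {x}) ` F)" by (rule finite_subset[of _ "\<phi> ` V"]) (use V in \<open>auto simp: F_def\<close>)
  then have F: "finite F" by (rule finite_imageD) simp
  let ?\<G> = "uminus ` insert F (\<Union>e\<in>E. \<K> e)"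
  have "UNIV \<subseteq> closure (\<Inter>?\<G>)"
  proof (rule Baire)
    show "countable ?\<G>" using E \<K>(1) by (auto intro: countable_finite)
    fix T assume "T \<in> ?\<G>"
    then obtain K where K: "T = - K" "K = F \<or> (\<exists>e\<in>E. K \<in> \<K> e)" by blast
    then have "closed K" "interior K = {}"
      using \<K>(2) F finite_imp_closed empty_interior_finite by blast+
    then show "openin (top_of_set UNIV) T \<and> UNIV \<subseteq> closure T"
      unfolding K(1) by (simp add: closure_complement open_Compl)
  qed simp
  then have "0 \<in> closure (\<Inter>?\<G>)" by blast
  then obtain x where x: "x \<in> \<Inter>?\<G>" "dist x 0 < 1" 
    unfolding closure_approachable using zero_less_one by blast
  then have ball: "x \<in> ball 0 1" by (simp add: dist_commute)
  have "{x} \<notin> \<phi> ` V" using x(1) by (auto simp: F_def)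
  moreover have "{x} \<notin> \<gamma> e ` {0..1}" if e: "e \<in> E" for e
  proof
    assume "{x} \<in> \<gamma> e ` {0..1}"
    then obtain K where "K \<in> \<K> e" "x \<in> K" using \<K>(3)[OF e ball] by blast
    moreover have "x \<in> - K" using x(1) e \<open>K \<in> \<K> e\<close> by blast
    ultimately show False by simp
  qed
  moreover have "{x} \<in> topspace (polygon_surface w)"
    using openin_subset[OF openin_polygon_surface_inner[of "ball 0 1" w]] ball by auto
  ultimately show ?thesis by blast
qed

lemma embeds_add_isolated:
  assumes G: "simple_graph G" and n: "n \<notin> verts G" and emb: "embeds_in G (polygon_surface w)"
  shows "embeds_in (add_isolated n G) (polygon_surface w)"
proof -
  let ?S = "polygon_surface w"
  obtain \<phi> \<gamma> where \<phi>: "\<phi> ` verts G \<subseteq> topspace ?S" "inj_on \<phi> (verts G)"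
    and \<gamma>: "\<forall>e\<in>edges G. pathin ?S (\<gamma> e) \<and> inj_on (\<gamma> e) {0..1} \<and>
        {\<gamma> e 0, \<gamma> e 1} = \<phi> ` e \<and> \<gamma> e ` {0<..<1} \<inter> \<phi> ` verts G = {}"
    and disj: "\<forall>e\<in>edges G. \<forall>e'\<in>edges G. e \<noteq> e' \<longrightarrow> \<gamma> e ` {0<..<1} \<inter> \<gamma> e' ` {0<..<1} = {}"
    using emb unfolding embeds_in_def by (elim exE conjE)
  obtain p where p: "p \<in> topspace ?S" "p \<notin> \<phi> ` verts G" "\<forall>e\<in>edges G. p \<notin> \<gamma> e ` {0..1}"
    using ex_point_off_arcs[OF simple_graph_finite[OF G], of w \<gamma> \<phi>] \<gamma> by blast
  let ?\<phi> = "\<phi>(n := p)"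
  have eq: "?\<phi> ` A = \<phi> ` A" if "A \<subseteq> verts G" for A using n that by (intro image_cong) auto
  have im: "?\<phi> ` insert n (verts G) = insert p (\<phi> ` verts G)" using eq[of "verts G"] by auto
  show ?thesis
    unfolding embeds_in_def add_isolated_def fst_conv snd_conv
  proof (intro exI[of _ ?\<phi>] exI[of _ \<gamma>] conjI)
    show "?\<phi> ` insert n (verts G) \<subseteq> topspace ?S" unfolding im using \<phi>(1) p(1) by blast
    show "inj_on ?\<phi> (insert n (verts G))"
    proof -
      have "inj_on ?\<phi> (verts G)" using \<phi>(2) n by (subst inj_on_cong[of _ _ \<phi>]) auto
      then show ?thesis using eq[of "verts G"] p(2) n by (simp add: inj_on_insert)
    qed
    show "\<forall>e\<in>edges G. pathin ?S (\<gamma> e) \<and> inj_on (\<gamma> e) {0..1} \<and> {\<gamma> e 0, \<gamma> e 1} = ?\<phi> ` e \<and>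
        \<gamma> e ` {0<..<1} \<inter> ?\<phi> ` insert n (verts G) = {}"
    proof
      fix e assume e: "e \<in> edges G"
      then have "e \<subseteq> verts G" using G unfolding simple_graph_def by blast
      moreover have "\<gamma> e ` {0<..<1} \<subseteq> \<gamma> e ` {0..1}" by (intro image_mono) auto
      ultimately show "pathin ?S (\<gamma> e) \<and> inj_on (\<gamma> e) {0..1} \<and> {\<gamma> e 0, \<gamma> e 1} = ?\<phi> ` e \<and>
        \<gamma> e ` {0<..<1} \<inter> ?\<phi> ` insert n (verts G) = {}"
        unfolding im using bspec[OF \<gamma> e] bspec[OF p(3) e] eq[of e] by (auto simp del: fun_upd_apply)
    qed
  qed (rule disj)
qed

section \<open>Isolated vertices and the class of minors\<close>

text \<open>If \<open>n\<close> lies in a branch set, connectedness makes that set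
  \<open>{n}\<close>, so the corresponding vertex \<open>x\<close> of the minor \<open>H\<close> is
  isolated. Then \<open>H\<close> without \<open>x\<close> is a minor of \<open>G\<close>, and
  closure of \<open>A\<close> under isolated vertices restores \<open>H\<close>. If \<open>n\<close>
  lies in no branch set, \<open>H\<close> is itself a minor of \<open>G\<close>.\<close>

lemma Minor_add_isolated:
  assumes A: "\<And>H x. H \<in> A \<Longrightarrow> x \<notin> verts H \<Longrightarrow> add_isolated x H \<in> A"
    and G: "G \<in> Minor A" and n: "n \<notin> verts G"
  shows "add_isolated n G \<in> Minor A"
proof -
  have simpG: "simple_graph G" using G unfolding Minor_def by blast
  note simpG' = simple_add_isolated[OF simpG, of n]
  have minorA: "H \<in> A" if "minor_of H G" for H using G that unfolding Minor_def by blast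
  have "H \<in> A" if minorH: "minor_of H (add_isolated n G)" for H
  proof -
    have simpH: "simple_graph H" using minorH minor_of_iff by blast
    obtain \<beta> where "branch_map \<beta> H (add_isolated n G)" using minorH minor_of_iff by blast
    note \<beta> = branch_mapD[OF this]
    have edges_eq: "edges (add_isolated n G) = edges G" "verts (add_isolated n G) = insert n (verts G)"
      by (simp_all add: add_isolated_def)
    have ind: "induced (add_isolated n G) B = induced G B" for B
      by (simp add: induced_def edges_eq)
    have no_edge: "{n, v} \<notin> edges G" for v using simple_edgeD(2)[OF simpG] n by blast
    have edge: "\<exists>u\<in>\<beta> x. \<exists>v\<in>\<beta> y. {u, v} \<in> edges G" if "{x, y} \<in> edges H" for x y
      using \<beta>(4)[OF that] unfolding edges_eq .
    show ?thesis
    proof (cases "\<exists>x\<in>verts H. n \<in> \<beta> x")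
      case False
      then have "branch_map \<beta> H G"
        unfolding branch_map_def using \<beta>(1-3) edge unfolding edges_eq ind by blast
      then have "minor_of H G" using simpH simpG minor_of_iff by blast
      then show ?thesis by (rule minorA)
    next
      case True
      then obtain x where x: "x \<in> verts H" "n \<in> \<beta> x" by blast
      have "\<beta> x = {n}"
      proof (rule ccontr)
        assume "\<beta> x \<noteq> {n}"
        then obtain v where v: "v \<in> \<beta> x" "v \<noteq> n" using x(2) by blast
        have "(n, v) \<in> (adj (induced G (\<beta> x)))\<^sup>*"
          using \<beta>(2)[OF x(1)] v(1) x(2) unfolding ind connected_graph_iff induced_simps by blast
        then obtain w where "(n, w) \<in> adj (induced G (\<beta> x))"
          using v(2) by (blast elim: converse_rtranclE)
        then show False using no_edge by (simp add: adj_def)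
      qed
      then have no_edge_x: "{x, y} \<notin> edges H" for y
        using edge[of x y] no_edge unfolding \<open>\<beta> x = {n}\<close> by blast
      let ?V = "verts H - {x}"
      have sub: "\<beta> y \<subseteq> verts G" if "y \<in> ?V" for y
        using \<beta>(1)[of y] \<beta>(3)[of x y] that x unfolding edges_eq by blast
      show ?thesis
      \<comment> \<open>Deleting \<open>x\<close> from a one-vertex \<open>H\<close> would leave the
        null graph; such an \<open>H\<close> is a minor of \<open>G\<close> through any single
        vertex.\<close>
      proof (cases "?V = {}")
        case True
        then have V: "verts H = {x}" using x by blast
        obtain v where v: "v \<in> verts G" using simpG unfolding simple_graph_def by blast
        have "{a, b} \<notin> edges H" for a b using no_edge_x[of b] simple_edgeD(2)[OF simpH, of a b] V by auto
        then have "branch_map (\<lambda>_. {v}) H G"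
          unfolding branch_map_def using v V connected_induced_singleton by simp
        then have "minor_of H G" using simpH simpG minor_of_iff by blast
        then show ?thesis by (rule minorA)
      next
        case False
        let ?H = "(?V, edges H)"
        have "e \<subseteq> ?V" if "e \<in> edges H" for e
        proof -
          obtain a b where ab: "e = {a, b}" "a \<in> verts H" "b \<in> verts H"
            using simple_edgeE[OF simpH \<open>e \<in> edges H\<close>] by blast
          moreover have "a \<noteq> x" "b \<noteq> x" using no_edge_x[of b] no_edge_x[of a] that ab(1)
            by (auto simp: insert_commute)
          ultimately show ?thesis by blast
        qed
        then have simpH': "simple_graph ?H"
          using False by (intro simple_graph_subgraph[OF simpH]) auto
        have "branch_map \<beta> ?H G"
          unfolding branch_map_def fst_conv snd_conv using \<beta>(2,3) edge sub unfolding ind by blast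
        then have "minor_of ?H G" using simpH' simpG minor_of_iff by blast
        then have "?H \<in> A" by (rule minorA)
        then have "add_isolated x ?H \<in> A" by (rule A) simp
        moreover have "add_isolated x ?H = H"
          using x(1) by (simp add: add_isolated_def insert_absorb prod_eq_iff)
        ultimately show ?thesis by simp
      qed
    qed
  qed
  then show ?thesis unfolding Minor_def using simpG' by blast
qed

section \<open>The number of unlabelled graphs\<close>

definition pairs :: "nat \<Rightarrow> nat set set" where
  "pairs n = {e. e \<subseteq> {..<n} \<and> card e = 2}"

definition perms :: "nat \<Rightarrow> (nat \<Rightarrow> nat) set" where
  "perms n = {p. p permutes {..<n}}"

definition act :: "(nat \<Rightarrow> nat) \<Rightarrow> nat set set \<Rightarrow> nat set set" where
  "act p E = (\<lambda>e. p ` e) ` E"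

abbreviation number_of_graphs :: "nat \<Rightarrow> nat" where
  "number_of_graphs n \<equiv> card (unlabelled_of_order all_graphs n)"

lemma finite_pairs [simp]: "finite (pairs n)" and card_pairs': "card (pairs n) = n choose 2"
  using card_pairs by (simp_all add: pairs_def)

lemma finite_perms [simp]: "finite (perms n)" and card_perms: "card (perms n) = fact n"
  by (simp_all add: perms_def finite_permutations card_permutations)

lemma act_comp: "act (p \<circ> q) E = act p (act q E)"
  by (simp add: act_def image_image)

lemma act_id: "act id E = E"
  by (simp add: act_def)

lemma act_inv:
  assumes "p \<in> perms n"
  shows "act (inv p) (act p E) = E" "act p (act (inv p) E) = E"
proof -
  have p: "p permutes {..<n}" using assms by (simp add: perms_def)
  show "act (inv p) (act p E) = E" "act p (act (inv p) E) = E"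
    unfolding act_comp[symmetric] permutes_inv_o[OF p] act_id by (rule refl)+
qed

lemma perms_comp: "p \<in> perms n \<Longrightarrow> q \<in> perms n \<Longrightarrow> p \<circ> q \<in> perms n"
  by (simp add: perms_def permutes_compose)

lemma perms_inv: "p \<in> perms n \<Longrightarrow> inv p \<in> perms n"
  by (simp add: perms_def permutes_inv)

lemma image_perm_in_pairs:
  assumes "p \<in> perms n"
  shows "p ` e \<in> pairs n \<longleftrightarrow> e \<in> pairs n"
proof -
  have p: "p permutes {..<n}" using assms by (simp add: perms_def)
  then have "card (p ` e) = card e" using permutes_inj_on[OF p] card_image by blast
  moreover have "p ` e \<subseteq> {..<n} \<longleftrightarrow> e \<subseteq> {..<n}" using permutes_in_image[OF p] by blast
  ultimately show ?thesis by (simp add: pairs_def)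
qed

lemma act_in_Pow:
  assumes "p \<in> perms n" "E \<in> Pow (pairs n)"
  shows "act p E \<in> Pow (pairs n)"
proof -
  have "p ` e \<in> pairs n" if "e \<in> E" for e
    using that assms(2) image_perm_in_pairs[OF assms(1)] by blast
  then show ?thesis by (simp add: act_def image_subset_iff)
qed

lemma simple_on_iff:
  assumes "n > 0"
  shows "simple_graph ({..<n}, E) \<longleftrightarrow> E \<in> Pow (pairs n)"
  using assms by (simp add: simple_graph_def pairs_def lessThan_empty_iff)

lemma iso_iff_act:
  assumes n: "n > 0" and E: "E \<in> Pow (pairs n)" "F \<in> Pow (pairs n)"
  shows "(({..<n}, E), ({..<n}, F)) \<in> iso_rel \<longleftrightarrow> (\<exists>p\<in>perms n. F = act p E)"
proof
  assume "(({..<n}, E), ({..<n}, F)) \<in> iso_rel"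
  then obtain f where f: "bij_betw f {..<n} {..<n}" "F = (\<lambda>e. f ` e) ` E"
    unfolding iso_rel_iff by auto
  define p where "p x = (if x \<in> {..<n} then f x else x)" for x
  have "bij_betw p {..<n} {..<n}" using f(1) by (subst bij_betw_cong[of _ _ f]) (auto simp: p_def)
  then have "p permutes {..<n}" by (rule bij_imp_permutes) (simp add: p_def)
  moreover have "p ` e = f ` e" if "e \<in> E" for e
  proof (rule image_cong)
    fix x assume "x \<in> e"
    then show "p x = f x" using that E(1) by (auto simp: p_def pairs_def)
  qed simp
  then have "act p E = F" unfolding f(2) act_def by (simp cong: image_cong)
  ultimately show "\<exists>p\<in>perms n. F = act p E" by (auto simp: perms_def)
next
  assume "\<exists>p\<in>perms n. F = act p E"
  then obtain p where p: "p permutes {..<n}" "F = (\<lambda>e. p ` e) ` E" by (auto simp: perms_def act_def)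
  then have "bij_betw p {..<n} {..<n}" by (simp add: permutes_imp_bij)
  then show "(({..<n}, E), ({..<n}, F)) \<in> iso_rel"
    unfolding iso_rel_iff using p(2) E simple_on_iff[OF n] by auto
qed

text \<open>The permutations carrying \<open>E\<close> to \<open>F\<close> form a coset of the
  stabiliser of \<open>F\<close>.\<close>

lemma card_cosets:
  assumes "q \<in> perms n" "F = act q E"
  shows "card {p \<in> perms n. act p E = F} = card {p \<in> perms n. act p F = F}"
proof (rule bij_betw_same_card[of "\<lambda>p. p \<circ> inv q"], rule bij_betw_byWitness[where f' = "\<lambda>p. p \<circ> q"])
  have q: "q permutes {..<n}" using assms(1) by (simp add: perms_def)
  show "\<forall>p\<in>{p \<in> perms n. act p E = F}. p \<circ> inv q \<circ> q = p"
    using permutes_inv_o(2)[OF q] by (simp add: comp_assoc)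
  show "\<forall>p\<in>{p \<in> perms n. act p F = F}. p \<circ> q \<circ> inv q = p"
    using permutes_inv_o(1)[OF q] by (simp add: comp_assoc)
  show "(\<lambda>p. p \<circ> inv q) ` {p \<in> perms n. act p E = F} \<subseteq> {p \<in> perms n. act p F = F}"
    using assms act_inv(1)[OF assms(1), of E] by (auto simp: act_comp intro: perms_comp perms_inv)
  show "(\<lambda>p. p \<circ> q) ` {p \<in> perms n. act p F = F} \<subseteq> {p \<in> perms n. act p E = F}"
  proof (rule image_subsetI)
    fix p assume "p \<in> {p \<in> perms n. act p F = F}"
    then have "p \<in> perms n" "act p F = F" by simp_all
    then show "p \<circ> q \<in> {p \<in> perms n. act p E = F}"
      using perms_comp[OF _ assms(1)] by (simp add: act_comp flip: assms(2))
  qed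
qed

text \<open>Burnside's lemma for permutations acting on edge sets: pairs of a permutation and a
  fixed edge set are counted in both orders, and every orbit contributes \<open>fact n\<close> by
  \<open>card_cosets\<close>.\<close>

lemma burnside_graphs:
  assumes n: "n > 0"
  shows "number_of_graphs n * fact n = (\<Sum>p\<in>perms n. card {E \<in> Pow (pairs n). act p E = E})"
proof -
  let ?X = "Pow (pairs n)"
  let ?c = "\<lambda>E. iso_class ({..<n}, E)"
  have classes: "unlabelled_of_order all_graphs n = ?c ` ?X"
  proof -
    have "{G \<in> all_graphs. verts G = {..<n}} = (\<lambda>E. ({..<n}, E)) ` ?X"
    proof (intro set_eqI iffI)
      fix G assume "G \<in> {G \<in> all_graphs. verts G = {..<n}}"
      then have G: "simple_graph G" "verts G = {..<n}" by (simp_all add: all_graphs_def)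
      then have "G = ({..<n}, edges G)" by (simp add: prod_eq_iff)
      then show "G \<in> (\<lambda>E. ({..<n}, E)) ` ?X" using G(1) simple_on_iff[OF n, of "edges G"] by auto
    next
      fix G assume "G \<in> (\<lambda>E. ({..<n}, E)) ` ?X"
      then show "G \<in> {G \<in> all_graphs. verts G = {..<n}}"
        using simple_on_iff[OF n] by (auto simp: all_graphs_def)
    qed
    then show ?thesis unfolding unlabelled_of_order_eq[OF iso_closed_all_graphs] by (simp add: image_image)
  qed
  have orbit: "(\<Sum>E\<in>{E \<in> ?X. ?c E = R}. card {p \<in> perms n. act p E = E}) = fact n"
    if R: "R \<in> ?c ` ?X" for R
  proof -
    obtain E where E: "E \<in> ?X" "R = ?c E" using R by blast
    have iff: "?c F = R \<longleftrightarrow> (\<exists>p\<in>perms n. F = act p E)" if F: "F \<in> ?X" for F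
    proof -
      have "?c F = R \<longleftrightarrow> ?c E = ?c F" unfolding E(2) by auto
      also have "\<dots> \<longleftrightarrow> (({..<n}, E), ({..<n}, F)) \<in> iso_rel"
        using iso_class_eq_iff simple_on_iff[OF n] E(1) F by blast
      finally show ?thesis using iso_iff_act[OF n E(1) F] by simp
    qed
    have orb: "{F \<in> ?X. ?c F = R} = (\<lambda>p. act p E) ` perms n"
    proof (intro set_eqI iffI)
      fix F assume "F \<in> {F \<in> ?X. ?c F = R}"
      then have "F \<in> ?X" "?c F = R" by (simp_all only: mem_Collect_eq)
      then show "F \<in> (\<lambda>p. act p E) ` perms n" using iff[of F] by blast
    next
      fix F assume "F \<in> (\<lambda>p. act p E) ` perms n"
      then obtain p where p: "p \<in> perms n" "F = act p E" by blast
      then have "F \<in> ?X" using act_in_Pow[OF p(1) E(1)] by (simp only:)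
      then show "F \<in> {F \<in> ?X. ?c F = R}" using iff[of F] p by blast
    qed
    have "(\<Sum>F\<in>(\<lambda>p. act p E) ` perms n. card {p \<in> perms n. act p F = F})
        = (\<Sum>F\<in>(\<lambda>p. act p E) ` perms n. card {p \<in> perms n. act p E = F})"
    proof (rule sum.cong[OF refl])
      fix F assume "F \<in> (\<lambda>p. act p E) ` perms n"
      then obtain q where "q \<in> perms n" "F = act q E" by blast
      then show "card {p \<in> perms n. act p F = F} = card {p \<in> perms n. act p E = F}"
        by (rule card_cosets[symmetric])
    qed
    also have "\<dots> = (\<Sum>F\<in>(\<lambda>p. act p E) ` perms n. \<Sum>p\<in>{p \<in> perms n. act p E = F}. 1)" by simp
    also have "\<dots> = (\<Sum>p\<in>perms n. 1)" by (rule sum.group) auto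
    finally show ?thesis unfolding orb by (simp add: card_perms)
  qed
  have "(\<Sum>p\<in>perms n. card {E \<in> ?X. act p E = E})
      = (\<Sum>p\<in>perms n. \<Sum>E\<in>?X. if act p E = E then 1 else 0)"
    by (simp add: sum.If_cases Int_def)
  also have "\<dots> = (\<Sum>E\<in>?X. \<Sum>p\<in>perms n. if act p E = E then 1 else 0)" by (rule sum.swap)
  also have "\<dots> = (\<Sum>E\<in>?X. card {p \<in> perms n. act p E = E})"
    by (simp add: sum.If_cases Int_def)
  also have "\<dots> = (\<Sum>R\<in>?c ` ?X. \<Sum>E\<in>{E \<in> ?X. ?c E = R}. card {p \<in> perms n. act p E = E})"
    by (rule sum.group[symmetric]) auto
  also have "\<dots> = (\<Sum>R\<in>?c ` ?X. fact n)" using orbit by (rule sum.cong[OF refl])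
  also have "\<dots> = number_of_graphs n * fact n" unfolding classes by simp
  finally show ?thesis by simp
qed

section \<open>Graphs fixed by a permutation\<close>

text \<open>For a largest \<open>Z\<close> disjoint from its image, every other point lies in the
  image of \<open>Z\<close> or is mapped into \<open>Z\<close>. Injectivity bounds each of these
  sets by \<open>card Z\<close>. A 3-cycle shows that a third is the right fraction.\<close>

lemma ex_third_disjoint_from_image:
  fixes f :: "'a \<Rightarrow> 'a"
  assumes W: "finite W" and f: "inj_on f W" "\<And>w. w \<in> W \<Longrightarrow> f w \<noteq> w"
  shows "\<exists>Z\<subseteq>W. f ` Z \<inter> Z = {} \<and> card W \<le> 3 * card Z"
proof -
  define P where "P Z \<longleftrightarrow> Z \<subseteq> W \<and> f ` Z \<inter> Z = {}" for Z
  have "P {}" by (simp add: P_def)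
  moreover have "\<forall>Z. P Z \<longrightarrow> card Z < Suc (card W)"
    using card_mono[OF W] by (auto simp: P_def less_Suc_eq_le)
  ultimately obtain Z where Z: "P Z" "\<And>Y. P Y \<Longrightarrow> card Y \<le> card Z"
    using ex_has_greatest_nat[of P "{}" card "Suc (card W)"] by blast
  have ZW: "Z \<subseteq> W" and disj: "f ` Z \<inter> Z = {}" using Z(1) by (auto simp: P_def)
  have finZ: "finite Z" using ZW W finite_subset by blast
  let ?pre = "{w \<in> W. f w \<in> Z}"
  have "W \<subseteq> Z \<union> f ` Z \<union> ?pre"
  proof
    fix w assume w: "w \<in> W"
    show "w \<in> Z \<union> f ` Z \<union> ?pre"
    proof (rule ccontr)
      assume n: "w \<notin> Z \<union> f ` Z \<union> ?pre"
      then have "P (insert w Z)" using w ZW disj f(2) by (auto simp: P_def)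
      then have "card (insert w Z) \<le> card Z" by (rule Z(2))
      then show False using n finZ by simp
    qed
  qed
  then have "card W \<le> card (Z \<union> f ` Z \<union> ?pre)" using finZ W by (intro card_mono) auto
  also have "\<dots> \<le> card (Z \<union> f ` Z) + card ?pre" by (rule card_Un_le)
  also have "card (Z \<union> f ` Z) \<le> card Z + card (f ` Z)" by (rule card_Un_le)
  also have "card (f ` Z) \<le> card Z" by (rule card_image_le[OF finZ])
  also have "card ?pre \<le> card Z"
  proof (rule card_inj_on_le)
    show "inj_on f ?pre" by (rule inj_on_subset[OF f(1)]) blast
  qed (use finZ in blast)+
  finally have "card W \<le> 3 * card Z" by simp
  then show ?thesis using ZW disj by blast
qed

text \<open>An invariant edge set contains a pair iff it contains the image of the pair. The set
  \<open>Z\<close> consists of moved pairs whose images lie outside \<open>Z\<close>, so membership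
  of its \<open>z\<close> pairs is forced by the rest. For the lower bound on \<open>z\<close>, each
  moved point lies in at least \<open>n - 2\<close> moved pairs, each pair has two points, and
  \<open>Z\<close> is at least a third of the moved pairs.\<close>

lemma card_fixed_graphs:
  assumes p: "p \<in> perms n" and n: "n \<ge> 2"
  shows "\<exists>z. card {E \<in> Pow (pairs n). act p E = E} * 2 ^ z \<le> 2 ^ (n choose 2)
    \<and> card {x. p x \<noteq> x} * (n - 2) \<le> 6 * z"
proof -
  have perm: "p permutes {..<n}" using p by (simp add: perms_def)
  have inj: "inj p" using permutes_inj[OF perm] .
  let ?M = "{x. p x \<noteq> x}"
  have M: "?M \<subseteq> {..<n}" using perm by (auto simp: permutes_def)
  then have finM: "finite ?M" using finite_subset by blast
  define W where "W = {e \<in> pairs n. p ` e \<noteq> e}"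
  have finW: "finite W" by (simp add: W_def)
  have injW: "inj_on (\<lambda>e. p ` e) W" using inj by (auto simp: inj_on_def inj_image_eq_iff)
  obtain Z where Z: "Z \<subseteq> W" "(\<lambda>e. p ` e) ` Z \<inter> Z = {}" "card W \<le> 3 * card Z"
    using ex_third_disjoint_from_image[OF finW injW] by (auto simp: W_def)
  have finZ: "finite Z" using Z(1) finW finite_subset by blast
  have Zp: "Z \<subseteq> pairs n" using Z(1) by (auto simp: W_def)
  have "card ?M * (n - 2) \<le> (\<Sum>x\<in>?M. card {e \<in> W. x \<in> e})"
  proof -
    have "n - 2 \<le> card {e \<in> W. x \<in> e}" if x: "x \<in> ?M" for x
    proof -
      have xn: "x < n" using x M by blast
      \<comment> \<open>For \<open>y\<close> different from \<open>x\<close> and \<open>p x\<close>,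
        the point \<open>p x\<close> is in the image of \<open>{x, y}\<close> but not in
        \<open>{x, y}\<close>, so this pair is moved.\<close>
      let ?Y = "{..<n} - {x, p x}"
      have "(\<lambda>y. {x, y}) ` ?Y \<subseteq> {e \<in> W. x \<in> e}"
      proof (rule image_subsetI)
        fix y assume y: "y \<in> ?Y"
        have "p x \<in> p ` {x, y}" "p x \<notin> {x, y}" using x y by auto
        then have "p ` {x, y} \<noteq> {x, y}" by blast
        moreover have "{x, y} \<in> pairs n" using xn y by (auto simp: pairs_def card_2_iff)
        ultimately show "{x, y} \<in> {e \<in> W. x \<in> e}" by (simp add: W_def)
      qed
      moreover have "inj_on (\<lambda>y. {x, y}) ?Y" by (auto simp: inj_on_def doubleton_eq_iff)
      ultimately have "card ?Y \<le> card {e \<in> W. x \<in> e}"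
        using finW by (intro card_inj_on_le) auto
      moreover have "n - card {x, p x} \<le> card ?Y"
        using diff_card_le_card_Diff[of "{x, p x}" "{..<n}"] by simp
      moreover have "card {x, p x} \<le> 2" by (simp add: card_insert_if)
      ultimately show ?thesis by linarith
    qed
    then show ?thesis using sum_bounded_below[of ?M "n - 2" "\<lambda>x. card {e \<in> W. x \<in> e}"] by simp
  qed
  also have "\<dots> = (\<Sum>x\<in>?M. \<Sum>e\<in>W. if x \<in> e then 1 else 0)"
    using finW by (simp add: sum.If_cases Int_def)
  also have "\<dots> = (\<Sum>e\<in>W. \<Sum>x\<in>?M. if x \<in> e then 1 else 0)" by (rule sum.swap)
  also have "\<dots> \<le> (\<Sum>e\<in>W. 2)"
  proof (rule sum_mono)
    fix e assume "e \<in> W"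
    then have e: "card e = 2" "finite e"
      using finite_subset[of e "{..<n}"] by (auto simp: W_def pairs_def)
    have "card (?M \<inter> e) \<le> card e" using e by (intro card_mono) auto
    then show "(\<Sum>x\<in>?M. if x \<in> e then 1 else 0) \<le> (2::nat)"
      using finM e by (simp add: sum.If_cases)
  qed
  finally have "card ?M * (n - 2) \<le> 6 * card Z" using Z(3) by simp
  moreover have "card {E \<in> Pow (pairs n). act p E = E} * 2 ^ card Z \<le> 2 ^ (n choose 2)"
  proof -
    let ?F = "{E \<in> Pow (pairs n). act p E = E}"
    have mem: "e \<in> E \<longleftrightarrow> p ` e \<in> E" if "act p E = E" for e E
    proof -
      have "p ` e \<in> act p E \<longleftrightarrow> e \<in> E" unfolding act_def using inj by (auto simp: inj_image_eq_iff)
      then show ?thesis using that by simp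
    qed
    have "inj_on (\<lambda>E. E - Z) ?F"
    proof (rule inj_onI)
      fix E E' assume E: "E \<in> ?F" "E' \<in> ?F" "E - Z = E' - Z"
      have out: "e \<in> E \<longleftrightarrow> e \<in> E'" if "e \<notin> Z" for e using E(3) that by blast
      have "e \<in> E \<longleftrightarrow> e \<in> E'" if e: "e \<in> Z" for e
      proof -
        have "p ` e \<notin> Z" using Z(2) e by blast
        then show ?thesis using out[of "p ` e"] mem[of E e] mem[of E' e] E(1,2) by simp
      qed
      then show "E = E'" using out by blast
    qed
    moreover have "(\<lambda>E. E - Z) ` ?F \<subseteq> Pow (pairs n - Z)" by blast
    ultimately have "card ?F \<le> card (Pow (pairs n - Z))" by (rule card_inj_on_le) simp
    also have "\<dots> = 2 ^ ((n choose 2) - card Z)"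
      using finZ Zp by (simp add: card_Pow card_Diff_subset card_pairs')
    finally have "card ?F * 2 ^ card Z \<le> 2 ^ ((n choose 2) - card Z) * 2 ^ card Z" by simp
    moreover have "card Z \<le> n choose 2" using card_mono[OF finite_pairs Zp] by (simp add: card_pairs')
    ultimately show ?thesis by (simp flip: power_add)
  qed
  ultimately show ?thesis by blast
qed

text \<open>Choosing a \<open>k\<close>-set and then any permutation of it covers all cases, with
  \<open>(n choose k) * fact k\<close> choices.\<close>

lemma card_perms_moving:
  "card {p \<in> perms n. card {x. p x \<noteq> x} = k} \<le> n ^ k"
proof -
  let ?A = "{A. A \<subseteq> {..<n} \<and> card A = k}"
  have sub: "{p \<in> perms n. card {x. p x \<noteq> x} = k} \<subseteq> (\<Union>A\<in>?A. {p. p permutes A})"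
  proof
    fix p assume p: "p \<in> {p \<in> perms n. card {x. p x \<noteq> x} = k}"
    then have perm: "p permutes {..<n}" by (simp add: perms_def)
    have "p permutes {x. p x \<noteq> x}" using perm by (auto simp: permutes_def)
    moreover have "{x. p x \<noteq> x} \<subseteq> {..<n}" using perm by (auto simp: permutes_def)
    ultimately show "p \<in> (\<Union>A\<in>?A. {p. p permutes A})" using p by blast
  qed
  have fin: "finite ?A" by simp
  have finA: "finite A" if "A \<in> ?A" for A
    by (rule finite_subset[of _ "{..<n}"]) (use that in auto)
  have "finite (\<Union>A\<in>?A. {p. p permutes A})"
    by (rule finite_UN_I[OF fin]) (rule finite_permutations[OF finA])
  then have "card {p \<in> perms n. card {x. p x \<noteq> x} = k} \<le> card (\<Union>A\<in>?A. {p. p permutes A})"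
    using sub by (rule card_mono)
  also have "\<dots> \<le> (\<Sum>A\<in>?A. card {p. p permutes A})" by (rule card_UN_le[OF fin])
  also have "\<dots> = (\<Sum>A\<in>?A. fact k)"
  proof (rule sum.cong[OF refl])
    fix A assume A: "A \<in> ?A"
    show "card {p. p permutes A} = fact k"
      by (rule card_permutations[OF _ finA[OF A]]) (use A in simp)
  qed
  also have "\<dots> = (n choose k) * fact k" using n_subsets[of "{..<n}" k] by simp
  also have "\<dots> \<le> n ^ k" by (rule binomial_fact_pow)
  finally show ?thesis .
qed

section \<open>Asymptotic number of unlabelled graphs\<close>

text \<open>The number of classes if every graph had trivial automorphism group. At
  \<open>n = 0\<close> it is 1 although there is no graph of order 0, hence the condition
  \<open>n > 0\<close> in the lower bound.\<close>

definition labelled_ratio :: "nat \<Rightarrow> real" where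
  "labelled_ratio n = 2 ^ (n choose 2) / fact n"

lemma labelled_ratio_pos: "labelled_ratio n > 0"
  by (simp add: labelled_ratio_def)

text \<open>The identity alone contributes \<open>2 ^ (n choose 2)\<close> to the Burnside
  sum.\<close>

lemma number_of_graphs_ge:
  assumes "n > 0"
  shows "labelled_ratio n \<le> number_of_graphs n"
proof -
  have "id \<in> perms n" by (simp add: perms_def permutes_id)
  then have "card {E \<in> Pow (pairs n). act id E = E} \<le> number_of_graphs n * fact n"
    unfolding burnside_graphs[OF assms]
    by (rule member_le_sum[of id "perms n" "\<lambda>p. card {E \<in> Pow (pairs n). act p E = E}"]) auto
  moreover have "{E \<in> Pow (pairs n). act id E = E} = Pow (pairs n)" by (simp add: act_id Pow_def)
  ultimately have "2 ^ (n choose 2) \<le> number_of_graphs n * fact n"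
    by (simp add: card_Pow card_pairs')
  then have "real (2 ^ (n choose 2)) \<le> real (number_of_graphs n * fact n)" by (rule of_nat_mono)
  then show ?thesis by (simp add: labelled_ratio_def divide_simps)
qed

text \<open>Group the Burnside sum by the number \<open>k\<close> of moved points: there are at most
  \<open>n ^ k\<close> such permutations, and each fixes at most a fraction \<open>y ^ k\<close> of
  all graphs, where \<open>y = 2 powr (- (real n - 2) / 6)\<close>. With \<open>x = n * y\<close>
  the sum is dominated by a geometric series.\<close>

lemma number_of_graphs_le:
  assumes n: "n \<ge> 2"
  defines "x \<equiv> n * 2 powr (- (real n - 2) / 6)"
  assumes x: "x < 1"
  shows "number_of_graphs n \<le> labelled_ratio n / (1 - x)"
proof -
  define y where "y = 2 powr (- (real n - 2) / 6)"
  let ?m = "\<lambda>p::nat\<Rightarrow>nat. card {x. p x \<noteq> x}"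
  have y: "y > 0" by (simp add: y_def)
  have fix_le: "card {E \<in> Pow (pairs n). act p E = E} \<le> 2 ^ (n choose 2) * y ^ ?m p" if p: "p \<in> perms n" for p
  proof -
    obtain z where z: "card {E \<in> Pow (pairs n). act p E = E} * 2 ^ z \<le> 2 ^ (n choose 2)"
      "?m p * (n - 2) \<le> 6 * z" using card_fixed_graphs[OF p n] by blast
    have "real (?m p * (n - 2)) \<le> real (6 * z)" using z(2) by (rule of_nat_mono)
    then have exponent: "- real z \<le> (- (real n - 2) / 6) * real (?m p)"
      using n by (simp add: of_nat_diff field_simps)
    have "real (card {E \<in> Pow (pairs n). act p E = E} * 2 ^ z) \<le> real (2 ^ (n choose 2))"
      using z(1) by (rule of_nat_mono)
    then have "real (card {E \<in> Pow (pairs n). act p E = E}) \<le> 2 ^ (n choose 2) * 2 powr (- real z)"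
      by (simp add: powr_minus powr_realpow divide_simps)
    also have "\<dots> \<le> 2 ^ (n choose 2) * 2 powr ((- (real n - 2) / 6) * real (?m p))"
      using exponent by (intro mult_left_mono powr_mono) auto
    also have "2 powr ((- (real n - 2) / 6) * real (?m p)) = y ^ ?m p"
      unfolding y_def powr_powr[symmetric] by (rule powr_realpow) simp
    finally show ?thesis .
  qed
  have m_le: "?m p \<in> {..n}" if "p \<in> perms n" for p
  proof -
    have "{x. p x \<noteq> x} \<subseteq> {..<n}" using that by (auto simp: perms_def permutes_def)
    then have "?m p \<le> card {..<n}" by (intro card_mono) auto
    then show ?thesis by simp
  qed
  have x0: "0 \<le> x" by (simp add: x_def)
  have "real (number_of_graphs n * fact n) = (\<Sum>p\<in>perms n. real (card {E \<in> Pow (pairs n). act p E = E}))"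
    using n by (simp add: burnside_graphs)
  also have "\<dots> \<le> (\<Sum>p\<in>perms n. 2 ^ (n choose 2) * y ^ ?m p)" using fix_le by (rule sum_mono)
  also have "\<dots> = (\<Sum>k\<in>{..n}. \<Sum>p\<in>{p \<in> perms n. ?m p = k}. 2 ^ (n choose 2) * y ^ ?m p)"
    using m_le by (intro sum.group[symmetric]) auto
  also have "\<dots> = (\<Sum>k\<in>{..n}. 2 ^ (n choose 2) * (card {p \<in> perms n. ?m p = k} * y ^ k))"
    by (intro sum.cong) auto
  also have "\<dots> \<le> (\<Sum>k\<in>{..n}. 2 ^ (n choose 2) * x ^ k)"
  proof (intro sum_mono mult_left_mono)
    fix k
    have "real (card {p \<in> perms n. ?m p = k}) * y ^ k \<le> real (n ^ k) * y ^ k"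
      using card_perms_moving[of n k] y by (intro mult_right_mono of_nat_mono) auto
    also have "\<dots> = x ^ k" by (simp add: x_def y_def power_mult_distrib)
    finally show "real (card {p \<in> perms n. ?m p = k}) * y ^ k \<le> x ^ k" .
  qed simp
  also have "\<dots> = 2 ^ (n choose 2) * (\<Sum>k\<in>{..n}. x ^ k)" by (simp add: sum_distrib_left)
  also have "\<dots> \<le> 2 ^ (n choose 2) * (1 / (1 - x))"
  proof (intro mult_left_mono)
    have "(\<Sum>k\<in>{..n}. x ^ k) \<le> (\<Sum>k. x ^ k)"
      using x x0 by (intro sum_le_suminf summable_geometric) auto
    then show "(\<Sum>k\<in>{..n}. x ^ k) \<le> 1 / (1 - x)" using x x0 by (simp add: suminf_geometric)
  qed simp
  finally show ?thesis using x by (simp add: labelled_ratio_def field_simps)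
qed

lemma number_of_graphs_tendsto:
  "(\<lambda>n. number_of_graphs n / labelled_ratio n) \<longlonglongrightarrow> 1"
proof (rule tendsto_sandwich)
  let ?x = "\<lambda>n. real n * 2 powr (- (real n - 2) / 6)"
  have "((\<lambda>n. ?x n) \<longlongrightarrow> 0) sequentially" by real_asymp
  then have small: "\<forall>\<^sub>F n in sequentially. ?x n < 1" by (rule order_tendstoD) simp
  show "\<forall>\<^sub>F n in sequentially. number_of_graphs n / labelled_ratio n \<le> 1 / (1 - ?x n)"
    using small eventually_ge_at_top[of 2]
  proof eventually_elim
    case (elim n)
    then show ?case
      using number_of_graphs_le[of n] labelled_ratio_pos[of n] by (simp add: divide_simps mult.commute)
  qed
  show "\<forall>\<^sub>F n in sequentially. 1 \<le> number_of_graphs n / labelled_ratio n"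
    using eventually_gt_at_top[of 0]
    by eventually_elim (use number_of_graphs_ge labelled_ratio_pos in \<open>simp add: divide_simps\<close>)
  show "(\<lambda>n. 1 / (1 - ?x n)) \<longlonglongrightarrow> 1" by real_asymp
qed simp

section \<open>Disconnected unlabelled graphs\<close>

lemma choose_two_add: "(k + m) choose 2 = (k choose 2) + (m choose 2) + k * m"
  by (induction m) (simp_all add: numeral_2_eq_2)

text \<open>\<open>S\<close> is a component or its complement, whichever is small enough. The size
  bound keeps a split and its mirror image from both entering the later sum, so the main term occurs
  once.\<close>

lemma disconnected_split:
  assumes G: "simple_graph G" and disc: "\<not> connected_graph G"
  obtains S where "S \<subseteq> verts G" "S \<noteq> {}" "2 * card S \<le> card (verts G)"
    "\<And>e. e \<in> edges G \<Longrightarrow> e \<subseteq> S \<or> e \<subseteq> verts G - S"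
proof -
  have "verts G \<noteq> {}" using G by (simp add: simple_graph_def)
  then obtain u v where uv: "u \<in> verts G" "v \<in> verts G" "(u, v) \<notin> (adj G)\<^sup>*"
    using disc unfolding connected_graph_iff by blast
  define C where "C = {w \<in> verts G. (u, w) \<in> (adj G)\<^sup>*}"
  have C: "C \<subseteq> verts G" "u \<in> C" "v \<in> verts G - C" using uv by (auto simp: C_def)
  have finG: "finite (verts G)" using simple_graph_finite(1)[OF G] .
  have step: "b \<in> C" if "{a, b} \<in> edges G" "a \<in> C" for a b
  proof -
    have "(u, a) \<in> (adj G)\<^sup>*" using that(2) by (simp add: C_def)
    moreover have "(a, b) \<in> adj G" using that(1) by (simp add: adj_def)
    ultimately have "(u, b) \<in> (adj G)\<^sup>*" by (rule rtrancl_into_rtrancl)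
    then show ?thesis using simple_edgeD(3)[OF G that(1)] by (simp add: C_def)
  qed
  have split: "e \<subseteq> C \<or> e \<subseteq> verts G - C" if e: "e \<in> edges G" for e
  proof -
    obtain a b where ab: "e = {a, b}" "a \<in> verts G" "b \<in> verts G"
      using simple_edgeE[OF G e] by blast
    then have "a \<in> C \<longleftrightarrow> b \<in> C" using step[of a b] step[of b a] e by (auto simp: insert_commute)
    then show ?thesis using ab by blast
  qed
  have sum: "card C + card (verts G - C) = card (verts G)"
    using C(1) finG by (metis card_Diff_subset card_mono finite_subset le_add_diff_inverse)
  show thesis
  proof (cases "2 * card C \<le> card (verts G)")
    case True
    then show ?thesis using that[of C] C split by blast
  next
    case False
    then have "2 * card (verts G - C) \<le> card (verts G)" using sum by linarith
    moreover have "verts G - (verts G - C) = C" using C(1) by blast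
    ultimately show ?thesis using that[of "verts G - C"] C split by auto
  qed
qed

text \<open>A disjoint union provided that the vertices of \<open>G\<close> lie below
  \<open>k\<close>, as they do for representatives on \<open>{..<k}\<close>.\<close>

definition graph_sum :: "nat \<Rightarrow> ugraph \<Rightarrow> ugraph \<Rightarrow> ugraph" where
  "graph_sum k G H =
     (verts G \<union> (\<lambda>v. k + v) ` verts H, edges G \<union> (\<lambda>e. (\<lambda>v. k + v) ` e) ` edges H)"

lemma iso_graph_sum:
  assumes G: "simple_graph G" and S: "S \<subseteq> verts G"
    and split: "\<And>e. e \<in> edges G \<Longrightarrow> e \<subseteq> S \<or> e \<subseteq> verts G - S"
    and iso: "(induced G S, H) \<in> iso_rel" "(induced G (verts G - S), K) \<in> iso_rel"
    and H: "verts H = {..<k}"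
  shows "(G, graph_sum k H K) \<in> iso_rel"
proof -
  obtain f where f: "simple_graph (induced G S)" "inj_on f (verts (induced G S))"
      "H = image_graph f (induced G S)"
    using iso(1) by (rule iso_relE)
  obtain g where g: "simple_graph (induced G (verts G - S))" "inj_on g (verts (induced G (verts G - S)))"
      "K = image_graph g (induced G (verts G - S))"
    using iso(2) by (rule iso_relE)
  note Heq = f(3)[unfolded image_graph_inj[OF f(1,2)]]
  note Keq = g(3)[unfolded image_graph_inj[OF g(1,2)]]
  define h where "h v = (if v \<in> S then f v else k + g v)" for v
  have f_less: "f v < k" if "v \<in> S" for v
    using H that unfolding Heq by auto
  have inj: "inj_on h (verts G)"
  proof (rule inj_onI)
    fix u v assume uv: "u \<in> verts G" "v \<in> verts G" "h u = h v"
    consider "u \<in> S" "v \<in> S" | "u \<notin> S" "v \<notin> S" | "u \<in> S" "v \<notin> S" | "u \<notin> S" "v \<in> S" by blast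
    then show "u = v"
    proof cases
      case 1
      then have "f u = f v" using uv by (simp add: h_def)
      then show ?thesis using f(2) 1 by (simp add: inj_on_eq_iff)
    next
      case 2
      then have "g u = g v" using uv by (simp add: h_def)
      then show ?thesis using g(2) 2 uv by (simp add: inj_on_eq_iff)
    next
      case 3
      then show ?thesis using uv(3) f_less[of u] by (simp add: h_def)
    next
      case 4
      then show ?thesis using uv(3) f_less[of v] by (simp add: h_def)
    qed
  qed
  have im_S: "h ` A = f ` A" if "A \<subseteq> S" for A
    using that by (intro image_cong) (auto simp: h_def)
  have im_D: "h ` A = (\<lambda>v. k + v) ` g ` A" if "A \<subseteq> verts G - S" for A
    unfolding image_image using that by (intro image_cong) (auto simp: h_def)
  have "verts G = S \<union> (verts G - S)" using S by blast
  then have "h ` verts G = h ` S \<union> h ` (verts G - S)" by (metis image_Un)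
  then have v: "h ` verts G = verts H \<union> (\<lambda>v. k + v) ` verts K"
    using im_S[of S] im_D[of "verts G - S"] unfolding Heq Keq by simp
  have eS: "edges (induced G S) = {e \<in> edges G. e \<subseteq> S}"
    and eD: "edges (induced G (verts G - S)) = {e \<in> edges G. e \<subseteq> verts G - S}"
    by (simp_all add: induced_def)
  have "edges G = edges (induced G S) \<union> edges (induced G (verts G - S))"
    unfolding eS eD using split by blast
  then have "(\<lambda>e. h ` e) ` edges G
      = (\<lambda>e. h ` e) ` edges (induced G S) \<union> (\<lambda>e. h ` e) ` edges (induced G (verts G - S))"
    by (metis image_Un)
  moreover have "(\<lambda>e. h ` e) ` edges (induced G S) = edges H"
    unfolding Heq snd_conv by (rule image_cong[OF refl]) (simp add: eS im_S)
  moreover have "(\<lambda>e. h ` e) ` edges (induced G (verts G - S)) = (\<lambda>e. (\<lambda>v. k + v) ` e) ` edges K"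
    unfolding Keq snd_conv image_image[of "\<lambda>e. (\<lambda>v. k + v) ` e"]
    by (rule image_cong[OF refl]) (simp add: eD im_D)
  ultimately have "image_graph h G = graph_sum k H K"
    unfolding image_graph_inj[OF G inj] graph_sum_def v by simp
  then show ?thesis using iso_image_graph[OF G inj] by simp
qed

abbreviation number_of_disconnected :: "nat \<Rightarrow> nat" where
  "number_of_disconnected n \<equiv>
     card {R \<in> unlabelled_of_order all_graphs n. \<not> unlabelled_connected R}"

text \<open>A disconnected class is coded by the classes of the two sides of a split. Graphs with
  several splits are overcounted, which is harmless because only \<open>k = 1\<close> matters
  asymptotically.\<close>

lemma number_of_disconnected_le:
  "number_of_disconnected n \<le> (\<Sum>k\<in>{1..n div 2}. number_of_graphs k * number_of_graphs (n - k))"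
proof -
  note iso = iso_closed_all_graphs
  obtain T where "\<forall>h. T h \<subseteq> {G \<in> all_graphs. verts G = {..<h}} \<and> finite (T h) \<and>
      card (T h) = number_of_graphs h \<and>
      (\<forall>G\<in>all_graphs. graph_order G = h \<longrightarrow> (\<exists>H\<in>T h. (G, H) \<in> iso_rel))"
    using ex_representative_system[OF iso] by (rule exE)
  then have T: "\<And>h. T h \<subseteq> {G \<in> all_graphs. verts G = {..<h}}" "\<And>h. finite (T h)"
      "\<And>h. card (T h) = number_of_graphs h"
      "\<And>h G. G \<in> all_graphs \<Longrightarrow> graph_order G = h \<Longrightarrow> \<exists>H\<in>T h. (G, H) \<in> iso_rel"
    by blast+
  let ?D = "{R \<in> unlabelled_of_order all_graphs n. \<not> unlabelled_connected R}"
  define code where "code k = (\<lambda>(H, K). iso_class (graph_sum k H K)) ` (T k \<times> T (n - k))" for k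
  have sub: "?D \<subseteq> (\<Union>k\<in>{1..n div 2}. code k)"
  proof
    fix R assume R: "R \<in> ?D"
    then obtain G where G: "G \<in> all_graphs" "graph_order G = n" "R = iso_class G"
      using unlabelled_of_order_iff[OF iso] by blast
    then have simp: "simple_graph G" by (simp add: all_graphs_def)
    then have disc: "\<not> connected_graph G" using R G(3) unlabelled_connected_iso_class by simp
    obtain S where S: "S \<subseteq> verts G" "S \<noteq> {}" "2 * card S \<le> card (verts G)"
      "\<And>e. e \<in> edges G \<Longrightarrow> e \<subseteq> S \<or> e \<subseteq> verts G - S"
      using disconnected_split[OF simp disc] by blast
    let ?k = "card S"
    have n: "card (verts G) = n" using G(2) by (simp add: graph_order_def)
    have fin: "finite (verts G)" "finite S"
      using simple_graph_finite(1)[OF simp] finite_subset[OF S(1)] by blast+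
    have k: "0 < ?k" "2 * ?k \<le> n" using S(2,3) fin(2) n by (auto simp: card_gt_0_iff)
    have c: "card (verts G - S) = n - ?k" using fin S(1) n by (simp add: card_Diff_subset)
    then have "verts G - S \<noteq> {}" using k by (metis card.empty diff_is_0_eq leD le_add1 mult_2 not_gr_zero add_le_same_cancel1 le_trans)
    then have ind: "induced G S \<in> all_graphs" "induced G (verts G - S) \<in> all_graphs"
      using simple_graph_induced[OF simp] S(1,2) unfolding all_graphs_def by blast+
    obtain H where H: "H \<in> T ?k" "(induced G S, H) \<in> iso_rel"
      using T(4)[OF ind(1), of ?k] by (auto simp: graph_order_def)
    obtain K where K: "K \<in> T (n - ?k)" "(induced G (verts G - S), K) \<in> iso_rel"
      using T(4)[OF ind(2), of "n - ?k"] c by (auto simp: graph_order_def)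
    have "verts H = {..<?k}" using H(1) T(1) by blast
    then have "(G, graph_sum ?k H K) \<in> iso_rel" using iso_graph_sum[OF simp S(1,4) H(2) K(2)] by blast
    then have "R = iso_class (graph_sum ?k H K)" unfolding G(3) by (rule iso_classI)
    then have "R \<in> code ?k" unfolding code_def using H(1) K(1) by (intro image_eqI[of _ _ "(H, K)"]) auto
    moreover have "?k \<in> {1..n div 2}" using k by simp
    ultimately show "R \<in> (\<Union>k\<in>{1..n div 2}. code k)" by blast
  qed
  have "finite (\<Union>k\<in>{1..n div 2}. code k)" unfolding code_def using T(2) by simp
  then have "card ?D \<le> card (\<Union>k\<in>{1..n div 2}. code k)" using sub by (rule card_mono)
  also have "\<dots> \<le> (\<Sum>k\<in>{1..n div 2}. card (code k))" by (rule card_UN_le) simp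
  also have "\<dots> \<le> (\<Sum>k\<in>{1..n div 2}. number_of_graphs k * number_of_graphs (n - k))"
  proof (rule sum_mono)
    fix k
    have "card (code k) \<le> card (T k \<times> T (n - k))" unfolding code_def using T(2) by (intro card_image_le) simp
    then show "card (code k) \<le> number_of_graphs k * number_of_graphs (n - k)"
      by (simp add: card_cartesian_product T(3))
  qed
  finally show ?thesis .
qed

lemma number_of_disconnected_ge:
  assumes "n > 0"
  shows "number_of_graphs (n - 1) \<le> number_of_disconnected n"
proof -
  have "add_isolated (n - 1) G \<in> all_graphs" if "G \<in> all_graphs" for G
    using simple_add_isolated that by (simp add: all_graphs_def)
  then show ?thesis using card_disconnected_ge[OF iso_closed_all_graphs, of "n - 1"] assms by simp
qed

section \<open>Comparing the terms of the sum over splits\<close>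

text \<open>The power of 2 stands for the absent edges between the two sides, the binomial
  coefficient for the distribution of the labels.\<close>

lemma labelled_ratio_mult:
  assumes "k \<le> n"
  shows "labelled_ratio k * labelled_ratio (n - k) = labelled_ratio n * ((n choose k) / 2 ^ (k * (n - k)))"
proof -
  have "n choose 2 = (k choose 2) + ((n - k) choose 2) + k * (n - k)"
    using choose_two_add[of k "n - k"] assms by simp
  moreover have "real (fact n) = fact k * fact (n - k) * (n choose k)"
    using binomial_fact_lemma[OF assms] by (metis of_nat_fact of_nat_mult)
  ultimately show ?thesis using assms by (simp add: labelled_ratio_def power_add field_simps not_less)
qed

lemma labelled_ratio_pred:
  assumes "n > 0"
  shows "labelled_ratio (n - 1) = labelled_ratio n * (n * 2 powr (- real n + 1))"
proof -
  have "labelled_ratio (Suc 0) = 1" by (simp add: labelled_ratio_def numeral_2_eq_2)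
  moreover have "2 powr (- real n + 1) = 1 / 2 ^ (n - 1)"
  proof -
    have "- real n + 1 = - real (n - 1)" using assms by (simp add: of_nat_diff)
    then show ?thesis by (simp only: powr_minus_divide powr_realpow[OF zero_less_numeral])
  qed
  ultimately show ?thesis using labelled_ratio_mult[of 1 n] assms by simp
qed

text \<open>The term \<open>k = 2\<close> is of order \<open>n ^ 2 / 4 ^ n\<close>. For
  \<open>k \<ge> 3\<close>, the estimates \<open>k * (n - k) \<ge> 3 * (n - 3)\<close> and
  \<open>n choose k \<le> 2 ^ n\<close> give at most \<open>512 / 4 ^ n\<close> each.\<close>

lemma sum_binomial_le:
  assumes n: "n \<ge> 6"
  shows "(\<Sum>k\<in>{2..n div 2}. real (n choose k) / 2 ^ (k * (n - k))) \<le> (16 * real n ^ 2 + 512 * n) / 4 ^ n"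
proof -
  let ?f = "\<lambda>k. real (n choose k) / 2 ^ (k * (n - k))"
  have pw: "(2::real) ^ (2 * (n - 2)) = 4 ^ n / 16"
  proof -
    have "n - 2 + 2 = n" using n by simp
    then have "(4::real) ^ n = 4 ^ (n - 2) * 4 ^ 2" by (metis power_add)
    then show ?thesis by (simp add: power_mult)
  qed
  have "?f 2 = 16 * (n choose 2) / 4 ^ n" unfolding pw by simp
  moreover have "real (n choose 2) \<le> n ^ 2"
    using binomial_le_pow[of 2 n] n by (intro of_nat_mono) simp
  ultimately have f2: "?f 2 \<le> 16 * n ^ 2 / 4 ^ n" by (simp add: divide_right_mono)
  have f3: "?f k \<le> 512 / 4 ^ n" if k: "k \<in> {3..n div 2}" for k
  proof -
    have k3: "3 \<le> k" "k + 3 \<le> n" using k n by auto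
    have "3 * (n - 3) \<le> k * (n - k)"
    proof -
      \<comment> \<open>With \<open>k = 3 + a\<close> and \<open>n = k + 3 + b\<close> the two sides
        differ by \<open>a * b\<close>.\<close>
      obtain a where a: "k = 3 + a" using le_Suc_ex[OF k3(1)] by blast
      obtain b where "n = k + 3 + b" using le_Suc_ex[OF k3(2)] by blast
      then have b: "n = k + (3 + b)" by simp
      show ?thesis unfolding b a by (simp add: algebra_simps)
    qed
    then have "(2::real) ^ (3 * (n - 3)) \<le> 2 ^ (k * (n - k))" by (intro power_increasing) auto
    moreover have "real (n choose k) \<le> 2 ^ n"
      using of_nat_mono[OF binomial_le_pow2[of n k], where ?'a = real] by simp
    ultimately have "?f k \<le> 2 ^ n / 2 ^ (3 * (n - 3))" by (intro frac_le) auto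
    also have "(2::real) ^ (3 * (n - 3)) = 8 ^ n / 512"
    proof -
      have "(8::real) ^ n = 8 ^ (n - 3) * 8 ^ 3" 
      proof -
        have "n - 3 + 3 = n" using n by simp
        then show ?thesis by (metis power_add)
      qed
      then show ?thesis by (simp add: power_mult)
    qed
    also have "(8::real) ^ n = 2 ^ n * 4 ^ n" by (simp flip: power_mult_distrib)
    finally show ?thesis by simp
  qed
  have "{2..n div 2} = insert 2 {3..n div 2}" using n by auto
  then have "(\<Sum>k\<in>{2..n div 2}. ?f k) = ?f 2 + (\<Sum>k\<in>{3..n div 2}. ?f k)" by simp
  also have "\<dots> \<le> 16 * n ^ 2 / 4 ^ n + (\<Sum>k\<in>{3..n div 2}. 512 / 4 ^ n)"
    using f2 f3 by (intro add_mono sum_mono)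
  also have "(\<Sum>k\<in>{3..n div 2}. 512 / 4 ^ n) \<le> n * (512 / 4 ^ n :: real)"
  proof -
    have "card {3..n div 2} \<le> n" by simp
    then show ?thesis by (simp add: divide_right_mono)
  qed
  finally show ?thesis by (simp add: add_divide_distrib mult.commute)
qed

text \<open>\<open>number_of_graphs (n - 1)\<close> bounds the disconnected classes from below and,
  up to an error, from above. The quotient of \<open>labelled_ratio\<close> at \<open>n - 1\<close>
  and \<open>n\<close> is exactly the asserted rate, so both bounds tend to 1 after
  normalisation.\<close>

lemma disconnected_fraction_tendsto:
  "(\<lambda>n. (number_of_disconnected n / number_of_graphs n) / (real n * 2 powr (- real n + 1))) \<longlonglongrightarrow> 1"
proof -
  let ?a = "\<lambda>n. real (number_of_graphs n)" and ?r = labelled_ratio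
  let ?d = "\<lambda>n. real (number_of_disconnected n)"
  let ?w = "\<lambda>n. real n * 2 powr (- real n + 1)"
  \<comment> \<open>One constant for all orders is needed, because the sum over splits also involves
    small \<open>k\<close>, where the asymptotic count says nothing.\<close>
  obtain K where "\<forall>n. norm (?a n / ?r n) \<le> K"
    using convergent_imp_Bseq[OF convergentI[OF number_of_graphs_tendsto]] by (auto simp: Bseq_def)
  then have le: "?a n / ?r n \<le> K" for n using abs_le_D1 by (metis real_norm_def)
  have K: "?a n \<le> K * ?r n" for n using labelled_ratio_pos[of n] le[of n] by (simp add: pos_divide_le_eq)
  have K0: "0 \<le> K" using K[of 0] labelled_ratio_pos[of 0]
    by (metis linorder_not_le mult_neg_pos of_nat_0_le_iff order_less_le_trans)
  have shift: "(\<lambda>n. ?a (n - 1) / ?r (n - 1)) \<longlonglongrightarrow> 1"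
    using filterlim_compose[OF number_of_graphs_tendsto filterlim_minus_const_nat_at_top[of 1]] .
  have inv: "(\<lambda>n. ?r n / ?a n) \<longlonglongrightarrow> 1"
    using tendsto_inverse[OF number_of_graphs_tendsto] by simp
  have pred: "?r (n - 1) = ?r n * ?w n" if "n > 0" for n using labelled_ratio_pred[OF that] by simp
  have upper: "?d n \<le> ?a (n - 1) + K\<^sup>2 * ?r n * ((16 * real n ^ 2 + 512 * n) / 4 ^ n)" if n: "n \<ge> 6" for n
  proof -
    have "?d n \<le> (\<Sum>k\<in>{1..n div 2}. ?a k * ?a (n - k))"
      using number_of_disconnected_le[of n] by (metis (no_types, lifting) of_nat_le_iff of_nat_mult of_nat_sum sum.cong)
    also have "{1..n div 2} = insert 1 {2..n div 2}" using n by auto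
    also have "(\<Sum>k\<in>\<dots>. ?a k * ?a (n - k)) = ?a 1 * ?a (n - 1) + (\<Sum>k\<in>{2..n div 2}. ?a k * ?a (n - k))"
      by simp
    also have "?a 1 * ?a (n - 1) \<le> 1 * ?a (n - 1)"
      using card_unlabelled_of_order_le[OF iso_closed_all_graphs, of 1]
      by (intro mult_right_mono) (auto simp: numeral_2_eq_2)
    also have "(\<Sum>k\<in>{2..n div 2}. ?a k * ?a (n - k))
        \<le> (\<Sum>k\<in>{2..n div 2}. K\<^sup>2 * ?r n * (real (n choose k) / 2 ^ (k * (n - k))))"
    proof (rule sum_mono)
      fix k assume k: "k \<in> {2..n div 2}"
      have "?a k * ?a (n - k) \<le> (K * ?r k) * (K * ?r (n - k))"
        using K labelled_ratio_pos[of k] K0 by (intro mult_mono) (auto simp: less_imp_le)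
      also have "\<dots> = K\<^sup>2 * (?r k * ?r (n - k))" by (simp add: power2_eq_square)
      also have "?r k * ?r (n - k) = ?r n * ((n choose k) / 2 ^ (k * (n - k)))"
        using k by (intro labelled_ratio_mult) auto
      finally show "?a k * ?a (n - k) \<le> K\<^sup>2 * ?r n * (real (n choose k) / 2 ^ (k * (n - k)))"
        by (simp add: mult.assoc)
    qed
    also have "\<dots> = K\<^sup>2 * ?r n * (\<Sum>k\<in>{2..n div 2}. real (n choose k) / 2 ^ (k * (n - k)))"
      by (simp add: sum_distrib_left)
    also have "\<dots> \<le> K\<^sup>2 * ?r n * ((16 * real n ^ 2 + 512 * n) / 4 ^ n)"
      using labelled_ratio_pos[of n] by (intro mult_left_mono sum_binomial_le[OF n]) auto
    finally show ?thesis by simp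
  qed
  \<comment> \<open>The error from \<open>k \<ge> 2\<close> relative to the asserted rate, of order
    at most \<open>n / 2 ^ n\<close>.\<close>
  let ?e = "\<lambda>n. K\<^sup>2 * ((16 * real n ^ 2 + 512 * n) / 4 ^ n) / ?w n"
  show ?thesis
  proof (rule tendsto_sandwich)
    show "\<forall>\<^sub>F n in sequentially. (?a (n - 1) / ?r (n - 1)) * (?r n / ?a n) \<le> ?d n / ?a n / ?w n"
      using eventually_gt_at_top[of 1]
    proof eventually_elim
      case (elim n)
      have pos: "?r n > 0" "?w n > 0" using labelled_ratio_pos elim by auto
      have "?a n > 0" using number_of_graphs_ge[of n] pos elim by linarith
      then have "(?a (n - 1) / ?r (n - 1)) * (?r n / ?a n) = ?a (n - 1) / ?a n / ?w n"
        using pred[of n] pos elim by simp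
      also have "\<dots> \<le> ?d n / ?a n / ?w n"
        using number_of_disconnected_ge[of n] elim pos by (intro divide_right_mono) auto
      finally show ?case .
    qed
    show "\<forall>\<^sub>F n in sequentially. ?d n / ?a n / ?w n
        \<le> (?a (n - 1) / ?r (n - 1)) * (?r n / ?a n) + ?e n * (?r n / ?a n)"
      using eventually_ge_at_top[of 6]
    proof eventually_elim
      case (elim n)
      have pos: "?r n > 0" "?w n > 0" using labelled_ratio_pos elim by auto
      have "?a n > 0" using number_of_graphs_ge[of n] pos elim by linarith
      have "?d n / ?a n / ?w n
          \<le> (?a (n - 1) + K\<^sup>2 * ?r n * ((16 * real n ^ 2 + 512 * n) / 4 ^ n)) / ?a n / ?w n"
        using upper[OF elim] pos by (intro divide_right_mono) auto
      also have "\<dots> = (?a (n - 1) / ?r (n - 1)) * (?r n / ?a n) + ?e n * (?r n / ?a n)"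
        using pred[of n] pos elim \<open>?a n > 0\<close> by (simp add: add_divide_distrib mult_ac)
      finally show ?case .
    qed
    show "(\<lambda>n. (?a (n - 1) / ?r (n - 1)) * (?r n / ?a n)) \<longlonglongrightarrow> 1"
      using tendsto_mult[OF shift inv] by simp
    have "?e \<longlonglongrightarrow> 0" by real_asymp
    then show "(\<lambda>n. (?a (n - 1) / ?r (n - 1)) * (?r n / ?a n) + ?e n * (?r n / ?a n)) \<longlonglongrightarrow> 1"
      using tendsto_add[OF tendsto_mult[OF shift inv] tendsto_mult[OF _ inv]] by fastforce
  qed
qed

section \<open>Connectivity of random unlabelled graphs\<close>

lemma embeds_iso:
  assumes iso: "(H, G) \<in> iso_rel" and emb: "embeds_in G S"
  shows "embeds_in H S"
proof -
  obtain g where g: "bij_betw g (verts H) (verts G)" "edges G = (\<lambda>e. g ` e) ` edges H"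
    and H: "simple_graph H"
    using iso unfolding iso_rel_iff by blast
  have im: "g ` verts H = verts G" and inj: "inj_on g (verts H)" using g(1) by (simp_all add: bij_betw_def)
  obtain \<phi> \<gamma> where \<phi>: "\<phi> ` verts G \<subseteq> topspace S" "inj_on \<phi> (verts G)"
    and \<gamma>: "\<forall>e\<in>edges G. pathin S (\<gamma> e) \<and> inj_on (\<gamma> e) {0..1} \<and>
        {\<gamma> e 0, \<gamma> e 1} = \<phi> ` e \<and> \<gamma> e ` {0<..<1} \<inter> \<phi> ` verts G = {}"
    and disj: "\<forall>e\<in>edges G. \<forall>e'\<in>edges G. e \<noteq> e' \<longrightarrow> \<gamma> e ` {0<..<1} \<inter> \<gamma> e' ` {0<..<1} = {}"
    using emb unfolding embeds_in_def by (elim exE conjE)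
  have edge: "g ` e \<in> edges G" if "e \<in> edges H" for e using g(2) that by blast
  show ?thesis
    unfolding embeds_in_def
  proof (intro exI[of _ "\<phi> \<circ> g"] exI[of _ "\<lambda>e. \<gamma> (g ` e)"] conjI)
    show "(\<phi> \<circ> g) ` verts H \<subseteq> topspace S" unfolding image_comp[symmetric] im by (rule \<phi>(1))
    show "inj_on (\<phi> \<circ> g) (verts H)" using comp_inj_on[OF inj] \<phi>(2) im by simp
    show "\<forall>e\<in>edges H. pathin S (\<gamma> (g ` e)) \<and> inj_on (\<gamma> (g ` e)) {0..1} \<and>
        {\<gamma> (g ` e) 0, \<gamma> (g ` e) 1} = (\<phi> \<circ> g) ` e \<and> \<gamma> (g ` e) ` {0<..<1} \<inter> (\<phi> \<circ> g) ` verts H = {}"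
      unfolding image_comp[symmetric] im
    proof
      fix e assume "e \<in> edges H"
      then show "pathin S (\<gamma> (g ` e)) \<and> inj_on (\<gamma> (g ` e)) {0..1} \<and>
        {\<gamma> (g ` e) 0, \<gamma> (g ` e) 1} = \<phi> ` g ` e \<and> \<gamma> (g ` e) ` {0<..<1} \<inter> \<phi> ` verts G = {}"
        by (rule bspec[OF \<gamma> edge])
    qed
    show "\<forall>e\<in>edges H. \<forall>e'\<in>edges H. e \<noteq> e' \<longrightarrow> \<gamma> (g ` e) ` {0<..<1} \<inter> \<gamma> (g ` e') ` {0<..<1} = {}"
    proof (intro ballI impI)
      fix e e' assume e: "e \<in> edges H" "e' \<in> edges H" "e \<noteq> e'"
      then have "e \<subseteq> verts H" "e' \<subseteq> verts H" using H unfolding simple_graph_def by blast+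
      then have "g ` e \<noteq> g ` e'" using e(3) inj_on_image_eq_iff[OF inj] by blast
      then show "\<gamma> (g ` e) ` {0<..<1} \<inter> \<gamma> (g ` e') ` {0<..<1} = {}"
        by (rule disj[rule_format, OF edge[OF e(1)] edge[OF e(2)]])
    qed
  qed
qed

text \<open>Each of the four classes in the theorem is an intersection of two (possibly equal) classes of
  the following form.\<close>

definition genus_class :: "(nat \<Rightarrow> complex set topology \<Rightarrow> bool) \<Rightarrow> (nat \<Rightarrow> nat) \<Rightarrow> ugraph set" where
  "genus_class P g = {G. simple_graph G \<and> (\<exists>e\<le>g (graph_order G). \<exists>S. P e S \<and> embeds_in G S)}"

lemma genus_class_iso:
  assumes "G \<in> genus_class P g" "(G, H) \<in> iso_rel"
  shows "H \<in> genus_class P g"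
proof -
  obtain e S where e: "e \<le> g (graph_order G)" "P e S" "embeds_in G S"
    using assms(1) unfolding genus_class_def by blast
  have "embeds_in H S" using embeds_iso[OF iso_sym[OF assms(2)] e(3)] .
  moreover have "simple_graph H" using assms(2) iso_rel_iff by blast
  moreover have "e \<le> g (graph_order H)" using e(1) iso_order[OF assms(2)] by simp
  ultimately show ?thesis using e(2) unfolding genus_class_def by blast
qed

text \<open>The surface is kept while the order grows by one; monotonicity of \<open>g\<close> on
  positive orders keeps its Euler genus admissible.\<close>

lemma genus_class_add_isolated:
  assumes P: "\<And>e S. P e S \<Longrightarrow> \<exists>w. S = polygon_surface w" and g: "mono_on {1..} g"
    and G: "G \<in> genus_class P g" and x: "x \<notin> verts G"
  shows "add_isolated x G \<in> genus_class P g"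
proof -
  obtain e S where e: "e \<le> g (graph_order G)" "P e S" "embeds_in G S"
    and simp: "simple_graph G"
    using G unfolding genus_class_def by blast
  obtain w where w: "S = polygon_surface w" using P[OF e(2)] by blast
  have emb: "embeds_in (add_isolated x G) S"
    using embeds_add_isolated[OF simp x] e(3) unfolding w by blast
  note fin = simple_graph_finite(1)[OF simp]
  have ord: "graph_order (add_isolated x G) = Suc (graph_order G)"
    using x fin by (simp add: graph_order_def add_isolated_def)
  have "graph_order G \<ge> 1"
    using fin simp by (simp add: graph_order_def simple_graph_def Suc_le_eq card_gt_0_iff)
  then have "g (graph_order G) \<le> g (graph_order (add_isolated x G))"
    unfolding ord by (intro mono_onD[OF g]) auto
  then have "e \<le> g (graph_order (add_isolated x G))" using e(1) by linarith
  then show ?thesis using e(2) emb simple_add_isolated[OF simp] unfolding genus_class_def by blast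
qed

lemma orientable_polygon: "orientable_surface e S \<Longrightarrow> \<exists>w. S = polygon_surface w"
  unfolding orientable_surface_def sphere_with_handles_def by blast

lemma nonorientable_polygon: "nonorientable_surface z e S \<Longrightarrow> \<exists>w. S = polygon_surface w"
  unfolding nonorientable_surface_def sphere_with_crosscaps_def by blast

lemma genus_classes:
  "\<E> g = genus_class (\<lambda>e S. orientable_surface e S \<or> nonorientable_surface False e S) g"
  "\<O>\<E> g = genus_class orientable_surface g"
  "\<N>\<E> z g = genus_class (nonorientable_surface z) g"
  by (simp_all only: \<E>_def \<O>\<E>_def \<N>\<E>_def genus_class_def)

lemma genus_class_cases:
  assumes "A \<in> {\<E> g, \<O>\<E> g, \<N>\<E> z g, \<O>\<E> g \<inter> \<N>\<E> z g}"
  obtains P Q where "A = genus_class P g \<inter> genus_class Q g"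
    "\<And>e S. P e S \<Longrightarrow> \<exists>w. S = polygon_surface w" "\<And>e S. Q e S \<Longrightarrow> \<exists>w. S = polygon_surface w"
proof -
  let ?E = "\<lambda>e S. orientable_surface e S \<or> nonorientable_surface False e S"
  have E: "\<exists>w. S = polygon_surface w" if "?E e S" for e S
    using that orientable_polygon nonorientable_polygon by blast
  note polys = E orientable_polygon nonorientable_polygon
  consider "A = genus_class ?E g \<inter> genus_class ?E g"
    | "A = genus_class orientable_surface g \<inter> genus_class orientable_surface g"
    | "A = genus_class (nonorientable_surface z) g \<inter> genus_class (nonorientable_surface z) g"
    | "A = genus_class orientable_surface g \<inter> genus_class (nonorientable_surface z) g"
    using assms unfolding genus_classes by auto
  then show thesis
  proof cases
    case 1
    then show ?thesis by (rule that) (rule polys; assumption)+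
  next
    case 2
    then show ?thesis by (rule that) (rule polys; assumption)+
  next
    case 3
    then show ?thesis by (rule that) (rule polys; assumption)+
  next
    case 4
    then show ?thesis by (rule that) (rule polys; assumption)+
  qed
qed

lemma unlabelled_eq_all_graphs_iff:
  assumes "iso_closed A"
  shows "unlabelled A = unlabelled all_graphs \<longleftrightarrow> A = all_graphs"
proof
  assume eq: "unlabelled A = unlabelled all_graphs"
  have "G \<in> A" if G: "G \<in> all_graphs" for G
  proof -
    have "iso_class G \<in> unlabelled A"
      unfolding eq using G unfolding unlabelled_def iso_class_def by (rule quotientI)
    then obtain H where H: "H \<in> A" "iso_class G = iso_class H"
      unfolding unlabelled_def iso_class_def by (elim quotientE) blast
    then have "(H, G) \<in> iso_rel"
      using iso_class_eq_iff[of H G] iso_closed_simple[OF assms H(1)] G by (simp add: all_graphs_def)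
    then show ?thesis using iso_closedD[OF assms H(1)] by blast
  qed
  then show "A = all_graphs" using assms unfolding iso_closed_def by blast
qed simp

lemma Minor_all_graphs: "Minor all_graphs = all_graphs"
proof -
  have "simple_graph H" if "minor_of H G" for G H using that minor_of_iff by blast
  then show ?thesis unfolding Minor_def all_graphs_def by (intro Collect_cong) blast
qed

lemma number_of_graphs_pos: "n > 0 \<Longrightarrow> number_of_graphs n > 0"
  using number_of_graphs_ge[of n] labelled_ratio_pos[of n] by linarith

lemma prob_connected_eq:
  assumes "iso_closed \<B>" "unlabelled_of_order \<B> n \<noteq> {}"
  shows "\<P>(R in random_unlabelled \<B> n. unlabelled_connected R)
    = 1 - \<P>(R in random_unlabelled \<B> n. \<not> unlabelled_connected R)"
proof -
  let ?U = "unlabelled_of_order \<B> n"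
  have fin: "finite ?U" by (rule finite_unlabelled_of_order[OF assms(1)])
  have "card ?U = card {R \<in> ?U. unlabelled_connected R} + card {R \<in> ?U. \<not> unlabelled_connected R}"
    using fin by (subst card_Un_disjoint[symmetric]) (auto intro: arg_cong[of _ _ card])
  then have "real (card ?U) = card {R \<in> ?U. unlabelled_connected R} + card {R \<in> ?U. \<not> unlabelled_connected R}"
    by simp
  moreover have "card ?U > 0" using fin assms(2) by (simp add: card_gt_0_iff)
  ultimately show ?thesis
    unfolding prob_random_unlabelled[OF assms(1)] by (simp add: field_simps)
qed

section \<open>The class of all graphs\<close>

lemma prob_disconnected_all_graphs:
  "(\<lambda>n. \<P>(R in random_unlabelled all_graphs n. \<not> unlabelled_connected R))
     \<sim>[sequentially] (\<lambda>n. real n * 2 powr (- real n + 1))"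
  unfolding prob_random_unlabelled[OF iso_closed_all_graphs]
  by (rule asymp_equivI') (rule disconnected_fraction_tendsto)

lemma wvhp_connected_all_graphs:
  "wvhp (\<lambda>n. \<P>(R in random_unlabelled all_graphs n. unlabelled_connected R))"
proof -
  let ?p = "\<lambda>n. \<P>(R in random_unlabelled all_graphs n. \<not> unlabelled_connected R)"
  let ?w = "\<lambda>n. real n * 2 powr (- real n + 1)"
  have "(\<lambda>n. ?p n / ?w n) \<longlonglongrightarrow> 1"
    unfolding prob_random_unlabelled[OF iso_closed_all_graphs] by (rule disconnected_fraction_tendsto)
  then have "\<forall>\<^sub>F n in sequentially. ?p n / ?w n < 2" by (rule order_tendstoD) simp
  \<comment> \<open>Halving the exponent absorbs the polynomial factor, which gives the rate
    constant \<open>ln 2 / 2\<close>.\<close>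
  moreover have "\<forall>\<^sub>F n in sequentially. 2 * ?w n \<le> exp (- (ln 2 / 2) * real n)"
  proof -
    have "\<forall>\<^sub>F n in sequentially. 2 * ?w n \<le> 2 powr (- real n / 2)" by real_asymp
    moreover have "2 powr (- real n / 2) = exp (- (ln 2 / 2) * real n)" for n by (simp add: powr_def)
    ultimately show ?thesis by simp
  qed
  ultimately have "\<forall>\<^sub>F n in sequentially. 1 - exp (- (ln 2 / 2) * real n)
      \<le> \<P>(R in random_unlabelled all_graphs n. unlabelled_connected R)"
    using eventually_gt_at_top[of 0]
  proof eventually_elim
    case (elim n)
    have "?p n \<le> 2 * ?w n" using elim(1,3) by (simp add: divide_less_eq)
    moreover have "unlabelled_of_order all_graphs n \<noteq> {}" using number_of_graphs_pos[OF elim(3)] by auto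
    ultimately show ?case using elim(2) prob_connected_eq[OF iso_closed_all_graphs] by simp
  qed
  then show ?thesis unfolding wvhp_def by (intro exI[of _ "ln 2 / 2"]) simp
qed

section \<open>Proper minor-closed classes\<close>

text \<open>A graph of order \<open>Suc t\<close> outside \<open>A\<close> is, after relabelling, a
  subgraph of the complete graph of that order. Members of \<open>Minor A\<close> therefore exclude
  this complete minor and have at most \<open>2 ^ t\<close> edges per vertex.\<close>

lemma sparse_minor_closed_Minor:
  assumes A: "iso_closed A" "A \<noteq> all_graphs"
  obtains d where "sparse_minor_closed (Minor A) d"
proof -
  obtain G0 where G0: "simple_graph G0" "G0 \<notin> A"
    using A unfolding iso_closed_def all_graphs_def by blast
  obtain K where K: "(G0, K) \<in> iso_rel" "verts K = {..<graph_order G0}"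
    by (rule ex_relabelling[OF G0(1)])
  have simpK: "simple_graph K" using K(1) iso_rel_iff by blast
  then have "graph_order G0 \<noteq> 0" using K(2) unfolding simple_graph_def by auto
  then obtain t where t: "graph_order G0 = Suc t" using not0_implies_Suc by blast
  have "minor_of K (complete_graph (Suc t))"
  proof (rule minor_subgraph[OF simple_complete_graph simpK])
    show "verts K \<subseteq> verts (complete_graph (Suc t))" using K(2) t by (simp add: complete_graph_def)
    show "edges K \<subseteq> edges (complete_graph (Suc t))"
      using simpK K(2) t unfolding simple_graph_def complete_graph_def by simp
  qed
  then have minor: "minor_of G0 (complete_graph (Suc t))"
    using minor_trans minor_iso[OF iso_sym[OF K(1)]] by blast
  have "sparse_minor_closed (Minor A) (2 ^ t)"
  proof
    fix G H assume G: "G \<in> Minor A"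
    show simpG: "simple_graph G" using G unfolding Minor_def by blast
    show "H \<in> Minor A" if "minor_of H G" using Minor_closed[OF G that] .
    show "card (edges G) \<le> 2 ^ t * card (verts G)"
    proof (rule ccontr)
      assume "\<not> ?thesis"
      then have "minor_of (complete_graph (Suc t)) G" by (intro complete_minor_if_dense[OF simpG]) simp
      then have "minor_of G0 G" using minor minor_trans by blast
      then show False using G G0(2) unfolding Minor_def by blast
    qed
  qed
  then show thesis by (rule that)
qed

text \<open>Otherwise disconnected classes would eventually make up less than a fraction
  \<open>1 / b\<close>. They are at least as numerous as all classes of order one less, so the
  counts would grow by a factor \<open>b\<close> at each step, against \<open>C ^ n\<close>.\<close>

lemma liminf_connected_less_1:
  assumes iso: "iso_closed \<B>" and C: "\<And>n. card (unlabelled_of_order \<B> n) \<le> C ^ n"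
    and add: "\<And>G n. G \<in> \<B> \<Longrightarrow> n \<notin> verts G \<Longrightarrow> add_isolated n G \<in> \<B>"
  shows "liminf (\<lambda>n. ereal (\<P>(R in random_unlabelled \<B> n. unlabelled_connected R))) < 1"
proof (rule ccontr)
  let ?U = "\<lambda>n. unlabelled_of_order \<B> n"
  let ?p = "\<lambda>n. \<P>(R in random_unlabelled \<B> n. unlabelled_connected R)"
  \<comment> \<open>The factor 2 makes \<open>b ^ k\<close> exceed \<open>(C + 1) ^ k\<close> by
    \<open>2 ^ k\<close>, which no constant \<open>(C + 1) ^ N\<close> can match. Adding 1 keeps the
    base positive when \<open>C = 0\<close>.\<close>
  define b :: real where "b = 2 * (real C + 1)"
  have b: "b > 0" by (simp add: b_def)
  assume "\<not> ?thesis"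
  then have lim: "1 \<le> liminf (\<lambda>n. ereal (?p n))" by simp
  have "ereal (1 - 1 / b) < 1" using b by (simp add: one_ereal_def)
  then have "\<forall>\<^sub>F n in sequentially. ereal (1 - 1 / b) < ereal (?p n)"
    using lim unfolding le_Liminf_iff by blast
  then obtain N where N: "\<And>n. n \<ge> N \<Longrightarrow> 1 - 1 / b < ?p n"
    unfolding eventually_sequentially by auto
  \<comment> \<open>An order without members would have probability 0, as division by zero yields 0;
    the bound \<open>1 - 1 / b > 0\<close> excludes this.\<close>
  have pos: "card (?U n) > 0" if "n \<ge> N" for n
  proof (rule ccontr)
    assume "\<not> card (?U n) > 0"
    then have "?p n = 0" unfolding prob_random_unlabelled[OF iso] by simp
    moreover have "1 / b < 1" using b by (simp add: b_def)
    ultimately show False using N[OF that] by simp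
  qed
  have step: "b * card (?U n) \<le> card (?U (Suc n))" if n: "n \<ge> N" for n
  proof -
    let ?D = "{R \<in> ?U (Suc n). \<not> unlabelled_connected R}"
    have "1 - card ?D / card (?U (Suc n)) > 1 - 1 / b"
      using N[of "Suc n"] n pos[of "Suc n"] prob_connected_eq[OF iso, of "Suc n"]
      unfolding prob_random_unlabelled[OF iso] by fastforce
    then have "b * card ?D < card (?U (Suc n))" using pos[of "Suc n"] n b by (simp add: field_simps)
    moreover have "card (?U n) \<le> card ?D" using add by (intro card_disconnected_ge[OF iso]) simp
    then have "b * card (?U n) \<le> b * card ?D" using b by simp
    ultimately show ?thesis by linarith
  qed
  have growth: "b ^ k \<le> card (?U (N + k))" for k
  proof (induction k)
    case 0
    then show ?case using pos[of N] by simp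
  next
    case (Suc k)
    have "b ^ Suc k \<le> b * card (?U (N + k))" using Suc b by simp
    also have "\<dots> \<le> card (?U (N + Suc k))" using step[of "N + k"] by simp
    finally show ?case .
  qed
  let ?c = "real C + 1"
  have bound: "2 ^ k \<le> ?c ^ N" for k
  proof -
    have "(2::real) ^ k * ?c ^ k = b ^ k" by (simp only: b_def power_mult_distrib)
    also have "\<dots> \<le> card (?U (N + k))" by (rule growth)
    also have "\<dots> \<le> real C ^ (N + k)" using C[of "N + k"] by (metis of_nat_mono of_nat_power)
    also have "\<dots> \<le> ?c ^ (N + k)" by (intro power_mono) auto
    also have "\<dots> = ?c ^ N * ?c ^ k" by (rule power_add)
    finally show ?thesis by (rule mult_right_le_imp_le) simp
  qed
  obtain k where "?c ^ N < 2 ^ k" using real_arch_pow[of 2 "?c ^ N"] by auto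
  then show False using bound[of k] by simp
qed

theorem theorem41:
  fixes g :: "nat \<Rightarrow> nat" and A :: "ugraph set" and z :: bool
  assumes "A \<in> {\<E> g, \<O>\<E> g, \<N>\<E> z g, \<O>\<E> g \<inter> \<N>\<E> z g}"
  shows "(unlabelled A = unlabelled all_graphs \<longrightarrow>
      wvhp (\<lambda>n. \<P>(R in random_unlabelled (Minor A) n. unlabelled_connected R)) \<and>
      (\<lambda>n. \<P>(R in random_unlabelled (Minor A) n. \<not> unlabelled_connected R))
        \<sim>[sequentially] (\<lambda>n. real n * 2 powr (- real n + 1))) \<and>
    (mono_on {1..} g \<and> unlabelled A \<noteq> unlabelled all_graphs \<longrightarrow>
      liminf (\<lambda>n. ereal (\<P>(R in random_unlabelled (Minor A) n. unlabelled_connected R))) < 1)"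
proof -
  obtain P Q where A: "A = genus_class P g \<inter> genus_class Q g"
    and poly: "\<And>e S. P e S \<Longrightarrow> \<exists>w. S = polygon_surface w" "\<And>e S. Q e S \<Longrightarrow> \<exists>w. S = polygon_surface w"
    using genus_class_cases[OF assms] by blast
  have iso: "iso_closed A"
    unfolding iso_closed_def
  proof (intro conjI ballI allI impI)
    show "A \<subseteq> all_graphs" unfolding A genus_class_def all_graphs_def by blast
    show "H \<in> A" if "G \<in> A" "(G, H) \<in> iso_rel" for G H
      using that genus_class_iso[OF _ that(2)] unfolding A by blast
  qed
  note eq_iff = unlabelled_eq_all_graphs_iff[OF iso]
  show ?thesis
  proof (intro conjI impI)
    assume "unlabelled A = unlabelled all_graphs"
    then have Minor: "Minor A = all_graphs" using eq_iff Minor_all_graphs by simp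
    show "wvhp (\<lambda>n. \<P>(R in random_unlabelled (Minor A) n. unlabelled_connected R))"
      unfolding Minor by (rule wvhp_connected_all_graphs)
    show "(\<lambda>n. \<P>(R in random_unlabelled (Minor A) n. \<not> unlabelled_connected R))
        \<sim>[sequentially] (\<lambda>n. real n * 2 powr (- real n + 1))"
      unfolding Minor by (rule prob_disconnected_all_graphs)
  next
    assume *: "mono_on {1..} g \<and> unlabelled A \<noteq> unlabelled all_graphs"
    then obtain d where "sparse_minor_closed (Minor A) d"
      using sparse_minor_closed_Minor[OF iso] eq_iff by blast
    then obtain C where C: "\<And>n. card (unlabelled_of_order (Minor A) n) \<le> C ^ n"
      using sparse_minor_closed.card_unlabelled_le_power by blast
    have mono: "mono_on {1..} g" using * by (rule conjunct1)
    have add: "add_isolated x H \<in> A" if H: "H \<in> A" and x: "x \<notin> verts H" for H x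
    proof -
      have "H \<in> genus_class P g" "H \<in> genus_class Q g" using H unfolding A by (rule IntD1, rule IntD2)
      then show ?thesis
        unfolding A using genus_class_add_isolated[OF poly(1) mono _ x]
          genus_class_add_isolated[OF poly(2) mono _ x] by (intro IntI)
    qed
    show "liminf (\<lambda>n. ereal (\<P>(R in random_unlabelled (Minor A) n. unlabelled_connected R))) < 1"
    proof (rule liminf_connected_less_1[OF iso_closed_Minor C])
      fix G n assume "G \<in> Minor A" "n \<notin> verts G"
      with add show "add_isolated n G \<in> Minor A" by (rule Minor_add_isolated)
    qed
  qed
qed

end
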